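(* Let $k_0\ge 2$ be a natural number and let $k_n=k_0$ for all $n\ge 1$. Let $\{L_n\}_{n=1}^\infty$ be a strictly increasing sequence of natural numbers with $L_{n+1}-L_n\to\infty$ as $n\to\infty$, and let $\Gamma$ be the spherically homogeneous rooted tree of type $\{L_n,k_n\}_{n=1}^\infty$. Then the essential spectrum of $\Delta$ on $\ell^2(\Gamma)$ contains the interval $[-2,2]$. Moreover, provided the differences $L_{n+1}-L_n$ increase sufficiently rapidly, any spectral measure for $\Delta$ is purely singular continuous on $(-2,2)$. Here "sufficiently rapidly" means that each $L_{n+1}-L_n$ has to be sufficiently large with respect to $\{L_{i+1}-L_i\}_{i<n}$; that is, for each $k_0$ there exist functions $F_n:\mathbb{N}^{n-1}\to\mathbb{N}$ ($n\ge 1$, with $F_1$ a constant) such that the conclusion that any spectral measure for $\Delta$ is purely singular continuous on $(-2,2)$ holds whenever $\{L_n\}_{n=1}^\infty$ is a strictly increasing sequence of natural numbers with $L_{n+1}-L_n\to\infty$ as $n\to\infty$ and, in addition, $L_{n+1}-L_n\ge F_n(L_2-L_1,\dots,L_n-L_{n-1})$ for all $n\ge 1$.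
   Context: Distance $d(x,y)$ between vertices of a tree is the number of edges of the unique path joining them. A rooted tree with root $O$ is spherically homogeneous (SH) if every vertex at distance $j$ from $O$ is connected with exactly $\kappa_j$ vertices at distance $j+1$ from $O$, where $\kappa_j$ depends only on $j$; a locally finite SH rooted tree is uniquely determined by $\{\kappa_j\}_{j=0}^\infty$. Given natural numbers $k_n>1$ and a strictly increasing sequence of natural numbers $L_n$ ($n\ge1$), the SH rooted tree is of type $\{L_n,k_n\}_{n=1}^\infty$ if $\kappa_j=k_n$ when $j=L_n$ for some $n$, and $\kappa_j=1$ otherwise. The Laplacian on $\ell^2(\Gamma)$ (square-summable functions on the vertices) is $(\Delta f)(x)=\sum_{y:\,d(x,y)=1}f(y)$; when $\{k_n\}$ is bounded it is a bounded self-adjoint operator. For $\psi\in\ell^2(\Gamma)$, the spectral measure of $\psi$ is the Borel measure $\mu_\psi$ on $\mathbb{R}$ with $\langle\psi,g(\Delta)\psi\rangle=\int g\,d\mu_\psi$ for bounded Borel $g$. "Purely singular continuous on $(-2,2)$" means that the restriction of the measure to $(-2,2)$ has no atoms and is singular with respect to Lebesgue measure. *)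

theory Defs
  imports "HOL-Analysis.Analysis"
begin

section \<open>Spherically homogeneous rooted trees\<close>

text \<open>A simple graph is a vertex set \<open>V\<close> with an adjacency relation \<open>adj\<close>; the values of
  \<open>adj\<close> outside \<open>V\<close> are irrelevant. A path is the list of its (distinct) vertices.\<close>

definition path_between :: "'v set \<Rightarrow> ('v \<Rightarrow> 'v \<Rightarrow> bool) \<Rightarrow> 'v \<Rightarrow> 'v list \<Rightarrow> 'v \<Rightarrow> bool" where
  "path_between V adj x p y \<longleftrightarrow>
     p \<noteq> [] \<and> hd p = x \<and> last p = y \<and> set p \<subseteq> V \<and> distinct p \<and> successively adj p"

definition tree_graph :: "'v set \<Rightarrow> ('v \<Rightarrow> 'v \<Rightarrow> bool) \<Rightarrow> bool" where
  "tree_graph V adj \<longleftrightarrow>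
     V \<noteq> {} \<and>
     (\<forall>x\<in>V. \<not> adj x x) \<and>
     (\<forall>x\<in>V. \<forall>y\<in>V. adj x y \<longrightarrow> adj y x) \<and>
     (\<forall>x\<in>V. \<forall>y\<in>V. \<exists>!p. path_between V adj x p y)"

definition tree_dist :: "'v set \<Rightarrow> ('v \<Rightarrow> 'v \<Rightarrow> bool) \<Rightarrow> 'v \<Rightarrow> 'v \<Rightarrow> nat" where
  "tree_dist V adj x y = length (THE p. path_between V adj x p y) - 1"

definition SH_rooted_tree ::
    "'v set \<Rightarrow> ('v \<Rightarrow> 'v \<Rightarrow> bool) \<Rightarrow> 'v \<Rightarrow> (nat \<Rightarrow> nat) \<Rightarrow> bool" where
  "SH_rooted_tree V adj rt \<kappa> \<longleftrightarrow>
     tree_graph V adj \<and> rt \<in> V \<and>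
     (\<forall>j. \<forall>x\<in>V. tree_dist V adj rt x = j \<longrightarrow>
        finite {y \<in> V. adj x y \<and> tree_dist V adj rt y = j + 1} \<and>
        card {y \<in> V. adj x y \<and> tree_dist V adj rt y = j + 1} = \<kappa> j)"

text \<open>The sequences \<open>L\<close> and \<open>k\<close> are indexed by \<open>n \<ge> 1\<close>; \<open>L 0\<close> and \<open>k 0\<close> play no role.\<close>

definition SH_rooted_tree_of_type ::
    "'v set \<Rightarrow> ('v \<Rightarrow> 'v \<Rightarrow> bool) \<Rightarrow> 'v \<Rightarrow> (nat \<Rightarrow> nat) \<Rightarrow> (nat \<Rightarrow> nat) \<Rightarrow> bool" where
  "SH_rooted_tree_of_type V adj rt L k \<longleftrightarrow>
     (\<exists>\<kappa>. SH_rooted_tree V adj rt \<kappa> \<and>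
          (\<forall>n\<ge>1. \<kappa> (L n) = k n) \<and> (\<forall>j. j \<notin> L ` {1..} \<longrightarrow> \<kappa> j = 1))"


section \<open>The Hilbert space of square-summable functions and its bounded operators\<close>

text \<open>Functions on \<open>V\<close> are represented by functions on the whole type vanishing off \<open>V\<close>, so
  that equality of functions is equality on \<open>V\<close>. The inner product is linear in the second
  argument.\<close>

definition l2 :: "'v set \<Rightarrow> ('v \<Rightarrow> complex) set" where
  "l2 V = {f. (\<forall>x. x \<notin> V \<longrightarrow> f x = 0) \<and> (\<lambda>x. (cmod (f x))\<^sup>2) summable_on V}"

definition l2_inner :: "'v set \<Rightarrow> ('v \<Rightarrow> complex) \<Rightarrow> ('v \<Rightarrow> complex) \<Rightarrow> complex" where
  "l2_inner V f g = (\<Sum>\<^sub>\<infinity>x\<in>V. cnj (f x) * g x)"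

definition l2_norm :: "'v set \<Rightarrow> ('v \<Rightarrow> complex) \<Rightarrow> real" where
  "l2_norm V f = sqrt (\<Sum>\<^sub>\<infinity>x\<in>V. (cmod (f x))\<^sup>2)"

text \<open>Operators matter only through their action on \<open>l2 V\<close>.\<close>

definition bounded_operator :: "'v set \<Rightarrow> (('v \<Rightarrow> complex) \<Rightarrow> ('v \<Rightarrow> complex)) \<Rightarrow> bool" where
  "bounded_operator V A \<longleftrightarrow>
     (\<forall>f\<in>l2 V. A f \<in> l2 V) \<and>
     (\<forall>f\<in>l2 V. \<forall>g\<in>l2 V. A (\<lambda>x. f x + g x) = (\<lambda>x. A f x + A g x)) \<and>
     (\<forall>c. \<forall>f\<in>l2 V. A (\<lambda>x. c * f x) = (\<lambda>x. c * A f x)) \<and>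
     (\<exists>C. \<forall>f\<in>l2 V. l2_norm V (A f) \<le> C * l2_norm V f)"

definition op_spectrum :: "'v set \<Rightarrow> (('v \<Rightarrow> complex) \<Rightarrow> ('v \<Rightarrow> complex)) \<Rightarrow> complex set" where
  "op_spectrum V A =
     {z. \<not> (\<exists>R. bounded_operator V R \<and>
               (\<forall>f\<in>l2 V. R (\<lambda>x. A f x - z * f x) = f \<and> (\<lambda>x. A (R f) x - z * R f x) = f))}"

definition eigenspace ::
    "'v set \<Rightarrow> (('v \<Rightarrow> complex) \<Rightarrow> ('v \<Rightarrow> complex)) \<Rightarrow> complex \<Rightarrow> ('v \<Rightarrow> complex) set" where
  "eigenspace V A z = {f \<in> l2 V. A f = (\<lambda>x. z * f x)}"

definition finite_dim :: "('v \<Rightarrow> complex) set \<Rightarrow> bool" where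
  "finite_dim S \<longleftrightarrow>
     (\<exists>B. finite B \<and> B \<subseteq> S \<and> (\<forall>f\<in>S. \<exists>c. f = (\<lambda>x. \<Sum>b\<in>B. c b * b x)))"

definition discrete_spectrum ::
    "'v set \<Rightarrow> (('v \<Rightarrow> complex) \<Rightarrow> ('v \<Rightarrow> complex)) \<Rightarrow> complex set" where
  "discrete_spectrum V A =
     {z. z isolated_in op_spectrum V A \<and>
         (\<exists>f\<in>eigenspace V A z. f \<noteq> (\<lambda>x. 0)) \<and> finite_dim (eigenspace V A z)}"

text \<open>The usual definition for self-adjoint operators.\<close>

definition essential_spectrum ::
    "'v set \<Rightarrow> (('v \<Rightarrow> complex) \<Rightarrow> ('v \<Rightarrow> complex)) \<Rightarrow> complex set" where
  "essential_spectrum V A = op_spectrum V A - discrete_spectrum V A"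


section \<open>Borel functional calculus and spectral measures\<close>

definition bounded_borel :: "(real \<Rightarrow> complex) set" where
  "bounded_borel = {g. g \<in> borel_measurable borel \<and> bounded (range g)}"

text \<open>\<open>\<Phi> g\<close> plays the role of \<open>g(A)\<close>. The conditions are those which characterize the Borel
  functional calculus of a bounded self-adjoint operator \<open>A\<close>: it is a norm-decreasing unital
  \<open>*\<close>-homomorphism on the bounded Borel functions, it maps the identity function to \<open>A\<close>, and
  bounded pointwise convergence implies strong convergence. Since the identity is unbounded on
  the real line, the second condition is stated for the bounded Borel functions which agree with
  it on the spectrum of \<open>A\<close>.\<close>

definition borel_functional_calculus ::
    "'v set \<Rightarrow> (('v \<Rightarrow> complex) \<Rightarrow> ('v \<Rightarrow> complex)) \<Rightarrow>
     ((real \<Rightarrow> complex) \<Rightarrow> ('v \<Rightarrow> complex) \<Rightarrow> ('v \<Rightarrow> complex)) \<Rightarrow> bool" where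
  "borel_functional_calculus V A \<Phi> \<longleftrightarrow>
     (\<forall>g\<in>bounded_borel. bounded_operator V (\<Phi> g)) \<and>
     (\<forall>f\<in>l2 V. \<Phi> (\<lambda>t. 1) f = f) \<and>
     (\<forall>g\<in>bounded_borel. \<forall>h\<in>bounded_borel. \<forall>f\<in>l2 V.
        \<Phi> (\<lambda>t. g t + h t) f = (\<lambda>x. \<Phi> g f x + \<Phi> h f x)) \<and>
     (\<forall>c. \<forall>g\<in>bounded_borel. \<forall>f\<in>l2 V. \<Phi> (\<lambda>t. c * g t) f = (\<lambda>x. c * \<Phi> g f x)) \<and>
     (\<forall>g\<in>bounded_borel. \<forall>h\<in>bounded_borel. \<forall>f\<in>l2 V. \<Phi> (\<lambda>t. g t * h t) f = \<Phi> g (\<Phi> h f)) \<and>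
     (\<forall>g\<in>bounded_borel. \<forall>f\<in>l2 V. \<forall>h\<in>l2 V.
        l2_inner V (\<Phi> (\<lambda>t. cnj (g t)) f) h = l2_inner V f (\<Phi> g h)) \<and>
     (\<forall>g\<in>bounded_borel. \<forall>C. (\<forall>t. cmod (g t) \<le> C) \<longrightarrow>
        (\<forall>f\<in>l2 V. l2_norm V (\<Phi> g f) \<le> C * l2_norm V f)) \<and>
     (\<forall>g\<in>bounded_borel. (\<forall>t. complex_of_real t \<in> op_spectrum V A \<longrightarrow> g t = complex_of_real t) \<longrightarrow>
        (\<forall>f\<in>l2 V. \<Phi> g f = A f)) \<and>
     (\<forall>G. \<forall>g\<in>bounded_borel.
        (\<forall>n. G n \<in> bounded_borel) \<and> (\<exists>C. \<forall>n t. cmod (G n t) \<le> C) \<and>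
        (\<forall>t. (\<lambda>n::nat. G n t) \<longlonglongrightarrow> g t) \<longrightarrow>
        (\<forall>f\<in>l2 V. (\<lambda>n. l2_norm V (\<lambda>x. \<Phi> (G n) f x - \<Phi> g f x)) \<longlonglongrightarrow> 0))"

text \<open>Finiteness of \<open>\<mu>\<close> is explicit because the Bochner integral of a non-integrable function
  is \<open>0\<close>, so that it would not follow from the case of constant \<open>g\<close>.\<close>

definition spectral_measure ::
    "'v set \<Rightarrow> (('v \<Rightarrow> complex) \<Rightarrow> ('v \<Rightarrow> complex)) \<Rightarrow> ('v \<Rightarrow> complex) \<Rightarrow> real measure \<Rightarrow> bool" where
  "spectral_measure V A \<psi> \<mu> \<longleftrightarrow>
     sets \<mu> = sets borel \<and> finite_measure \<mu> \<and>
     (\<exists>\<Phi>. borel_functional_calculus V A \<Phi> \<and>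
          (\<forall>g\<in>bounded_borel. l2_inner V \<psi> (\<Phi> g \<psi>) = (\<integral>t. g t \<partial>\<mu>)))"

definition purely_singular_continuous_on :: "real set \<Rightarrow> real measure \<Rightarrow> bool" where
  "purely_singular_continuous_on S \<mu> \<longleftrightarrow>
     (\<forall>t\<in>S. emeasure \<mu> {t} = 0) \<and> (\<exists>N\<in>null_sets lborel. emeasure \<mu> (S - N) = 0)"


section \<open>The Laplacian\<close>

definition laplacian :: "'v set \<Rightarrow> ('v \<Rightarrow> 'v \<Rightarrow> bool) \<Rightarrow> ('v \<Rightarrow> complex) \<Rightarrow> ('v \<Rightarrow> complex)" where
  "laplacian V adj f = (\<lambda>x. if x \<in> V then \<Sum>y\<in>{y \<in> V. tree_dist V adj x y = 1}. f y else 0)"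

end

theory Submission
  imports Defs
begin

text \<open>A function \<open>\<phi>\<close> on one level whose sums over sibling sets vanish (the root's point mass, or
  the difference of the point masses of two siblings) generates under \<open>\<Delta>\<close> a cyclic subspace on which
  \<open>\<Delta>\<close> is a Jacobi matrix with off-diagonal entries \<open>\<surd>\<kappa>\<^sub>j\<close>; these \<open>\<phi>\<close> are total in the sense that a
  spectral projection killing all of them is zero.

  On a long stretch with \<open>\<kappa>\<^sub>j = 1\<close> plane waves are approximate eigenfunctions, so \<open>[-2,2]\<close> lies in the
  spectrum, and no point of it is isolated.

  For \<open>t = 2 cos k\<close> the normalised orthogonal polynomials \<open>p\<^sub>j(t)\<close> have an amplitude that is constant
  along free stretches and changes by a bounded factor at each branching level. Hence
  \<open>\<Sum> p\<^sub>j(t)\<^sup>2 = \<infinity>\<close> once the gaps outgrow \<open>n\<^sup>n\<close>, which excludes atoms. A long gap makes the phase at the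
  next branching level equidistributed in \<open>k\<close>, and the phase average of the inverse of the branching
  factor is at most a constant below \<open>1\<close>; so the integral in \<open>k\<close> of the inverse amplitude decays
  exponentially and the amplitude tends to infinity Lebesgue almost everywhere. Since \<open>p\<^sub>j(\<Delta>) \<phi>\<close>
  has the norm of \<open>\<phi>\<close>, the spectral projection onto that set of energies kills \<open>\<phi>\<close>.\<close>

text \<open>The thresholds \<open>F n\<close> are fixed before the tree and see only earlier gaps,
  not \<open>L 1\<close>. The size a gap must have depends on more: the distance \<open>d\<close>
  from the start of a cyclic subspace to its first branching level, the subspace itself, and the
  compact window of phases away from \<open>sin k = 0\<close>. These parameters are countable and
  contraction is needed only eventually, so \<open>F n\<close> adds up the thresholds for all
  parameters up to \<open>n\<close>; every fixed choice is then served from some gap on. The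
  contraction factor must not depend on the energy. One bump is a real linear map of determinant 1,
  so the phase mean of its inverse square is exactly 1 and gives no decay; the first power does. Its
  mean growth is weakest at \<open>sin k = 1\<close> or \<open>-1\<close>, which yields the uniform
  constant \<open>bump_rate\<close>. Towards the band edges the lower bound on a single bump
  degenerates; there the growth \<open>n ^ n\<close> of the gaps beats every fixed exponential, so
  atoms are excluded at all energies by one sequence.\<close>

section \<open>The space of square-summable functions\<close>

lemma l2I:
  assumes "\<And>x. x \<notin> V \<Longrightarrow> f x = 0"
    and "\<And>X. finite X \<Longrightarrow> X \<subseteq> V \<Longrightarrow> (\<Sum>x\<in>X. (cmod (f x))\<^sup>2) \<le> C"
  shows "f \<in> l2 V"
proof -
  have "(\<lambda>x. (cmod (f x))\<^sup>2) summable_on V"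
    by (rule nonneg_bdd_above_summable_on) (auto intro!: bdd_aboveI[where M = C] assms(2))
  with assms(1) show ?thesis by (auto simp: l2_def)
qed

lemma l2_outside: "f \<in> l2 V \<Longrightarrow> x \<notin> V \<Longrightarrow> f x = 0"
  by (simp add: l2_def)

lemma l2_summable: "f \<in> l2 V \<Longrightarrow> (\<lambda>x. (cmod (f x))\<^sup>2) summable_on V"
  by (simp add: l2_def)

lemma l2_norm_nonneg: "l2_norm V f \<ge> 0"
  by (simp add: l2_norm_def infsum_nonneg)

lemma l2_norm_sq: "(l2_norm V f)\<^sup>2 = (\<Sum>\<^sub>\<infinity>x\<in>V. (cmod (f x))\<^sup>2)"
  by (simp add: l2_norm_def infsum_nonneg)

lemma finite_sum_le_l2_norm:
  assumes "f \<in> l2 V" "finite X" "X \<subseteq> V"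
  shows "(\<Sum>x\<in>X. (cmod (f x))\<^sup>2) \<le> (l2_norm V f)\<^sup>2"
  unfolding l2_norm_sq by (rule finite_sum_le_infsum) (use assms l2_summable in auto)

lemma L2_set_le_l2_norm:
  assumes "f \<in> l2 V" "finite X" "X \<subseteq> V"
  shows "L2_set (\<lambda>x. cmod (f x)) X \<le> l2_norm V f"
  using finite_sum_le_l2_norm[OF assms]
  by (auto simp: L2_set_def l2_norm_nonneg intro!: real_le_lsqrt sum_nonneg)

lemma l2_norm_leI:
  assumes "f \<in> l2 V" "C \<ge> 0"
    and "\<And>X. finite X \<Longrightarrow> X \<subseteq> V \<Longrightarrow> L2_set (\<lambda>x. cmod (f x)) X \<le> C"
  shows "l2_norm V f \<le> C"
proof -
  have "(l2_norm V f)\<^sup>2 \<le> C\<^sup>2" unfolding l2_norm_sq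
  proof (rule infsum_le_finite_sums)
    show "(\<lambda>x. (cmod (f x))\<^sup>2) summable_on V" using assms l2_summable by auto
    fix X assume X: "finite X" "X \<subseteq> V"
    have "(L2_set (\<lambda>x. cmod (f x)) X)\<^sup>2 \<le> C\<^sup>2"
      using assms(3)[OF X] by (intro power_mono) (auto simp: L2_set_nonneg)
    then show "(\<Sum>x\<in>X. (cmod (f x))\<^sup>2) \<le> C\<^sup>2"
      by (simp add: L2_set_def sum_nonneg)
  qed
  then show ?thesis using assms(2) by (rule power2_le_imp_le)
qed

text \<open>Estimates are made on finite sets of vertices, where \<open>L2_set\<close> provides
  Minkowski and Cauchy-Schwarz; this rule turns them into membership and a norm bound at
  once.\<close>

lemma l2_bounded_L2_setI:
  assumes "\<And>x. x \<notin> V \<Longrightarrow> f x = 0" "C \<ge> 0"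
    and "\<And>X. finite X \<Longrightarrow> X \<subseteq> V \<Longrightarrow> L2_set (\<lambda>x. cmod (f x)) X \<le> C"
  shows "f \<in> l2 V" "l2_norm V f \<le> C"
proof -
  show "f \<in> l2 V"
  proof (rule l2I)
    fix X assume X: "finite X" "X \<subseteq> V"
    have "(L2_set (\<lambda>x. cmod (f x)) X)\<^sup>2 \<le> C\<^sup>2"
      using assms(3)[OF X] by (intro power_mono) (auto simp: L2_set_nonneg)
    then show "(\<Sum>x\<in>X. (cmod (f x))\<^sup>2) \<le> C\<^sup>2"
      by (simp add: L2_set_def sum_nonneg)
  qed (use assms in auto)
  then show "l2_norm V f \<le> C" using assms by (intro l2_norm_leI)
qed

lemma l2_add:
  assumes "f \<in> l2 V" "g \<in> l2 V"
  shows "(\<lambda>x. f x + g x) \<in> l2 V" and l2_norm_triangle: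
    "l2_norm V (\<lambda>x. f x + g x) \<le> l2_norm V f + l2_norm V g"
proof -
  have *: "L2_set (\<lambda>x. cmod (f x + g x)) X \<le> l2_norm V f + l2_norm V g"
    if X: "finite X" "X \<subseteq> V" for X
  proof -
    have "L2_set (\<lambda>x. cmod (f x + g x)) X \<le> L2_set (\<lambda>x. cmod (f x) + cmod (g x)) X"
      by (rule L2_set_mono) (auto simp: norm_triangle_ineq)
    also have "\<dots> \<le> L2_set (\<lambda>x. cmod (f x)) X + L2_set (\<lambda>x. cmod (g x)) X"
      by (rule L2_set_triangle_ineq)
    also have "\<dots> \<le> l2_norm V f + l2_norm V g"
      using assms X by (intro add_mono L2_set_le_l2_norm)
    finally show ?thesis .
  qed
  note l2_bounded_L2_setI[of V "\<lambda>x. f x + g x", OF _ _ *]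
  then show "(\<lambda>x. f x + g x) \<in> l2 V" "l2_norm V (\<lambda>x. f x + g x) \<le> l2_norm V f + l2_norm V g"
    using assms by (auto simp: l2_outside l2_norm_nonneg)
qed

lemma l2_scale:
  assumes "f \<in> l2 V"
  shows "(\<lambda>x. c * f x) \<in> l2 V"
  using assms summable_on_cmult_right[of "\<lambda>x. (cmod (f x))\<^sup>2" V "(cmod c)\<^sup>2"]
  by (auto simp: l2_def norm_mult power_mult_distrib)

lemma l2_norm_scale: "l2_norm V (\<lambda>x. c * f x) = cmod c * l2_norm V f"
  by (simp add: l2_norm_def norm_mult power_mult_distrib infsum_cmult_right' real_sqrt_mult)

lemma l2_diff:
  assumes "f \<in> l2 V" "g \<in> l2 V"
  shows "(\<lambda>x. f x - g x) \<in> l2 V"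
  using l2_add(1)[OF assms(1) l2_scale[OF assms(2), of "-1"]] by simp

lemma l2_sum:
  assumes "\<And>i. i \<in> I \<Longrightarrow> f i \<in> l2 V"
  shows "(\<lambda>x. \<Sum>i\<in>I. f i x) \<in> l2 V"
  using assms
proof (induction I rule: infinite_finite_induct)
  case (insert i I)
  then show ?case using l2_add[of "f i" V "\<lambda>x. \<Sum>i\<in>I. f i x"] by simp
qed (auto intro: l2I[where C = 0])

lemma l2_norm_sum_le:
  assumes "\<And>i. i \<in> I \<Longrightarrow> f i \<in> l2 V"
  shows "l2_norm V (\<lambda>x. \<Sum>i\<in>I. f i x) \<le> (\<Sum>i\<in>I. l2_norm V (f i))"
  using assms
proof (induction I rule: infinite_finite_induct)
  case (insert i I)
  then have "l2_norm V (\<lambda>x. f i x + (\<Sum>i\<in>I. f i x)) \<le> l2_norm V (f i) + l2_norm V (\<lambda>x. \<Sum>i\<in>I. f i x)"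
    by (intro l2_norm_triangle l2_sum) auto
  with insert show ?case by simp
qed (simp_all add: l2_norm_def)

lemma norm_le_l2_norm:
  assumes "f \<in> l2 V"
  shows "cmod (f x) \<le> l2_norm V f"
proof (cases "x \<in> V")
  case True
  then show ?thesis using L2_set_le_l2_norm[OF assms, of "{x}"] by simp
next
  case False
  then show ?thesis using assms by (simp add: l2_outside l2_norm_nonneg)
qed

lemma l2_norm_eq_0D:
  assumes "f \<in> l2 V" "l2_norm V f = 0"
  shows "f = (\<lambda>x. 0)"
  using norm_le_l2_norm[OF assms(1)] assms(2) by (intro ext) simp

section \<open>The inner product and orthogonality\<close>

lemma l2_inner_summable:
  assumes "f \<in> l2 V" "g \<in> l2 V"
  shows "(\<lambda>x. norm (cnj (f x) * g x)) summable_on V"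
proof (rule nonneg_bdd_above_summable_on)
  show "bdd_above (sum (\<lambda>x. norm (cnj (f x) * g x)) ` {F. F \<subseteq> V \<and> finite F})"
  proof (rule bdd_aboveI2[where M = "l2_norm V f * l2_norm V g"])
    fix X assume "X \<in> {F. F \<subseteq> V \<and> finite F}"
    then have X: "finite X" "X \<subseteq> V" by auto
    have "(\<Sum>x\<in>X. \<bar>cmod (f x)\<bar> * \<bar>cmod (g x)\<bar>) \<le> L2_set (\<lambda>x. cmod (f x)) X * L2_set (\<lambda>x. cmod (g x)) X"
      by (rule L2_set_mult_ineq)
    also have "\<dots> \<le> l2_norm V f * l2_norm V g"
      using assms X by (intro mult_mono L2_set_le_l2_norm) (auto simp: l2_norm_nonneg L2_set_nonneg)
    finally show "(\<Sum>x\<in>X. norm (cnj (f x) * g x)) \<le> l2_norm V f * l2_norm V g"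
      by (simp add: norm_mult)
  qed
qed auto

lemma l2_Cauchy_Schwarz:
  assumes "f \<in> l2 V" "g \<in> l2 V"
  shows "cmod (l2_inner V f g) \<le> l2_norm V f * l2_norm V g"
proof -
  have "cmod (l2_inner V f g) \<le> (\<Sum>\<^sub>\<infinity>x\<in>V. norm (cnj (f x) * g x))"
    unfolding l2_inner_def by (rule norm_infsum_bound) (rule l2_inner_summable[OF assms])
  also have "\<dots> \<le> l2_norm V f * l2_norm V g"
  proof (rule infsum_le_finite_sums[OF l2_inner_summable[OF assms]])
    fix X assume X: "finite X" "X \<subseteq> V"
    have "(\<Sum>x\<in>X. \<bar>cmod (f x)\<bar> * \<bar>cmod (g x)\<bar>) \<le> L2_set (\<lambda>x. cmod (f x)) X * L2_set (\<lambda>x. cmod (g x)) X"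
      by (rule L2_set_mult_ineq)
    also have "\<dots> \<le> l2_norm V f * l2_norm V g"
      using assms X by (intro mult_mono L2_set_le_l2_norm) (auto simp: l2_norm_nonneg L2_set_nonneg)
    finally show "(\<Sum>x\<in>X. norm (cnj (f x) * g x)) \<le> l2_norm V f * l2_norm V g"
      by (simp add: norm_mult)
  qed
  finally show ?thesis .
qed

lemma l2_inner_add_right:
  assumes "f \<in> l2 V" "g \<in> l2 V" "h \<in> l2 V"
  shows "l2_inner V f (\<lambda>x. g x + h x) = l2_inner V f g + l2_inner V f h"
  unfolding l2_inner_def distrib_left
  by (intro infsum_add abs_summable_summable[OF l2_inner_summable] assms)

lemma l2_inner_scale_right: "l2_inner V f (\<lambda>x. c * g x) = c * l2_inner V f g"
  unfolding l2_inner_def mult.left_commute[of _ c] by (rule infsum_cmult_right')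

lemma l2_inner_sum_right:
  assumes "f \<in> l2 V" "\<And>i. i \<in> I \<Longrightarrow> g i \<in> l2 V"
  shows "l2_inner V f (\<lambda>x. \<Sum>i\<in>I. g i x) = (\<Sum>i\<in>I. l2_inner V f (g i))"
  using assms(2)
proof (induction I rule: infinite_finite_induct)
  case (insert i I)
  have "l2_inner V f (\<lambda>x. g i x + (\<Sum>i\<in>I. g i x)) = l2_inner V f (g i) + l2_inner V f (\<lambda>x. \<Sum>i\<in>I. g i x)"
    using insert by (intro l2_inner_add_right l2_sum assms(1)) auto
  also have "l2_inner V f (\<lambda>x. \<Sum>i\<in>I. g i x) = (\<Sum>i\<in>I. l2_inner V f (g i))"
    using insert by auto
  finally show ?case using insert(1,2) by simp
qed (simp_all add: l2_inner_def)

lemma l2_inner_commute: "l2_inner V g f = cnj (l2_inner V f g)"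
proof -
  have "cnj (l2_inner V f g) = (\<Sum>\<^sub>\<infinity>x\<in>V. cnj (cnj (f x) * g x))"
    unfolding l2_inner_def by (rule infsum_cnj[symmetric])
  also have "\<dots> = l2_inner V g f"
    unfolding l2_inner_def by (rule infsum_cong) (simp add: mult.commute)
  finally show ?thesis by simp
qed

lemma l2_inner_self:
  assumes "f \<in> l2 V"
  shows "l2_inner V f f = of_real ((l2_norm V f)\<^sup>2)"
proof -
  have "cnj (f x) * f x = of_real ((cmod (f x))\<^sup>2)" for x
    by (metis complex_norm_square mult.commute)
  moreover have "(\<Sum>\<^sub>\<infinity>x\<in>V. complex_of_real ((cmod (f x))\<^sup>2)) = of_real (\<Sum>\<^sub>\<infinity>x\<in>V. (cmod (f x))\<^sup>2)"
    using assms by (intro infsumI has_sum_of_real has_sum_infsum l2_summable)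
  ultimately show ?thesis unfolding l2_inner_def l2_norm_sq by simp
qed

lemma l2_finite_support:
  assumes "finite X" "X \<subseteq> V" "\<And>x. x \<notin> X \<Longrightarrow> f x = 0"
  shows "f \<in> l2 V" "(l2_norm V f)\<^sup>2 = (\<Sum>x\<in>X. (cmod (f x))\<^sup>2)"
proof -
  have "(\<lambda>x. (cmod (f x))\<^sup>2) summable_on V \<longleftrightarrow> (\<lambda>x. (cmod (f x))\<^sup>2) summable_on X"
    by (rule summable_on_cong_neutral) (use assms in auto)
  then show "f \<in> l2 V" using assms by (auto simp: l2_def)
  have "infsum (\<lambda>x. (cmod (f x))\<^sup>2) V = infsum (\<lambda>x. (cmod (f x))\<^sup>2) X"
    by (rule infsum_cong_neutral) (use assms in auto)
  then show "(l2_norm V f)\<^sup>2 = (\<Sum>x\<in>X. (cmod (f x))\<^sup>2)"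
    using assms by (simp add: l2_norm_sq)
qed

lemma l2_inner_sum_left:
  assumes "g \<in> l2 V" "\<And>i. i \<in> I \<Longrightarrow> f i \<in> l2 V"
  shows "l2_inner V (\<lambda>x. \<Sum>i\<in>I. f i x) g = (\<Sum>i\<in>I. l2_inner V (f i) g)"
proof -
  have "l2_inner V (\<lambda>x. \<Sum>i\<in>I. f i x) g = cnj (\<Sum>i\<in>I. l2_inner V g (f i))"
    using l2_inner_commute[of V "\<lambda>x. \<Sum>i\<in>I. f i x" g] assms by (simp add: l2_inner_sum_right)
  also have "\<dots> = (\<Sum>i\<in>I. l2_inner V (f i) g)"
    unfolding cnj_sum by (intro sum.cong refl l2_inner_commute[symmetric])
  finally show ?thesis .
qed

lemma l2_inner_scale_left: "l2_inner V (\<lambda>x. c * f x) g = cnj c * l2_inner V f g"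
  using l2_inner_commute[of V "\<lambda>x. c * f x" g] l2_inner_commute[of V f g]
  by (simp add: l2_inner_scale_right)

text \<open>Pythagoras. It gives the norms of two test vectors: the plane wave on a free stretch and
  the truncated eigenfunction in \<open>no_atom\<close>.\<close>

lemma l2_norm_sq_orthogonal_sum:
  assumes "finite I" "\<And>i. i \<in> I \<Longrightarrow> f i \<in> l2 V"
    and "\<And>i j. i \<in> I \<Longrightarrow> j \<in> I \<Longrightarrow> i \<noteq> j \<Longrightarrow> l2_inner V (f i) (f j) = 0"
  shows "(l2_norm V (\<lambda>x. \<Sum>i\<in>I. c i * f i x))\<^sup>2 = (\<Sum>i\<in>I. (cmod (c i))\<^sup>2 * (l2_norm V (f i))\<^sup>2)"
proof -
  have l2: "(\<lambda>x. c i * f i x) \<in> l2 V" if "i \<in> I" for i using assms(2)[OF that] by (rule l2_scale)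
  note l2s = l2_sum[of I "\<lambda>i x. c i * f i x", OF l2]
  have "of_real ((l2_norm V (\<lambda>x. \<Sum>i\<in>I. c i * f i x))\<^sup>2) =
      (\<Sum>i\<in>I. \<Sum>j\<in>I. cnj (c i) * (c j * l2_inner V (f i) (f j)))"
  proof -
    have "l2_inner V (\<lambda>x. c i * f i x) (\<lambda>x. \<Sum>j\<in>I. c j * f j x) =
        (\<Sum>j\<in>I. cnj (c i) * (c j * l2_inner V (f i) (f j)))" if "i \<in> I" for i
      using l2_inner_sum_right[OF l2[OF that] l2, of I] 
      by (simp add: l2_inner_scale_left l2_inner_scale_right sum_distrib_left)
    then show ?thesis
      using l2_inner_sum_left[OF l2s, of I "\<lambda>i x. c i * f i x"] l2
      by (simp add: l2_inner_self[OF l2s])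
  qed
  also have "\<dots> = (\<Sum>i\<in>I. cnj (c i) * (c i * l2_inner V (f i) (f i)))"
  proof (rule sum.cong[OF refl])
    fix i assume i: "i \<in> I"
    have "(\<Sum>j\<in>I. cnj (c i) * (c j * l2_inner V (f i) (f j))) =
        (\<Sum>j\<in>I. if j = i then cnj (c i) * (c i * l2_inner V (f i) (f i)) else 0)"
      using assms(3) i by (intro sum.cong refl) auto
    then show "(\<Sum>j\<in>I. cnj (c i) * (c j * l2_inner V (f i) (f j))) = cnj (c i) * (c i * l2_inner V (f i) (f i))"
      using i assms(1) by simp
  qed
  also have "\<dots> = (\<Sum>i\<in>I. of_real ((cmod (c i))\<^sup>2 * (l2_norm V (f i))\<^sup>2))"
  proof (rule sum.cong[OF refl])
    fix i assume i: "i \<in> I"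
    have "cnj (c i) * (c i * l2_inner V (f i) (f i)) = (c i * cnj (c i)) * l2_inner V (f i) (f i)"
      by (simp only: mult_ac)
    then show "cnj (c i) * (c i * l2_inner V (f i) (f i)) = of_real ((cmod (c i))\<^sup>2 * (l2_norm V (f i))\<^sup>2)"
      unfolding complex_norm_square[symmetric] l2_inner_self[OF assms(2)[OF i]] by simp
  qed
  also have "\<dots> = of_real (\<Sum>i\<in>I. (cmod (c i))\<^sup>2 * (l2_norm V (f i))\<^sup>2)" by simp
  finally show ?thesis by (simp only: of_real_eq_iff)
qed

section \<open>Levels, parents and children\<close>

context
  fixes V :: "'v set" and adj
  assumes tree: "tree_graph V adj"
begin

definition tpath where "tpath x y = (THE p. path_between V adj x p y)"

lemma tpath: "x \<in> V \<Longrightarrow> y \<in> V \<Longrightarrow> path_between V adj x (tpath x y) y"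
  unfolding tpath_def by (rule theI') (use tree in \<open>auto simp: tree_graph_def\<close>)

lemma tpath_unique: "path_between V adj x p y \<Longrightarrow> tpath x y = p"
proof -
  assume p: "path_between V adj x p y"
  then have "x \<in> V" "y \<in> V" by (auto simp: path_between_def)
  then show ?thesis using tree tpath[of x y] p unfolding tree_graph_def by blast
qed

lemma tree_dist_tpath: "tree_dist V adj x y = length (tpath x y) - 1"
  by (simp add: tree_dist_def tpath_def)

lemma tree_adj_sym: "x \<in> V \<Longrightarrow> y \<in> V \<Longrightarrow> adj x y \<Longrightarrow> adj y x"
  using tree by (auto simp: tree_graph_def)

lemma tree_adj_irrefl: "x \<in> V \<Longrightarrow> \<not> adj x x"
  using tree by (auto simp: tree_graph_def)

lemma tpath_edge:
  assumes "x \<in> V" "y \<in> V" "adj x y"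
  shows "tpath x y = [x, y]"
  using assms tree_adj_irrefl by (intro tpath_unique) (auto simp: path_between_def)

lemma tree_dist_eq_1_iff:
  assumes "x \<in> V" "y \<in> V"
  shows "tree_dist V adj x y = 1 \<longleftrightarrow> adj x y"
proof
  assume "tree_dist V adj x y = 1"
  then have "length (tpath x y) = 2" by (simp add: tree_dist_tpath)
  then obtain a b where "tpath x y = [a, b]"
    by (auto simp: length_Suc_conv numeral_2_eq_2)
  then show "adj x y" using tpath[OF assms] by (auto simp: path_between_def)
qed (simp add: tree_dist_tpath tpath_edge assms)

lemma tree_dist_refl: "x \<in> V \<Longrightarrow> tree_dist V adj x x = 0"
  using tpath_unique[of x "[x]" x] by (simp add: tree_dist_tpath path_between_def)

lemma tree_dist_eq_0:
  assumes "x \<in> V" "y \<in> V" "tree_dist V adj x y = 0"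
  shows "x = y"
proof -
  have "length (tpath x y) \<le> 1" using assms by (simp add: tree_dist_tpath)
  moreover have "tpath x y \<noteq> []" using tpath[OF assms(1,2)] by (auto simp: path_between_def)
  ultimately obtain a where "tpath x y = [a]" by (cases "tpath x y") auto
  then show ?thesis using tpath[OF assms(1,2)] by (auto simp: path_between_def)
qed

text \<open>If \<open>y\<close> is off the path to \<open>x\<close>, the edge extends that path. If
  \<open>y\<close> is on it, the rest of the path joins \<open>y\<close> to \<open>x\<close>, and
  uniqueness forces this rest to be the edge itself. Here the absence of cycles enters.\<close>

lemma tpath_adj_cases:
  assumes "r \<in> V" "x \<in> V" "y \<in> V" "adj x y"
  shows "tpath r y = tpath r x @ [y] \<or> tpath r x = tpath r y @ [x]"
proof (cases "y \<in> set (tpath r x)")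
  case False
  have "path_between V adj r (tpath r x @ [y]) y"
    using tpath[OF assms(1,2)] False assms
    by (auto simp: path_between_def successively_append_iff)
  then show ?thesis by (simp add: tpath_unique)
next
  case True
  then obtain us vs where uv: "tpath r x = us @ y # vs" by (auto simp: in_set_conv_decomp)
  have p: "path_between V adj r (us @ y # vs) x" using tpath[OF assms(1,2)] uv by simp
  have "path_between V adj y (y # vs) x"
    using p by (auto simp: path_between_def successively_append_iff)
  moreover have "tpath y x = [y, x]" using assms tree_adj_sym by (intro tpath_edge) auto
  ultimately have vs: "vs = [x]" by (simp add: tpath_unique)
  have "path_between V adj r (us @ [y]) y"
    using p vs successively_append_iff[of adj "us @ [y]" "[x]"]
    by (cases us) (auto simp: path_between_def)
  then have "tpath r y = us @ [y]" by (rule tpath_unique)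
  with uv vs show ?thesis by simp
qed

lemma tpath_parent:
  assumes "r \<in> V" "x \<in> V" "x \<noteq> r"
  obtains y where "y \<in> V" "adj x y" "tpath r x = tpath r y @ [x]"
proof -
  have p: "path_between V adj r (tpath r x) x" using tpath assms by auto
  then obtain us where us: "tpath r x = us @ [x]"
    by (metis append_butlast_last_id path_between_def)
  have ne: "us \<noteq> []" using p us assms by (auto simp: path_between_def)
  define y where "y = last us"
  have "adj y x" "y \<in> V" "path_between V adj r us y"
    using p ne by (auto simp: us path_between_def successively_append_iff y_def)
  then show ?thesis using that[of y] us tpath_unique tree_adj_sym assms by auto
qed

end

text \<open>\<open>kappa_pos\<close> rules out dead ends and keeps the weights \<open>wt\<close>
  positive; \<open>K\<close> bounds all degrees by \<open>K + 1\<close>, which makes the Laplacian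
  bounded.\<close>

locale sh_tree =
  fixes V :: "'v set" and adj :: "'v \<Rightarrow> 'v \<Rightarrow> bool" and rt :: 'v and \<kappa> :: "nat \<Rightarrow> nat" and K :: nat
  assumes SH: "SH_rooted_tree V adj rt \<kappa>"
    and kappa_pos: "\<And>j. \<kappa> j \<ge> 1" and kappa_le: "\<And>j. \<kappa> j \<le> K"
begin

lemma tree: "tree_graph V adj" and rt_in: "rt \<in> V"
  using SH by (auto simp: SH_rooted_tree_def)

definition lev :: "'v \<Rightarrow> nat" where "lev x = tree_dist V adj rt x"

definition children :: "'v \<Rightarrow> 'v set" where
  "children x = {y \<in> V. adj x y \<and> lev y = lev x + 1}"

definition parent :: "'v \<Rightarrow> 'v" where
  "parent x = (SOME y. y \<in> V \<and> adj x y \<and> lev x = lev y + 1)"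

lemma finite_children: "x \<in> V \<Longrightarrow> finite (children x)"
  and card_children: "x \<in> V \<Longrightarrow> card (children x) = \<kappa> (lev x)"
  using SH by (auto simp: SH_rooted_tree_def children_def lev_def)

lemma lev_rt [simp]: "lev rt = 0"
  by (simp add: lev_def tree_dist_refl[OF tree] rt_in)

lemma lev_eq_0: "x \<in> V \<Longrightarrow> lev x = 0 \<longleftrightarrow> x = rt"
  using tree_dist_eq_0[OF tree rt_in] by (auto simp: lev_def tree_dist_refl[OF tree] rt_in)

lemma tpath_nonempty: "x \<in> V \<Longrightarrow> tpath V adj rt x \<noteq> []"
  using tpath[OF tree rt_in, of x] by (auto simp: path_between_def)

lemma lev_adj:
  assumes "x \<in> V" "y \<in> V" "adj x y"
  shows "lev y = lev x + 1 \<or> lev x = lev y + 1"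
  using tpath_adj_cases[OF tree rt_in assms] tpath_nonempty assms
  by (auto simp: lev_def tree_dist_tpath[OF tree])

lemma upper_neighbour:
  assumes "x \<in> V" "y \<in> V" "adj x y" "lev x = lev y + 1"
  shows "tpath V adj rt x = tpath V adj rt y @ [x]"
  using tpath_adj_cases[OF tree rt_in assms(1-3)] tpath_nonempty[OF assms(1)] tpath_nonempty[OF assms(2)] assms(4)
  by (auto simp: lev_def tree_dist_tpath[OF tree])

text \<open>Both root paths become the root path of \<open>x\<close> when \<open>x\<close> is
  appended, so they coincide and so do their last vertices.\<close>

lemma upper_neighbour_unique:
  assumes "x \<in> V" "y \<in> V" "adj x y" "lev x = lev y + 1" "z \<in> V" "adj x z" "lev x = lev z + 1"
  shows "y = z"
proof -
  have "tpath V adj rt y = tpath V adj rt z"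
    using upper_neighbour[of x y] upper_neighbour[of x z] assms by simp
  then show ?thesis
    using tpath[OF tree rt_in assms(2)] tpath[OF tree rt_in assms(5)] by (auto simp: path_between_def)
qed

lemma parent:
  assumes "x \<in> V" "x \<noteq> rt"
  shows "parent x \<in> V" "adj x (parent x)" "lev x = lev (parent x) + 1"
proof -
  obtain y where y: "y \<in> V" "adj x y" "tpath V adj rt x = tpath V adj rt y @ [x]"
    using tpath_parent[OF tree rt_in assms] by auto
  have "lev x = lev y + 1" using y tpath_nonempty[of y] by (simp add: lev_def tree_dist_tpath[OF tree])
  with y have "y \<in> V \<and> adj x y \<and> lev x = lev y + 1" by simp
  then have "parent x \<in> V \<and> adj x (parent x) \<and> lev x = lev (parent x) + 1"
    unfolding parent_def by (rule someI)
  then show "parent x \<in> V" "adj x (parent x)" "lev x = lev (parent x) + 1" by auto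
qed

lemma in_children_iff:
  assumes "x \<in> V"
  shows "y \<in> children x \<longleftrightarrow> y \<in> V \<and> y \<noteq> rt \<and> parent y = x"
proof
  assume y: "y \<in> children x"
  then have *: "y \<in> V" "y \<noteq> rt" "adj x y" "lev y = lev x + 1" by (auto simp: children_def)
  have "parent y = x"
    using upper_neighbour_unique[of y "parent y" x] * parent[OF *(1,2)] assms
      tree_adj_sym[OF tree assms *(1)] by blast
  with * show "y \<in> V \<and> y \<noteq> rt \<and> parent y = x" by simp
next
  assume "y \<in> V \<and> y \<noteq> rt \<and> parent y = x"
  then have *: "y \<in> V" "adj y x" "lev y = lev x + 1" using parent[of y] by auto
  then show "y \<in> children x"
    using tree_adj_sym[OF tree *(1) assms] by (simp add: children_def)
qed

definition nbrs :: "'v \<Rightarrow> 'v set" where "nbrs x = {y \<in> V. tree_dist V adj x y = 1}"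

lemma nbrs_eq:
  assumes "x \<in> V"
  shows "nbrs x = (if x = rt then children x else insert (parent x) (children x))"
proof -
  have "nbrs x = {y \<in> V. adj x y}" using tree_dist_eq_1_iff[OF tree assms] by (auto simp: nbrs_def)
  also have "\<dots> = (if x = rt then children x else insert (parent x) (children x))"
  proof (cases "x = rt")
    case True
    then show ?thesis using lev_adj[OF assms] by (auto simp: children_def)
  next
    case False
    have "y \<in> children x \<or> y = parent x" if "y \<in> V" "adj x y" for y
      using lev_adj[OF assms that] upper_neighbour_unique[OF assms that _ parent(1,2)] parent(3) assms False that
      by (auto simp: children_def)
    then show ?thesis using parent[OF assms False] False by (auto simp: children_def)
  qed
  finally show ?thesis .
qed

lemma nbrs_sym: "x \<in> V \<Longrightarrow> y \<in> V \<Longrightarrow> y \<in> nbrs x \<longleftrightarrow> x \<in> nbrs y"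
  using tree_dist_eq_1_iff[OF tree] tree_adj_sym[OF tree, of x y] tree_adj_sym[OF tree, of y x]
  by (auto simp: nbrs_def)

lemma nbrs_subset: "nbrs x \<subseteq> V" by (auto simp: nbrs_def)

lemma finite_nbrs: "x \<in> V \<Longrightarrow> finite (nbrs x)"
  by (cases "x = rt") (simp_all add: nbrs_eq finite_children rt_in)

lemma card_nbrs: "x \<in> V \<Longrightarrow> card (nbrs x) \<le> K + 1"
  using kappa_le[of "lev x"] card_insert_le_m1[of "Suc K" "children x" "parent x"]
  by (auto simp: nbrs_eq card_children)

section \<open>The Laplacian as a bounded operator\<close>

abbreviation A where "A \<equiv> laplacian V adj"

lemma A_eq: "A f x = (if x \<in> V then \<Sum>y\<in>nbrs x. f y else 0)"
  by (simp add: laplacian_def nbrs_def)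

lemma A_split:
  assumes "x \<in> V"
  shows "A f x = (if x = rt then 0 else f (parent x)) + (\<Sum>y\<in>children x. f y)"
proof -
  have "x \<noteq> rt \<Longrightarrow> parent x \<notin> children x" using parent[OF assms] by (auto simp: children_def)
  then show ?thesis using assms by (auto simp: A_eq nbrs_eq finite_children)
qed

lemma A_add: "A (\<lambda>x. f x + g x) = (\<lambda>x. A f x + A g x)"
  by (auto simp: A_eq sum.distrib)

lemma A_scale: "A (\<lambda>x. c * f x) = (\<lambda>x. c * A f x)"
  by (auto simp: A_eq sum_distrib_left)

lemma A_sum: "A (\<lambda>x. \<Sum>i\<in>I. f i x) = (\<lambda>x. \<Sum>i\<in>I. A (f i) x)"
  by (rule ext) (simp add: A_eq sum.swap[of _ I])

text \<open>Schur's test: Cauchy-Schwarz over at most \<open>K + 1\<close> neighbours gives one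
  factor \<open>K + 1\<close>. After exchanging the sums, symmetry of adjacency shows that each
  vertex is counted at most \<open>K + 1\<close> times, which gives the other.\<close>

lemma A_bound:
  assumes "f \<in> l2 V"
  shows "A f \<in> l2 V" "l2_norm V (A f) \<le> (K + 1) * l2_norm V f"
proof -
  have *: "L2_set (\<lambda>x. cmod (A f x)) X \<le> (K + 1) * l2_norm V f" if X: "finite X" "X \<subseteq> V" for X
  proof -
    define Y where "Y = (\<Union>x\<in>X. nbrs x)"
    have Y: "finite Y" "Y \<subseteq> V" using X finite_nbrs nbrs_subset by (auto simp: Y_def)
    have "(cmod (A f x))\<^sup>2 \<le> (K + 1) * (\<Sum>y\<in>nbrs x. (cmod (f y))\<^sup>2)" if "x \<in> X" for x
    proof -
      have x: "x \<in> V" using that X by auto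
      have "(cmod (A f x))\<^sup>2 \<le> (\<Sum>y\<in>nbrs x. 1 * cmod (f y))\<^sup>2"
        using x by (intro power_mono) (auto simp: A_eq norm_sum)
      also have "\<dots> \<le> (\<Sum>y\<in>nbrs x. 1\<^sup>2) * (\<Sum>y\<in>nbrs x. (cmod (f y))\<^sup>2)"
        by (rule Cauchy_Schwarz_ineq_sum)
      also have "\<dots> \<le> (K + 1) * (\<Sum>y\<in>nbrs x. (cmod (f y))\<^sup>2)"
        using card_nbrs[OF x] by (intro mult_right_mono) (auto intro: sum_nonneg)
      finally show ?thesis .
    qed
    then have "(\<Sum>x\<in>X. (cmod (A f x))\<^sup>2) \<le> (\<Sum>x\<in>X. (K + 1) * (\<Sum>y\<in>nbrs x. (cmod (f y))\<^sup>2))"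
      by (rule sum_mono)
    also have "\<dots> = (K + 1) * (\<Sum>x\<in>X. \<Sum>y\<in>{y\<in>Y. y \<in> nbrs x}. (cmod (f y))\<^sup>2)"
      unfolding sum_distrib_left[symmetric]
      by (intro arg_cong[where f = "\<lambda>x. _ * x"] sum.cong refl) (auto simp: Y_def)
    also have "(\<Sum>x\<in>X. \<Sum>y\<in>{y\<in>Y. y \<in> nbrs x}. (cmod (f y))\<^sup>2) = (\<Sum>y\<in>Y. \<Sum>x\<in>{x\<in>X. y \<in> nbrs x}. (cmod (f y))\<^sup>2)"
      by (rule sum.swap_restrict) (use X Y in auto)
    also have "\<dots> \<le> (\<Sum>y\<in>Y. (K + 1) * (cmod (f y))\<^sup>2)"
    proof (rule sum_mono)
      fix y assume y: "y \<in> Y"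
      have "card {x\<in>X. y \<in> nbrs x} \<le> card (nbrs y)"
        using y X Y nbrs_sym by (intro card_mono finite_nbrs) auto
      also have "\<dots> \<le> K + 1" using y Y by (intro card_nbrs) auto
      finally have "real (card {x\<in>X. y \<in> nbrs x}) \<le> real (K + 1)" by (simp only: of_nat_le_iff)
      then have "real (card {x\<in>X. y \<in> nbrs x}) * (cmod (f y))\<^sup>2 \<le> real (K + 1) * (cmod (f y))\<^sup>2"
        by (intro mult_right_mono) auto
      then show "(\<Sum>x\<in>{x\<in>X. y \<in> nbrs x}. (cmod (f y))\<^sup>2) \<le> (K + 1) * (cmod (f y))\<^sup>2" by simp
    qed
    also have "\<dots> = (K + 1) * (\<Sum>y\<in>Y. (cmod (f y))\<^sup>2)" by (simp add: sum_distrib_left)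
    also have "\<dots> \<le> (K + 1) * (l2_norm V f)\<^sup>2"
      using finite_sum_le_l2_norm[OF assms Y] by (intro mult_left_mono) auto
    finally have "(\<Sum>x\<in>X. (cmod (A f x))\<^sup>2) \<le> (K + 1) * ((K + 1) * (l2_norm V f)\<^sup>2)"
      by (simp add: mult_left_mono)
    also have "\<dots> = (real (K + 1) * l2_norm V f)\<^sup>2"
      by (simp only: power2_eq_square mult_ac)
    finally have "(\<Sum>x\<in>X. (cmod (A f x))\<^sup>2) \<le> (real (K + 1) * l2_norm V f)\<^sup>2" .
    then have "L2_set (\<lambda>x. cmod (A f x)) X \<le> sqrt ((real (K + 1) * l2_norm V f)\<^sup>2)"
      unfolding L2_set_def by (rule real_sqrt_le_mono)
    then show ?thesis by (simp add: l2_norm_nonneg)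
  qed
  have **: "real (K + 1) * l2_norm V f \<ge> 0" by (simp add: l2_norm_nonneg)
  have "A f x = 0" if "x \<notin> V" for x using that by (simp add: A_eq)
  from l2_bounded_L2_setI[of V "A f", OF this ** *]
  show "A f \<in> l2 V" "l2_norm V (A f) \<le> (K + 1) * l2_norm V f" by auto
qed

end

section \<open>The spectrum and the cyclic subspaces\<close>

text \<open>The product of the squared Jacobi entries up to \<open>j\<close>, equivalently the
  number of descendants \<open>j\<close> levels further out; it normalises the orthogonal
  polynomials.\<close>

definition wt :: "(nat \<Rightarrow> nat) \<Rightarrow> nat \<Rightarrow> real" where "wt \<kappa> j = (\<Prod>i<j. real (\<kappa> i))"

context sh_tree
begin

lemma A_funpow_l2:
  assumes "f \<in> l2 V"
  shows "(A ^^ n) f \<in> l2 V \<and> l2_norm V ((A ^^ n) f) \<le> (K + 1) ^ n * l2_norm V f"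
proof (induction n)
  case (Suc n)
  have "l2_norm V (A ((A ^^ n) f)) \<le> (K + 1) * l2_norm V ((A ^^ n) f)" using Suc A_bound by blast
  also have "\<dots> \<le> (K + 1) * ((K + 1) ^ n * l2_norm V f)" using Suc by (intro mult_left_mono) auto
  finally show ?case using Suc A_bound(1) by (simp only: funpow.simps o_apply power_Suc mult.assoc of_nat_mult simp_thms)
qed (simp add: assms)

text \<open>Neumann series. It is summed pointwise, and the norm bound on the partial sums passes to
  the limit on each finite set of vertices, so no completeness argument is involved. The bound is
  what allows the identity to be truncated in the functional calculus.\<close>

lemma op_spectrum_A_bounded:
  assumes "z \<in> op_spectrum V A"
  shows "cmod z \<le> K + 1"
proof (rule ccontr)
  assume "\<not> cmod z \<le> K + 1"
  then have z: "cmod z > K + 1" by simp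
  define q where "q = (K + 1) / cmod z"
  have cz: "cmod z > 0" using z by linarith
  have q: "0 \<le> q" "q < 1" using z cz by (auto simp: q_def)
  have z0: "z \<noteq> 0" using cz by auto
  define a where "a n f x = (A ^^ n) f x / z ^ (n + 1)" for n f x
  define R where "R f x = - (\<Sum>n. a n f x)" for f x
  have a_l2: "a n f \<in> l2 V" "l2_norm V (a n f) \<le> q ^ n * (l2_norm V f / cmod z)" if f: "f \<in> l2 V" for n f
  proof -
    have eq: "a n f = (\<lambda>x. (1 / z ^ (n + 1)) * (A ^^ n) f x)" by (auto simp: a_def)
    show "a n f \<in> l2 V" unfolding eq using A_funpow_l2[OF f] by (intro l2_scale) auto
    have "l2_norm V (a n f) = l2_norm V ((A ^^ n) f) / cmod z ^ (n + 1)"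
      unfolding eq l2_norm_scale by (simp add: norm_divide norm_power norm_mult mult_ac)
    also have "\<dots> \<le> ((K + 1) ^ n * l2_norm V f) / cmod z ^ (n + 1)"
      using A_funpow_l2[OF f, of n] cz by (intro divide_right_mono) auto
    finally show "l2_norm V (a n f) \<le> q ^ n * (l2_norm V f / cmod z)" by (simp add: q_def power_divide mult_ac)
  qed
  have summ: "summable (\<lambda>n. a n f x)" if f: "f \<in> l2 V" for f x
  proof (rule summable_comparison_test')
    show "summable (\<lambda>n. q ^ n * (l2_norm V f / cmod z))"
      using q by (intro summable_mult2 summable_geometric) auto
    show "norm (a n f x) \<le> q ^ n * (l2_norm V f / cmod z)" if "n \<ge> 0" for n
      using norm_le_l2_norm[OF a_l2(1)[OF f], of n x] a_l2(2)[OF f, of n] by simp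
  qed
  have R_l2: "R f \<in> l2 V \<and> l2_norm V (R f) \<le> 1 / (1 - q) / cmod z * l2_norm V f" if f: "f \<in> l2 V" for f
  proof -
    have C: "1 / (1 - q) / cmod z * l2_norm V f \<ge> 0" using q by (simp add: l2_norm_nonneg)
    have out: "R f x = 0" if "x \<notin> V" for x
      using l2_outside[OF a_l2(1)[OF f] that] by (simp add: R_def)
    have *: "L2_set (\<lambda>x. cmod (R f x)) X \<le> 1 / (1 - q) / cmod z * l2_norm V f" if X: "finite X" "X \<subseteq> V" for X
    proof (rule tendsto_upperbound)
      show "(\<lambda>N. L2_set (\<lambda>x. cmod (- (\<Sum>n<N. a n f x))) X) \<longlonglongrightarrow> L2_set (\<lambda>x. cmod (R f x)) X"
        unfolding L2_set_def R_def by (intro tendsto_intros summable_LIMSEQ summ f)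
      have "L2_set (\<lambda>x. cmod (- (\<Sum>n<N. a n f x))) X \<le> 1 / (1 - q) / cmod z * l2_norm V f" for N
      proof -
        have "L2_set (\<lambda>x. cmod (- (\<Sum>n<N. a n f x))) X = L2_set (\<lambda>x. cmod (\<Sum>n<N. a n f x)) X"
          by (simp only: norm_minus_cancel)
        also have "\<dots> \<le> l2_norm V (\<lambda>x. \<Sum>n<N. a n f x)"
          using X a_l2(1)[OF f] by (intro L2_set_le_l2_norm l2_sum) auto
        also have "\<dots> \<le> (\<Sum>n<N. l2_norm V (a n f))"
          by (intro l2_norm_sum_le a_l2(1) f)
        also have "\<dots> \<le> (\<Sum>n<N. q ^ n * (l2_norm V f / cmod z))"
          by (intro sum_mono a_l2(2) f)
        also have "\<dots> = (\<Sum>n<N. q ^ n) * (l2_norm V f / cmod z)" by (simp only: sum_distrib_right)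
        also have "\<dots> \<le> (\<Sum>n. q ^ n) * (l2_norm V f / cmod z)"
          using q by (intro mult_right_mono sum_le_suminf summable_geometric) (auto simp: l2_norm_nonneg)
        also have "\<dots> = 1 / (1 - q) / cmod z * l2_norm V f" using q by (simp add: suminf_geometric)
        finally show ?thesis .
      qed
      then show "\<forall>\<^sub>F N in sequentially. L2_set (\<lambda>x. cmod (- (\<Sum>n<N. a n f x))) X \<le> 1 / (1 - q) / cmod z * l2_norm V f"
        by simp
    qed simp
    from l2_bounded_L2_setI[of V "R f", OF out C *] show ?thesis by auto
  qed
  have Apow_add: "(A ^^ n) (\<lambda>x. f x + g x) = (\<lambda>x. (A ^^ n) f x + (A ^^ n) g x)" for n f g
    by (induction n) (auto simp: A_add)
  have Apow_scale: "(A ^^ n) (\<lambda>x. c * f x) = (\<lambda>x. c * (A ^^ n) f x)" for n c f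
    by (induction n) (auto simp: A_scale)
  have Radd: "R (\<lambda>x. f x + g x) = (\<lambda>x. R f x + R g x)" if "f \<in> l2 V" "g \<in> l2 V" for f g
  proof
    fix x
    have "(\<Sum>n. a n (\<lambda>x. f x + g x) x) = (\<Sum>n. a n f x + a n g x)"
      by (simp add: a_def Apow_add add_divide_distrib)
    also have "\<dots> = (\<Sum>n. a n f x) + (\<Sum>n. a n g x)"
      by (rule suminf_add[symmetric]) (auto intro: summ that)
    finally show "R (\<lambda>x. f x + g x) x = R f x + R g x" by (simp add: R_def)
  qed
  have Rscale: "R (\<lambda>x. c * f x) = (\<lambda>x. c * R f x)" if "f \<in> l2 V" for f c
  proof
    fix x
    have "(\<Sum>n. a n (\<lambda>x. c * f x) x) = (\<Sum>n. c * a n f x)"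
      by (simp add: a_def Apow_scale)
    also have "\<dots> = c * (\<Sum>n. a n f x)"
      by (rule suminf_mult) (auto intro: summ that)
    finally show "R (\<lambda>x. c * f x) x = c * R f x" by (simp add: R_def)
  qed
  have bo: "bounded_operator V R"
    unfolding bounded_operator_def using R_l2 Radd Rscale by blast
  \<comment> \<open>Both resolvent identities reduce to this index shift, since applying
    \<open>A\<close> turns the term \<open>a n\<close> into \<open>z\<close> times the term
    \<open>a (Suc n)\<close>.\<close>
  have tele: "z * (\<Sum>n. a n f x) - (\<Sum>n. z * a (Suc n) f x) = f x" if f: "f \<in> l2 V" for f x
  proof -
    have "(\<Sum>n. a (Suc n) f x) = (\<Sum>n. a n f x) - a 0 f x"
      using suminf_split_head[OF summ[OF f]] by simp
    moreover have "z * a 0 f x = f x" using z0 by (simp add: a_def)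
    moreover have "(\<Sum>n. z * a (Suc n) f x) = z * (\<Sum>n. a (Suc n) f x)"
      using summ[OF f, of x] summable_Suc_iff[of "\<lambda>n. a n f x"] by (intro suminf_mult) simp
    ultimately show ?thesis by (simp add: right_diff_distrib)
  qed
  have "R (\<lambda>x. A f x - z * f x) = f \<and> (\<lambda>x. A (R f) x - z * R f x) = f" if f: "f \<in> l2 V" for f
  proof
    have Af: "A f \<in> l2 V" using A_bound f by blast
    have "R (\<lambda>x. A f x - z * f x) = (\<lambda>x. R (A f) x - z * R f x)"
      using Radd[OF Af l2_scale[OF f, of "- z"]] Rscale[OF f, of "- z"] by simp
    also have "\<dots> = f"
    proof
      fix x
      have "a n (A f) x = z * a (Suc n) f x" for n
        using z0 by (simp add: a_def funpow_swap1)
      then show "R (A f) x - z * R f x = f x" using tele[OF f, of x] by (simp add: R_def)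
    qed
    finally show "R (\<lambda>x. A f x - z * f x) = f" .
    show "(\<lambda>x. A (R f) x - z * R f x) = f"
    proof
      fix x
      show "A (R f) x - z * R f x = f x"
      proof (cases "x \<in> V")
        case True
        have "A (R f) x = - (\<Sum>y\<in>nbrs x. \<Sum>n. a n f y)"
          using True by (simp add: A_eq R_def sum_negf)
        also have "(\<Sum>y\<in>nbrs x. \<Sum>n. a n f y) = (\<Sum>n. \<Sum>y\<in>nbrs x. a n f y)"
          by (rule suminf_sum[symmetric]) (rule summ[OF f])
        also have "\<dots> = (\<Sum>n. z * a (Suc n) f x)"
          using True z0 by (intro suminf_cong) (simp add: a_def A_eq sum_divide_distrib sum_distrib_left)
        finally have "A (R f) x = - (\<Sum>n. z * a (Suc n) f x)" .
        moreover have "R f x = - (\<Sum>n. a n f x)" by (simp add: R_def)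
        ultimately show ?thesis using tele[OF f, of x] by simp
      next
        case False
        then show ?thesis using R_l2[OF f] f l2_outside[of "R f" V x] l2_outside[of f V x] by (simp add: A_eq)
      qed
    qed
  qed
  with bo assms show False unfolding op_spectrum_def by blast
qed

section \<open>Generators, outward shifts and the Jacobi recurrence\<close>

definition Lev :: "nat \<Rightarrow> 'v set" where "Lev l = {x \<in> V. lev x = l}"

lemma Lev_Suc: "Lev (Suc l) = (\<Union>x\<in>Lev l. children x)"
proof -
  have "y \<in> (\<Union>x\<in>Lev l. children x)" if "y \<in> Lev (Suc l)" for y
  proof -
    have y: "y \<in> V" "y \<noteq> rt" using that by (auto simp: Lev_def)
    from y parent[OF y] that have "y \<in> children (parent y)" "parent y \<in> Lev l"
      by (auto simp: in_children_iff Lev_def)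
    then show ?thesis by blast
  qed
  then show ?thesis by (auto simp: Lev_def children_def)
qed

lemma finite_Lev: "finite (Lev l)"
proof (induction l)
  case 0
  have "Lev 0 = {rt}" using lev_eq_0 rt_in by (auto simp: Lev_def)
  then show ?case by simp
next
  case (Suc l)
  have "Lev l \<subseteq> V" by (auto simp: Lev_def)
  with Suc show ?case unfolding Lev_Suc by (blast intro: finite_children)
qed

text \<open>The outward half of \<open>A\<close>; the other half, the sum over children, is its
  adjoint.\<close>

definition Dn :: "('v \<Rightarrow> complex) \<Rightarrow> 'v \<Rightarrow> complex" where
  "Dn f x = (if x \<in> V \<and> x \<noteq> rt then f (parent x) else 0)"

lemma sum_parent_Lev_Suc:
  fixes h :: "'v \<Rightarrow> real"
  shows "(\<Sum>y\<in>Lev (Suc l). h (parent y)) = \<kappa> l * (\<Sum>x\<in>Lev l. h x)"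
proof -
  have "(\<Sum>y\<in>Lev (Suc l). h (parent y)) = (\<Sum>x\<in>Lev l. \<Sum>y\<in>children x. h (parent y))"
    unfolding Lev_Suc
    by (rule sum.UNION_disjoint[OF finite_Lev]) (auto simp: finite_children Lev_def in_children_iff)
  also have "\<dots> = (\<Sum>x\<in>Lev l. \<kappa> l * h x)"
  proof (rule sum.cong[OF refl])
    fix x assume x: "x \<in> Lev l"
    then have "(\<Sum>y\<in>children x. h (parent y)) = (\<Sum>y\<in>children x. h x)"
      by (intro sum.cong refl) (auto simp: in_children_iff Lev_def)
    then show "(\<Sum>y\<in>children x. h (parent y)) = \<kappa> l * h x"
      using x by (simp add: Lev_def card_children)
  qed
  finally show ?thesis by (simp add: sum_distrib_left)
qed

text \<open>A generator is annihilated by the part of \<open>A\<close> that moves towards the root, so the span of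
  its images under the powers of \<open>A\<close> carries a Jacobi matrix.\<close>

definition generator :: "nat \<Rightarrow> ('v \<Rightarrow> complex) \<Rightarrow> bool" where
  "generator m \<phi> \<longleftrightarrow> (\<forall>x. x \<notin> Lev m \<longrightarrow> \<phi> x = 0) \<and> (\<forall>x\<in>V. (\<Sum>y\<in>children x. \<phi> y) = 0)"

lemma Dn_support:
  assumes "\<And>x. x \<notin> Lev l \<Longrightarrow> f x = 0" "x \<notin> Lev (Suc l)"
  shows "Dn f x = 0"
  using assms parent[of x] by (auto simp: Dn_def Lev_def)

lemma Dn_funpow_support:
  assumes "generator m \<phi>" "x \<notin> Lev (m + j)"
  shows "(Dn ^^ j) \<phi> x = 0"
  using assms(2)
proof (induction j arbitrary: x)
  case 0
  then show ?case using assms by (simp add: generator_def)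
next
  case (Suc j)
  then show ?case using Dn_support[of "m + j" "(Dn ^^ j) \<phi>" x] by simp
qed

lemma Lev_subset: "Lev l \<subseteq> V" by (auto simp: Lev_def)

lemma Dn_funpow_l2:
  assumes "generator m \<phi>"
  shows "(Dn ^^ j) \<phi> \<in> l2 V"
  using Dn_funpow_support[OF assms, of _ j] by (intro l2_finite_support(1)[OF finite_Lev Lev_subset])

text \<open>Every value is copied to all children, so a step from level \<open>m + j\<close>
  multiplies the squared norm by \<open>\<kappa> (m + j)\<close>. Normalising therefore turns the
  recurrence \<open>A_Dn_funpow\<close> into a Jacobi matrix with entries
  \<open>sqrt \<kappa>\<close>.\<close>

lemma Dn_funpow_norm:
  assumes "generator m \<phi>"
  shows "(l2_norm V ((Dn ^^ j) \<phi>))\<^sup>2 = wt (\<lambda>i. \<kappa> (m + i)) j * (l2_norm V \<phi>)\<^sup>2"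
proof (induction j)
  case (Suc j)
  have "(l2_norm V ((Dn ^^ Suc j) \<phi>))\<^sup>2 = (\<Sum>y\<in>Lev (Suc (m + j)). (cmod ((Dn ^^ Suc j) \<phi> y))\<^sup>2)"
    using Dn_funpow_support[OF assms, of _ "Suc j"]
    by (intro l2_finite_support(2)[OF finite_Lev Lev_subset]) auto
  also have "\<dots> = (\<Sum>y\<in>Lev (Suc (m + j)). (cmod ((Dn ^^ j) \<phi> (parent y)))\<^sup>2)"
    by (intro sum.cong refl) (auto simp: Dn_def Lev_def)
  also have "\<dots> = \<kappa> (m + j) * (\<Sum>x\<in>Lev (m + j). (cmod ((Dn ^^ j) \<phi> x))\<^sup>2)"
    by (rule sum_parent_Lev_Suc)
  also have "(\<Sum>x\<in>Lev (m + j). (cmod ((Dn ^^ j) \<phi> x))\<^sup>2) = (l2_norm V ((Dn ^^ j) \<phi>))\<^sup>2"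
    using Dn_funpow_support[OF assms, of _ j]
    by (intro l2_finite_support(2)[OF finite_Lev Lev_subset, symmetric]) auto
  finally show ?case using Suc by (simp add: wt_def)
qed (simp add: wt_def)

lemma Dn_funpow_orthogonal:
  assumes "generator m \<phi>" "i \<noteq> j"
  shows "l2_inner V ((Dn ^^ i) \<phi>) ((Dn ^^ j) \<phi>) = 0"
proof -
  have "cnj ((Dn ^^ i) \<phi> x) * (Dn ^^ j) \<phi> x = 0" for x
    using Dn_funpow_support[OF assms(1), of x i] Dn_funpow_support[OF assms(1), of x j] assms(2)
    by (cases "x \<in> Lev (m + i)") (auto simp: Lev_def)
  then show ?thesis unfolding l2_inner_def by (simp only: infsum_0_simp)
qed

lemma A_generator:
  assumes "generator m \<phi>"
  shows "A \<phi> = Dn \<phi>"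
proof
  fix x show "A \<phi> x = Dn \<phi> x"
    using assms by (cases "x \<in> V") (auto simp: A_split Dn_def generator_def, simp add: A_eq)
qed

text \<open>After an outward step siblings carry equal values, so the sum over children only
  multiplies by their number. Replacing \<open>lev x\<close> by \<open>m + j\<close> is harmless
  because the function vanishes on all other levels.\<close>

lemma A_Dn_funpow:
  assumes "generator m \<phi>"
  shows "A ((Dn ^^ Suc j) \<phi>) = (\<lambda>x. (Dn ^^ Suc (Suc j)) \<phi> x + of_nat (\<kappa> (m + j)) * (Dn ^^ j) \<phi> x)"
proof
  fix x
  show "A ((Dn ^^ Suc j) \<phi>) x = (Dn ^^ Suc (Suc j)) \<phi> x + of_nat (\<kappa> (m + j)) * (Dn ^^ j) \<phi> x"
  proof (cases "x \<in> V")
    case True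
    have "(\<Sum>y\<in>children x. (Dn ^^ Suc j) \<phi> y) = (\<Sum>y\<in>children x. (Dn ^^ j) \<phi> x)"
      using True by (intro sum.cong refl) (auto simp: Dn_def in_children_iff)
    also have "\<dots> = of_nat (\<kappa> (lev x)) * (Dn ^^ j) \<phi> x" using True by (simp add: card_children)
    also have "\<dots> = of_nat (\<kappa> (m + j)) * (Dn ^^ j) \<phi> x"
      using Dn_funpow_support[OF assms, of x j] True by (cases "lev x = m + j") (auto simp: Lev_def)
    finally show ?thesis using True A_split[OF True, of "(Dn ^^ Suc j) \<phi>"]
      by (simp add: Dn_def)
  next
    case False
    then have "x \<notin> Lev (m + j)" by (simp add: Lev_def)
    with False show ?thesis using Dn_funpow_support[OF assms, of x j] by (simp add: A_eq Dn_def)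
  qed
qed

section \<open>Point masses, and plane waves on free stretches\<close>

definition pt :: "'v \<Rightarrow> 'v \<Rightarrow> complex" where "pt x y = (if y = x then 1 else 0)"

lemma pt_l2: "x \<in> V \<Longrightarrow> pt x \<in> l2 V"
  by (intro l2_finite_support(1)[of "{x}"]) (auto simp: pt_def)

lemma generator_root: "generator 0 (pt rt)"
proof -
  have "rt \<notin> children x" for x by (auto simp: children_def)
  then have "(\<Sum>y\<in>children x. pt rt y) = 0" for x by (intro sum.neutral) (auto simp: pt_def)
  then show ?thesis by (auto simp: generator_def pt_def Lev_def rt_in)
qed

lemma generator_siblings:
  assumes "x \<in> V" "y \<in> children x" "y' \<in> children x"
  shows "generator (lev x + 1) (\<lambda>z. pt y z - pt y' z)"
proof -
  have "(\<Sum>u\<in>children z. pt y u - pt y' u) = 0" if z: "z \<in> V" for z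
  proof (cases "z = x")
    case True
    then show ?thesis using assms finite_children[OF z] by (simp add: pt_def sum_subtractf)
  next
    case False
    then have "y \<notin> children z" "y' \<notin> children z" using assms z by (auto simp: in_children_iff)
    then show ?thesis by (intro sum.neutral) (auto simp: pt_def)
  qed
  moreover have "y \<in> Lev (lev x + 1)" "y' \<in> Lev (lev x + 1)" using assms by (auto simp: children_def Lev_def)
  ultimately show ?thesis by (auto simp: generator_def pt_def)
qed

lemma A_pt:
  assumes "x \<in> V"
  shows "A (pt x) = (\<lambda>z. (if x = rt then 0 else pt (parent x) z) + (\<Sum>y\<in>children x. pt y z))"
proof
  fix z
  show "A (pt x) z = (if x = rt then 0 else pt (parent x) z) + (\<Sum>y\<in>children x. pt y z)"
  proof (cases "z \<in> V")
    case True
    have "A (pt x) z = (\<Sum>y\<in>nbrs z. if y = x then 1 else 0)"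
      using True by (simp add: A_eq pt_def)
    also have "\<dots> = (if x \<in> nbrs z then 1 else 0)" using finite_nbrs[OF True] by simp
    also have "\<dots> = (if z \<in> nbrs x then 1 else 0)" using nbrs_sym[OF assms True] by simp
    also have "\<dots> = (\<Sum>y\<in>nbrs x. pt y z)" using finite_nbrs[OF assms] by (simp add: pt_def)
    also have "\<dots> = (if x = rt then 0 else pt (parent x) z) + (\<Sum>y\<in>children x. pt y z)"
    proof -
      have "x \<noteq> rt \<Longrightarrow> parent x \<notin> children x" using parent[OF assms] by (auto simp: children_def)
      then show ?thesis using assms by (auto simp: nbrs_eq finite_children)
    qed
    finally show ?thesis .
  next
    case False
    then have "pt (parent x) z = 0" if "x \<noteq> rt" using parent[OF assms that] by (auto simp: pt_def)
    moreover have "(\<Sum>y\<in>children x. pt y z) = 0"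
      using False by (intro sum.neutral) (auto simp: pt_def children_def)
    ultimately show ?thesis using False by (simp add: A_eq)
  qed
qed


text \<open>On a free stretch \<open>A\<close> sends a shift to the sum of its two neighbours, so
  \<open>A - (w + 1 / w)\<close> applied to the plane wave telescopes and leaves two terms at each
  end.\<close>

lemma Weyl_sum:
  assumes gen: "generator m \<phi>" and w: "w \<noteq> 0"
    and k1: "\<And>j. b \<le> j \<Longrightarrow> j < b + n \<Longrightarrow> \<kappa> (m + j) = 1"
  defines "S \<equiv> (\<lambda>j. (Dn ^^ j) \<phi>)"
  shows "(\<Sum>j<n. w ^ j * A (S (b + 1 + j)) x) - (w + 1 / w) * (\<Sum>j<n. w ^ j * S (b + 1 + j) x) =
    S b x - S (b + 1) x / w + w ^ n * S (b + n + 1) x / w - w ^ n * S (b + n) x"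
  using k1
proof (induction n)
  case 0
  then show ?case by (simp add: S_def)
next
  case (Suc n)
  have "A (S (b + 1 + n)) x = S (b + n + 2) x + S (b + n) x"
    using A_Dn_funpow[OF gen, of "b + n"] Suc.prems[of "b + n"] by (simp add: S_def)
  then have "(\<Sum>j<Suc n. w ^ j * A (S (b + 1 + j)) x) - (w + 1 / w) * (\<Sum>j<Suc n. w ^ j * S (b + 1 + j) x) =
      ((\<Sum>j<n. w ^ j * A (S (b + 1 + j)) x) - (w + 1 / w) * (\<Sum>j<n. w ^ j * S (b + 1 + j) x)) +
      (w ^ n * (S (b + n + 2) x + S (b + n) x) - (w + 1 / w) * (w ^ n * S (b + n + 1) x))"
    by (simp add: ring_distribs add_ac)
  also have "(\<Sum>j<n. w ^ j * A (S (b + 1 + j)) x) - (w + 1 / w) * (\<Sum>j<n. w ^ j * S (b + 1 + j) x) =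
      S b x - S (b + 1) x / w + w ^ n * S (b + n + 1) x / w - w ^ n * S (b + n) x"
    by (rule Suc.IH) (use Suc.prems in auto)
  also have "\<dots> + (w ^ n * (S (b + n + 2) x + S (b + n) x) - (w + 1 / w) * (w ^ n * S (b + n + 1) x)) =
      S b x - S (b + 1) x / w + w ^ Suc n * S (b + Suc n + 1) x / w - w ^ Suc n * S (b + Suc n) x"
    using w by (simp add: field_simps)
  finally show ?case .
qed

text \<open>Weyl's criterion by contradiction: a bounded resolvent cannot coexist with plane waves
  of length \<open>n\<close>, whose norm grows like \<open>sqrt n\<close> while the error
  \<open>A f - t f\<close> stays bounded.\<close>

lemma spectrum_if_long_free_stretches:
  assumes stretch: "\<And>n. \<exists>b. \<forall>j. b \<le> j \<and> j \<le> b + n \<longrightarrow> \<kappa> j = 1"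
    and t: "t \<in> {-2..2::real}"
  shows "complex_of_real t \<in> op_spectrum V A"
proof (rule ccontr)
  assume "complex_of_real t \<notin> op_spectrum V A"
  then obtain R C where R: "\<And>f. f \<in> l2 V \<Longrightarrow> l2_norm V (R f) \<le> C * l2_norm V f"
      "\<And>f. f \<in> l2 V \<Longrightarrow> R (\<lambda>x. A f x - complex_of_real t * f x) = f"
    unfolding op_spectrum_def bounded_operator_def by blast
  define \<theta> where "\<theta> = arccos (t / 2)"
  have \<theta>: "t = 2 * cos \<theta>" using t by (simp add: \<theta>_def cos_arccos)
  define w where "w = cis \<theta>"
  have "1 / w = cis (- \<theta>)" by (simp add: w_def divide_inverse)
  then have "w + 1 / w = complex_of_real t"
    by (simp add: w_def \<theta> complex_eq_iff)
  moreover have "w \<noteq> 0" "cmod w = 1" by (simp_all add: w_def)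
  ultimately have w: "w \<noteq> 0" "cmod w = 1" "w + 1 / w = complex_of_real t" by auto
  \<comment> \<open>With \<open>N\<close> the common squared norm of the shifts, the wave has
    squared norm \<open>n * N\<close> and the error has norm at most \<open>4 * sqrt N\<close>, so a
    resolvent bound \<open>C\<close> would force \<open>n\<close> to be at most
    \<open>(4 * C)\<^sup>2\<close>.\<close>
  obtain n :: nat where n: "real n > (4 * C)\<^sup>2" using reals_Archimedean2 by blast
  obtain b where b: "\<And>j. b \<le> j \<Longrightarrow> j \<le> b + n \<Longrightarrow> \<kappa> j = 1" using stretch[of n] by blast
  define S where "S = (\<lambda>j. (Dn ^^ j) (pt rt))"
  define N where "N = (l2_norm V (S b))\<^sup>2"
  have Sl2: "S j \<in> l2 V" for j unfolding S_def by (rule Dn_funpow_l2[OF generator_root])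
  have norm: "(l2_norm V (S (b + j)))\<^sup>2 = N" if "j \<le> n + 1" for j
    using that
  proof (induction j)
    case (Suc j)
    have "(l2_norm V (S (b + Suc j)))\<^sup>2 = \<kappa> (b + j) * (l2_norm V (S (b + j)))\<^sup>2"
      unfolding S_def Dn_funpow_norm[OF generator_root] by (simp add: wt_def)
    then show ?case using Suc b[of "b + j"] by simp
  qed (simp add: N_def)
  have "pt rt \<noteq> (\<lambda>x. 0)" by (auto simp: pt_def fun_eq_iff)
  then have "l2_norm V (pt rt) \<noteq> 0" using l2_norm_eq_0D[OF pt_l2[OF rt_in]] by blast
  moreover have "wt (\<lambda>i. \<kappa> i) b > 0"
    using kappa_pos by (auto simp: wt_def intro!: prod_pos simp: Suc_le_eq)
  ultimately have N: "N > 0"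
    using Dn_funpow_norm[OF generator_root, of b] by (simp add: N_def S_def)
  define f where "f = (\<lambda>x. \<Sum>j<n. w ^ j * S (b + 1 + j) x)"
  have fl2: "f \<in> l2 V" unfolding f_def by (intro l2_sum l2_scale Sl2)
  have fn: "(l2_norm V f)\<^sup>2 = real n * N"
  proof -
    have "(l2_norm V f)\<^sup>2 = (\<Sum>j<n. (cmod (w ^ j))\<^sup>2 * (l2_norm V (S (b + 1 + j)))\<^sup>2)"
      unfolding f_def
    proof (rule l2_norm_sq_orthogonal_sum)
      show "l2_inner V (S (b + 1 + i)) (S (b + 1 + j)) = 0" if "i \<noteq> j" for i j
        unfolding S_def using that by (intro Dn_funpow_orthogonal[OF generator_root]) auto
    qed (auto intro: Sl2)
    also have "\<dots> = (\<Sum>j<n. N)"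
    proof (intro sum.cong refl)
      fix j assume "j \<in> {..<n}"
      then show "(cmod (w ^ j))\<^sup>2 * (l2_norm V (S (b + 1 + j)))\<^sup>2 = N"
        using norm[of "1 + j"] w by (simp add: norm_power)
    qed
    finally show ?thesis by simp
  qed
  define g where "g = (\<lambda>x. A f x - complex_of_real t * f x)"
  have gl2: "g \<in> l2 V" unfolding g_def by (intro l2_diff l2_scale fl2 A_bound)
  have g: "g = (\<lambda>x. 1 * S b x + (- (1 / w)) * S (b + 1) x + (w ^ n / w) * S (b + n + 1) x + (- (w ^ n)) * S (b + n) x)"
  proof
    fix x
    have "A f x = (\<Sum>j<n. w ^ j * A (S (b + 1 + j)) x)"
      unfolding f_def A_sum A_scale ..
    then show "g x = 1 * S b x + (- (1 / w)) * S (b + 1) x + (w ^ n / w) * S (b + n + 1) x + (- (w ^ n)) * S (b + n) x"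
      using Weyl_sum[OF generator_root w(1), of b n x] b by (simp add: g_def f_def S_def w(3))
  qed
  have sN: "l2_norm V (S (b + j)) = sqrt N" if "j \<le> n + 1" for j
    using norm[OF that] l2_norm_nonneg by (metis real_sqrt_unique)
  have cS: "l2_norm V (\<lambda>x. c * S (b + j) x) \<le> sqrt N" if "cmod c = 1" "j \<le> n + 1" for c j
    using sN[OF that(2)] that(1) by (simp add: l2_norm_scale)
  have "cmod (w ^ n / w) = 1" "cmod (- (w ^ n)) = 1" "cmod (- (1 / w)) = 1"
    using w by (simp_all add: norm_divide norm_power)
  then have "l2_norm V g \<le> sqrt N + sqrt N + sqrt N + sqrt N"
    unfolding g
    using cS[of 1 0] cS[of "- (1 / w)" 1] cS[of "w ^ n / w" "n + 1"] cS[of "- (w ^ n)" n]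
    by (intro order_trans[OF l2_norm_triangle] add_mono l2_add l2_scale Sl2) (simp_all only: add_0_right add.assoc norm_one order_refl le_add1 le_add2 zero_le)
  have "R g = f" using R(2)[OF fl2] by (simp add: g_def)
  then have "l2_norm V f \<le> C * l2_norm V g" using R(1)[OF gl2] by simp
  also have "\<dots> \<le> \<bar>C\<bar> * (4 * sqrt N)"
    using \<open>l2_norm V g \<le> _\<close> by (intro mult_mono) (auto simp: l2_norm_nonneg)
  finally have "(l2_norm V f)\<^sup>2 \<le> (\<bar>C\<bar> * (4 * sqrt N))\<^sup>2"
    by (intro power_mono) (auto simp: l2_norm_nonneg)
  also have "\<dots> = (4 * C)\<^sup>2 * N" using N by (simp add: power_mult_distrib)
  finally show False using fn N n by simp
qed

lemma essential_spectrum_if_long_free_stretches: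
  assumes stretch: "\<And>n. \<exists>b. \<forall>j. b \<le> j \<and> j \<le> b + n \<longrightarrow> \<kappa> j = 1"
  shows "complex_of_real ` {-2..2} \<subseteq> essential_spectrum V A"
proof
  fix z assume "z \<in> complex_of_real ` {-2..2}"
  then obtain t where t: "z = complex_of_real t" "t \<in> {-2..2}" by blast
  have sub: "complex_of_real ` {-2..2} \<subseteq> op_spectrum V A"
    using spectrum_if_long_free_stretches[OF stretch] by blast
  have "t islimpt {-2..2::real}"
    using t(2) connected_imp_perfect[of "{-2..2::real}" t] by auto
  then have "z islimpt complex_of_real ` {-2..2}"
    unfolding t(1) islimpt_approachable by (fastforce simp: dist_of_real)
  then have "z islimpt op_spectrum V A" using sub islimpt_subset by blast
  then have "\<not> z isolated_in op_spectrum V A"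
    by (simp add: isolated_in_islimpt_iff)
  then show "z \<in> essential_spectrum V A"
    using sub t by (auto simp: essential_spectrum_def discrete_spectrum_def)
qed

end

section \<open>Consequences of the functional calculus\<close>

lemma bounded_borelI:
  assumes "g \<in> borel_measurable borel" "\<And>t. cmod (g t) \<le> C"
  shows "g \<in> bounded_borel"
  using assms by (auto simp: bounded_borel_def bounded_iff)

lemma bounded_borelE:
  assumes "g \<in> bounded_borel"
  obtains C where "\<And>t. cmod (g t) \<le> C"
  using assms by (auto simp: bounded_borel_def bounded_iff)

lemma bounded_borel_const: "(\<lambda>t. c) \<in> bounded_borel"
  by (rule bounded_borelI[of _ "cmod c"]) auto

lemma bounded_borel_add:
  assumes "g \<in> bounded_borel" "h \<in> bounded_borel"
  shows "(\<lambda>t. g t + h t) \<in> bounded_borel"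
proof -
  obtain C D where "\<And>t. cmod (g t) \<le> C" "\<And>t. cmod (h t) \<le> D"
    using assms by (auto elim!: bounded_borelE)
  then show ?thesis using assms
    by (intro bounded_borelI[of _ "C + D"] order_trans[OF norm_triangle_ineq] add_mono)
      (auto simp: bounded_borel_def)
qed

lemma bounded_borel_mult:
  assumes "g \<in> bounded_borel" "h \<in> bounded_borel"
  shows "(\<lambda>t. g t * h t) \<in> bounded_borel"
proof -
  obtain C D where CD: "\<And>t. cmod (g t) \<le> C" "\<And>t. cmod (h t) \<le> D"
    using assms by (auto elim!: bounded_borelE)
  have "0 \<le> C" using CD(1)[of 0] by (meson norm_ge_zero order_trans)
  with CD show ?thesis using assms
    by (intro bounded_borelI[of _ "C * D"]) (auto simp: bounded_borel_def norm_mult intro!: mult_mono)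
qed

text \<open>The coefficients copy \<open>A_Dn_funpow\<close>, so that \<open>sol\<close> evaluated
  at \<open>A\<close> maps a generator to its \<open>j\<close>-th outward shift. \<open>nsol\<close>
  divides by the growth of norm of that shift and is the orthonormal polynomial.\<close>

fun sol :: "(nat \<Rightarrow> nat) \<Rightarrow> real \<Rightarrow> nat \<Rightarrow> real" where
  "sol \<kappa> t 0 = 1"
| "sol \<kappa> t (Suc 0) = t"
| "sol \<kappa> t (Suc (Suc j)) = t * sol \<kappa> t (Suc j) - \<kappa> j * sol \<kappa> t j"

definition nsol :: "(nat \<Rightarrow> nat) \<Rightarrow> real \<Rightarrow> nat \<Rightarrow> real" where
  "nsol \<kappa> t j = sol \<kappa> t j / sqrt (wt \<kappa> j)"

definition ind :: "real set \<Rightarrow> real \<Rightarrow> complex" where "ind B t = (if t \<in> B then 1 else 0)"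

lemma ind_bounded_borel: "B \<in> sets borel \<Longrightarrow> ind B \<in> bounded_borel"
  unfolding ind_def by (rule bounded_borelI[of _ 1]) auto

section \<open>The calculus on cyclic subspaces\<close>

locale sh_calculus = sh_tree V adj rt \<kappa> K
  for V :: "'v set" and adj rt \<kappa> K +
  fixes \<Phi> :: "(real \<Rightarrow> complex) \<Rightarrow> ('v \<Rightarrow> complex) \<Rightarrow> ('v \<Rightarrow> complex)"
  assumes bfc: "borel_functional_calculus V (laplacian V adj) \<Phi>"
begin

lemmas Phi_bounded_operator = bfc[unfolded borel_functional_calculus_def, THEN conjunct1, rule_format]
lemmas Phi_one = bfc[unfolded borel_functional_calculus_def, THEN conjunct2, THEN conjunct1, rule_format]
lemmas Phi_add = bfc[unfolded borel_functional_calculus_def, THEN conjunct2, THEN conjunct2, THEN conjunct1, rule_format]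
lemmas Phi_scale = bfc[unfolded borel_functional_calculus_def, THEN conjunct2, THEN conjunct2, THEN conjunct2, THEN conjunct1, rule_format]
lemmas Phi_mult = bfc[unfolded borel_functional_calculus_def, THEN conjunct2, THEN conjunct2, THEN conjunct2, THEN conjunct2, THEN conjunct1, rule_format]
lemmas Phi_adjoint = bfc[unfolded borel_functional_calculus_def, THEN conjunct2, THEN conjunct2, THEN conjunct2, THEN conjunct2, THEN conjunct2, THEN conjunct1, rule_format]
lemmas Phi_A = bfc[unfolded borel_functional_calculus_def, THEN conjunct2, THEN conjunct2, THEN conjunct2, THEN conjunct2, THEN conjunct2, THEN conjunct2, THEN conjunct2, THEN conjunct1, rule_format]
lemmas Phi_strong_limit = bfc[unfolded borel_functional_calculus_def, THEN conjunct2, THEN conjunct2, THEN conjunct2, THEN conjunct2, THEN conjunct2, THEN conjunct2, THEN conjunct2, THEN conjunct2, rule_format]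
lemmas Phi_l2 = Phi_bounded_operator[unfolded bounded_operator_def, THEN conjunct1, rule_format]
lemmas Phi_arg_add = Phi_bounded_operator[unfolded bounded_operator_def, THEN conjunct2, THEN conjunct1, rule_format]
lemmas Phi_arg_scale = Phi_bounded_operator[unfolded bounded_operator_def, THEN conjunct2, THEN conjunct2, THEN conjunct1, rule_format]

lemma Phi_selfadjoint:
  assumes "g \<in> bounded_borel" "\<And>t. cnj (g t) = g t" "f \<in> l2 V" "f' \<in> l2 V"
  shows "l2_inner V (\<Phi> g f) f' = l2_inner V f (\<Phi> g f')"
  using Phi_adjoint[OF assms(1,3,4)] by (simp add: assms(2))

lemma Phi_tendsto_0:
  assumes "\<And>n. G n \<in> bounded_borel" "\<And>n t. cmod (G n t) \<le> C" "\<And>t. (\<lambda>n. G n t) \<longlonglongrightarrow> 0" "f \<in> l2 V"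
  shows "(\<lambda>n. l2_norm V (\<Phi> (G n) f)) \<longlonglongrightarrow> 0"
proof -
  have "(\<lambda>n. l2_norm V (\<lambda>x. \<Phi> (G n) f x - \<Phi> (\<lambda>t. 0) f x)) \<longlonglongrightarrow> 0"
    by (rule Phi_strong_limit[OF bounded_borel_const _ assms(4)]) (use assms in auto)
  moreover have "\<Phi> (\<lambda>t. 0) f = (\<lambda>x. 0)"
    using Phi_scale[OF bounded_borel_const assms(4), of 0] by simp
  ultimately show ?thesis by simp
qed

lemma Phi_zero: "g \<in> bounded_borel \<Longrightarrow> \<Phi> g (\<lambda>x. 0) = (\<lambda>x. 0)"
  using Phi_arg_scale[of g "\<lambda>x. 0" 0] l2_finite_support(1)[of "{}" V "\<lambda>x. 0"] by simp

lemma Phi_arg_sum: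
  assumes "g \<in> bounded_borel" "\<And>i. i \<in> I \<Longrightarrow> f i \<in> l2 V"
  shows "\<Phi> g (\<lambda>x. \<Sum>i\<in>I. f i x) = (\<lambda>x. \<Sum>i\<in>I. \<Phi> g (f i) x)"
  using assms(2)
proof (induction I rule: infinite_finite_induct)
  case (insert i I)
  then have "\<Phi> g (\<lambda>x. f i x + (\<Sum>i\<in>I. f i x)) = (\<lambda>x. \<Phi> g (f i) x + \<Phi> g (\<lambda>x. \<Sum>i\<in>I. f i x) x)"
    by (intro Phi_arg_add[OF assms(1)] l2_sum) auto
  with insert show ?case by simp
qed (simp_all add: Phi_zero assms)

text \<open>The calculus takes bounded functions only, so the identity is cut off at the spectral
  bound \<open>K + 1\<close>. This is at least 2, and the energies in \<open>[-2,2]\<close> are left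
  untouched.\<close>

definition idc :: "real \<Rightarrow> real" where "idc t = (if \<bar>t\<bar> \<le> K + 1 then t else 0)"

lemma idc_bounded_borel: "(\<lambda>t. complex_of_real (idc t)) \<in> bounded_borel"
  unfolding idc_def by (rule bounded_borelI[of _ "K + 1"]) auto

lemma Phi_idc: "f \<in> l2 V \<Longrightarrow> \<Phi> (\<lambda>t. complex_of_real (idc t)) f = A f"
  using op_spectrum_A_bounded by (intro Phi_A idc_bounded_borel) (force simp: idc_def)+

lemma idc_id: "\<bar>t\<bar> \<le> 2 \<Longrightarrow> idc t = t"
  using kappa_pos[of 0] kappa_le[of 0] by (simp add: idc_def)

lemma sol_bounded_borel: "(\<lambda>t. complex_of_real (sol \<kappa>' (idc t) j)) \<in> bounded_borel"
proof (induction j rule: induct_nat_012)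
  case (ge2 j)
  have "(\<lambda>t. complex_of_real (idc t) * complex_of_real (sol \<kappa>' (idc t) (Suc j)) +
      (- of_nat (\<kappa>' j)) * complex_of_real (sol \<kappa>' (idc t) j)) \<in> bounded_borel"
    by (intro bounded_borel_add bounded_borel_mult bounded_borel_const idc_bounded_borel ge2)
  then show ?case by simp
qed (use idc_bounded_borel bounded_borel_const[of 1] in auto)

lemma Phi_sol:
  assumes gen: "generator m \<phi>"
  shows "\<Phi> (\<lambda>t. complex_of_real (sol (\<lambda>i. \<kappa> (m + i)) (idc t) j)) \<phi> = (Dn ^^ j) \<phi>"
proof (induction j rule: induct_nat_012)
  have \<phi>: "\<phi> \<in> l2 V" using Dn_funpow_l2[OF gen, of 0] by simp
  {
    case 0
    show ?case using Phi_one[OF \<phi>] by simp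
  next
    case 1
    show ?case using Phi_idc[OF \<phi>] A_generator[OF gen] by simp
  next
    case (ge2 j)
    let ?s = "\<lambda>j t. complex_of_real (sol (\<lambda>i. \<kappa> (m + i)) (idc t) j)"
    have "\<Phi> (?s (Suc (Suc j))) \<phi> = \<Phi> (\<lambda>t. complex_of_real (idc t) * ?s (Suc j) t + (- of_nat (\<kappa> (m + j))) * ?s j t) \<phi>"
      by simp
    also have "\<dots> = (\<lambda>x. \<Phi> (\<lambda>t. complex_of_real (idc t) * ?s (Suc j) t) \<phi> x + \<Phi> (\<lambda>t. (- of_nat (\<kappa> (m + j))) * ?s j t) \<phi> x)"
      by (intro Phi_add bounded_borel_mult bounded_borel_const idc_bounded_borel sol_bounded_borel \<phi>)
    also have "\<Phi> (\<lambda>t. complex_of_real (idc t) * ?s (Suc j) t) \<phi> = A ((Dn ^^ Suc j) \<phi>)"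
      unfolding Phi_mult[OF idc_bounded_borel sol_bounded_borel \<phi>] ge2 by (rule Phi_idc[OF Dn_funpow_l2[OF gen]])
    also have "\<Phi> (\<lambda>t. (- of_nat (\<kappa> (m + j))) * ?s j t) \<phi> = (\<lambda>x. (- of_nat (\<kappa> (m + j))) * (Dn ^^ j) \<phi> x)"
      unfolding Phi_scale[OF sol_bounded_borel \<phi>] ge2 ..
    finally show ?case unfolding A_Dn_funpow[OF gen] by simp
  }
qed

lemma wt_pos: "wt (\<lambda>i. \<kappa> (m + i)) j > 0"
  using kappa_pos by (auto simp: wt_def intro!: prod_pos simp: Suc_le_eq)

lemma l2_inner_pt:
  assumes "x \<in> V" shows "l2_inner V (pt x) f = f x"
proof -
  have "l2_inner V (pt x) f = infsum (\<lambda>y. cnj (pt x y) * f y) {x}"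
    unfolding l2_inner_def by (rule infsum_cong_neutral) (use assms in \<open>auto simp: pt_def\<close>)
  then show ?thesis by (simp add: pt_def)
qed

text \<open>Totality of the generators. Induction on the level shows that every point mass is
  killed: siblings have equal images because their difference is a generator, and the common image
  is determined by the parent.\<close>

lemma Phi_eq_0_if_generators:
  assumes g: "g \<in> bounded_borel" and real: "\<And>t. cnj (g t) = g t"
    and root: "\<And>\<phi>. generator 0 \<phi> \<Longrightarrow> \<Phi> g \<phi> = (\<lambda>x. 0)"
    and branch: "\<And>m \<phi>. \<kappa> m \<ge> 2 \<Longrightarrow> generator (m + 1) \<phi> \<Longrightarrow> \<Phi> g \<phi> = (\<lambda>x. 0)"
    and f: "f \<in> l2 V"
  shows "\<Phi> g f = (\<lambda>x. 0)"
proof -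
  have pt0: "\<Phi> g (pt x) = (\<lambda>x. 0)" if "x \<in> V" for x
    using that
  proof (induction "lev x" arbitrary: x rule: less_induct)
    case less
    show ?case
    proof (cases "x = rt")
      case True
      then show ?thesis using root[OF generator_root] by simp
    next
      case False
      define p where "p = parent x"
      have p: "p \<in> V" "lev x = lev p + 1" and xc: "x \<in> children p"
        using parent[OF less.prems False] in_children_iff less.prems False by (auto simp: p_def)
      \<comment> \<open>An only child falls under the trivial case \<open>y = x\<close>; a sibling
        generator is needed only where there are two children, which is what \<open>branch\<close>
        assumes.\<close>
      have same: "\<Phi> g (pt y) = \<Phi> g (pt x)" if y: "y \<in> children p" for y
      proof (cases "y = x")
        case False
        have "card {x, y} \<le> card (children p)"
          using xc y finite_children[OF p(1)] by (intro card_mono) auto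
        then have "\<kappa> (lev p) \<ge> 2" using False p card_children by simp
        then have "\<Phi> g (\<lambda>z. pt y z - pt x z) = (\<lambda>x. 0)"
          using branch generator_siblings[OF p(1) y xc] by simp
        moreover have "\<Phi> g (\<lambda>z. (pt y z - pt x z) + pt x z) = (\<lambda>z. \<Phi> g (\<lambda>z. pt y z - pt x z) z + \<Phi> g (pt x) z)"
          using y less.prems by (intro Phi_arg_add g l2_diff pt_l2) (auto simp: children_def)
        ultimately show ?thesis by simp
      qed simp
      have ch: "y \<in> V" if "y \<in> children p" for y using that by (simp add: children_def)
      \<comment> \<open>\<open>\<Phi> g\<close> commutes with \<open>A\<close> and kills
        \<open>pt p\<close> by induction, so it kills \<open>A (pt p)\<close>. Of this vector the
        part at the parent of \<open>p\<close> is killed too, and the children contribute their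
        number times one image.\<close>
      have "\<Phi> g (A (pt p)) = \<Phi> (\<lambda>t. g t * complex_of_real (idc t)) (pt p)"
        using Phi_mult[OF g idc_bounded_borel pt_l2[OF p(1)]] Phi_idc[OF pt_l2[OF p(1)]] by simp
      also have "\<dots> = \<Phi> (\<lambda>t. complex_of_real (idc t) * g t) (pt p)" by (simp only: mult.commute)
      also have "\<dots> = \<Phi> (\<lambda>t. complex_of_real (idc t)) (\<Phi> g (pt p))"
        by (rule Phi_mult[OF idc_bounded_borel g pt_l2[OF p(1)]])
      also have "\<dots> = (\<lambda>x. 0)" using less.hyps[of p] p by (simp add: Phi_zero idc_bounded_borel)
      finally have A0: "\<Phi> g (A (pt p)) = (\<lambda>x. 0)" .
      have up: "(\<lambda>z. if p = rt then 0 else pt (parent p) z) \<in> l2 V"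
          "\<Phi> g (\<lambda>z. if p = rt then 0 else pt (parent p) z) = (\<lambda>x. 0)"
        using parent[OF p(1)] pt_l2[of "parent p"] l2_finite_support(1)[of "{}" V "\<lambda>x. 0"] Phi_zero[OF g]
          less.hyps[of "parent p"] p(2) by (cases "p = rt"; simp)+
      have "\<Phi> g (A (pt p)) = (\<lambda>z. \<Phi> g (\<lambda>z. if p = rt then 0 else pt (parent p) z) z +
          \<Phi> g (\<lambda>z. \<Sum>y\<in>children p. pt y z) z)"
        unfolding A_pt[OF p(1)] by (intro Phi_arg_add g up l2_sum pt_l2 ch)
      also have "\<Phi> g (\<lambda>z. \<Sum>y\<in>children p. pt y z) = (\<lambda>z. \<Sum>y\<in>children p. \<Phi> g (pt x) z)"
        using same by (subst Phi_arg_sum[OF g]) (auto intro: pt_l2 ch)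
      finally have sum0: "(\<lambda>x. 0) = (\<lambda>z. 0 + (\<Sum>y\<in>children p. \<Phi> g (pt x) z))"
        unfolding A0 up(2) .
      have "of_nat (card (children p)) * \<Phi> g (pt x) z = 0" for z
        using fun_cong[OF sum0, of z] by simp
      moreover have "card (children p) \<noteq> 0" using xc finite_children[OF p(1)] by auto
      ultimately show ?thesis by (auto simp: fun_eq_iff)
    qed
  qed
  show ?thesis
  proof
    fix x
    show "\<Phi> g f x = 0"
    proof (cases "x \<in> V")
      case True
      \<comment> \<open>Self-adjointness moves \<open>\<Phi> g\<close> onto a point mass, which
        replaces a density argument.\<close>
      have "\<Phi> g f x = l2_inner V (\<Phi> g (pt x)) f"
        using Phi_selfadjoint[OF g real pt_l2[OF True] f] l2_inner_pt[OF True] by simp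
      also have "\<dots> = 0" using pt0[OF True] by (simp add: l2_inner_def)
      finally show ?thesis .
    qed (rule l2_outside[OF Phi_l2[OF g f]])
  qed
qed

text \<open>The projection \<open>\<eta>\<close> of \<open>\<phi>\<close> behaves as an eigenvector,
  so its components along the shifts of \<open>\<phi>\<close> are multiples of the polynomial values
  at \<open>E\<close>. Bessel's inequality bounds the sum of the squares
  \<open>nsol\<^sup>2\<close>.\<close>

lemma no_atom:
  assumes gen: "generator m \<phi>" and E: "\<bar>E\<bar> \<le> 2"
    and unb: "\<And>C. \<exists>J. finite J \<and> (\<Sum>j\<in>J. (nsol (\<lambda>i. \<kappa> (m + i)) E j)\<^sup>2) > C"
  shows "\<Phi> (ind {E}) \<phi> = (\<lambda>x. 0)"
proof (rule ccontr)
  let ?s = "\<lambda>j. sol (\<lambda>i. \<kappa> (m + i)) E j" and ?w = "\<lambda>j. wt (\<lambda>i. \<kappa> (m + i)) j"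
  let ?S = "\<lambda>j. (Dn ^^ j) \<phi>"
  define \<eta> where "\<eta> = \<Phi> (ind {E}) \<phi>"
  assume "\<Phi> (ind {E}) \<phi> \<noteq> (\<lambda>x. 0)"
  have \<phi>: "\<phi> \<in> l2 V" using Dn_funpow_l2[OF gen, of 0] by simp
  have i: "ind {E} \<in> bounded_borel" by (rule ind_bounded_borel) auto
  have ir: "cnj (ind {E} t) = ind {E} t" for t by (simp add: ind_def)
  have \<eta>: "\<eta> \<in> l2 V" unfolding \<eta>_def by (intro Phi_l2 i \<phi>)
  have pos: "l2_norm V \<eta> > 0"
    using l2_norm_eq_0D[OF \<eta>] l2_norm_nonneg[of V \<eta>] \<open>\<Phi> _ _ \<noteq> _\<close> by (auto simp: \<eta>_def less_le)
  have "l2_inner V \<eta> \<eta> = l2_inner V \<phi> (\<Phi> (ind {E}) \<eta>)"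
    unfolding \<eta>_def by (rule Phi_selfadjoint[OF i ir \<phi> \<eta>[unfolded \<eta>_def]])
  also have "\<Phi> (ind {E}) \<eta> = \<Phi> (\<lambda>t. ind {E} t * ind {E} t) \<phi>"
    unfolding \<eta>_def by (rule Phi_mult[OF i i \<phi>, symmetric])
  also have "(\<lambda>t. ind {E} t * ind {E} t) = ind {E}" by (auto simp: ind_def)
  finally have ee: "l2_inner V \<phi> \<eta> = (l2_norm V \<eta>)\<^sup>2"
    unfolding \<eta>_def[symmetric] l2_inner_self[OF \<eta>] by simp
  have eS: "l2_inner V \<eta> (?S j) = ?s j * (l2_norm V \<eta>)\<^sup>2" for j
  proof -
    have "l2_inner V \<eta> (?S j) = l2_inner V \<phi> (\<Phi> (ind {E}) (?S j))"
      unfolding \<eta>_def by (rule Phi_selfadjoint[OF i ir \<phi> Dn_funpow_l2[OF gen]])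
    also have "\<Phi> (ind {E}) (?S j) = \<Phi> (\<lambda>t. ind {E} t * complex_of_real (sol (\<lambda>i. \<kappa> (m + i)) (idc t) j)) \<phi>"
      using Phi_mult[OF i sol_bounded_borel \<phi>] Phi_sol[OF gen] by simp
    also have "(\<lambda>t. ind {E} t * complex_of_real (sol (\<lambda>i. \<kappa> (m + i)) (idc t) j)) = (\<lambda>t. complex_of_real (?s j) * ind {E} t)"
      using idc_id[OF E] by (auto simp: ind_def)
    also have "\<Phi> \<dots> \<phi> = (\<lambda>x. complex_of_real (?s j) * \<eta> x)"
      unfolding \<eta>_def by (rule Phi_scale[OF i \<phi>])
    finally show ?thesis by (simp add: l2_inner_scale_right ee)
  qed
  \<comment> \<open>The value of the sum on \<open>J\<close> exceeds the ratio that Cauchy-Schwarz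
    will allow.\<close>
  obtain J where J: "finite J" "(\<Sum>j\<in>J. (nsol (\<lambda>i. \<kappa> (m + i)) E j)\<^sup>2) > (l2_norm V \<phi>)\<^sup>2 / (l2_norm V \<eta>)\<^sup>2"
    using unb by blast
  define T where "T = (\<Sum>j\<in>J. (nsol (\<lambda>i. \<kappa> (m + i)) E j)\<^sup>2)"
  have n2: "(nsol (\<lambda>i. \<kappa> (m + i)) E j)\<^sup>2 = (?s j)\<^sup>2 / ?w j" for j
    using wt_pos[of m j] by (simp add: nsol_def power_divide)
  \<comment> \<open>Up to a constant factor, the expansion of \<open>\<eta>\<close> in the
    orthogonal shifts, truncated to \<open>J\<close>.\<close>
  define \<Psi> where "\<Psi> = (\<lambda>x. \<Sum>j\<in>J. complex_of_real (?s j / ?w j) * ?S j x)"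
  have \<Psi>l2: "\<Psi> \<in> l2 V" unfolding \<Psi>_def by (intro l2_sum l2_scale Dn_funpow_l2[OF gen])
  have "(l2_norm V \<Psi>)\<^sup>2 = (\<Sum>j\<in>J. (cmod (complex_of_real (?s j / ?w j)))\<^sup>2 * (l2_norm V (?S j))\<^sup>2)"
    unfolding \<Psi>_def
    by (rule l2_norm_sq_orthogonal_sum[OF J(1) Dn_funpow_l2[OF gen] Dn_funpow_orthogonal[OF gen]])
  also have "\<dots> = (\<Sum>j\<in>J. (nsol (\<lambda>i. \<kappa> (m + i)) E j)\<^sup>2 * (l2_norm V \<phi>)\<^sup>2)"
  proof (intro sum.cong refl)
    fix j
    have "(?s j / ?w j)\<^sup>2 * (?w j * (l2_norm V \<phi>)\<^sup>2) = (?s j)\<^sup>2 / ?w j * (l2_norm V \<phi>)\<^sup>2"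
      using wt_pos[of m j] by (simp add: power2_eq_square)
    then show "(cmod (complex_of_real (?s j / ?w j)))\<^sup>2 * (l2_norm V (?S j))\<^sup>2 = (nsol (\<lambda>i. \<kappa> (m + i)) E j)\<^sup>2 * (l2_norm V \<phi>)\<^sup>2"
      unfolding n2 Dn_funpow_norm[OF gen] norm_of_real power2_abs .
  qed
  finally have \<Psi>n: "(l2_norm V \<Psi>)\<^sup>2 = T * (l2_norm V \<phi>)\<^sup>2" by (simp add: T_def sum_distrib_right)
  have "l2_inner V \<eta> \<Psi> = (\<Sum>j\<in>J. complex_of_real ((nsol (\<lambda>i. \<kappa> (m + i)) E j)\<^sup>2 * (l2_norm V \<eta>)\<^sup>2))"
  proof -
    have "l2_inner V \<eta> \<Psi> = (\<Sum>j\<in>J. complex_of_real (?s j / ?w j) * (?s j * (l2_norm V \<eta>)\<^sup>2))"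
      unfolding \<Psi>_def
        l2_inner_sum_right[OF \<eta>, of J "\<lambda>j x. complex_of_real (?s j / ?w j) * ?S j x", OF l2_scale[OF Dn_funpow_l2[OF gen]]]
        l2_inner_scale_right eS ..
    also have "\<dots> = (\<Sum>j\<in>J. complex_of_real ((nsol (\<lambda>i. \<kappa> (m + i)) E j)\<^sup>2 * (l2_norm V \<eta>)\<^sup>2))"
      unfolding n2 of_real_mult[symmetric] by (simp add: power2_eq_square mult.assoc)
    finally show ?thesis .
  qed
  also have "\<dots> = complex_of_real (T * (l2_norm V \<eta>)\<^sup>2)" by (simp add: T_def sum_distrib_right)
  finally have "cmod (complex_of_real (T * (l2_norm V \<eta>)\<^sup>2)) \<le> l2_norm V \<eta> * l2_norm V \<Psi>"
    using l2_Cauchy_Schwarz[OF \<eta> \<Psi>l2] by simp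
  moreover have T0: "T \<ge> 0" by (simp add: T_def sum_nonneg)
  ultimately have "T * (l2_norm V \<eta>)\<^sup>2 \<le> l2_norm V \<eta> * l2_norm V \<Psi>" by (simp add: norm_mult norm_power)
  then have "T * l2_norm V \<eta> \<le> l2_norm V \<Psi>" using pos by (simp add: power2_eq_square)
  then have "(T * l2_norm V \<eta>)\<^sup>2 \<le> T * (l2_norm V \<phi>)\<^sup>2"
    unfolding \<Psi>n[symmetric] using T0 pos by (intro power_mono) auto
  moreover have "T > 0"
    using J(2) unfolding T_def[symmetric] by (smt (verit) divide_nonneg_nonneg zero_le_power2)
  ultimately have "T * (l2_norm V \<eta>)\<^sup>2 \<le> (l2_norm V \<phi>)\<^sup>2"
    by (simp add: power_mult_distrib power2_eq_square mult_ac)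
  with J(2) pos show False unfolding T_def[symmetric] by (simp add: field_simps)
qed

text \<open>The indicator of \<open>B\<close> is divided among 1 and two consecutive polynomials,
  with coefficients bounded by 1 that tend to 0 pointwise. Two polynomials are used because a single
  one may be small while the amplitude is large.\<close>

lemma Phi_ind_eq_0_if_unbounded:
  assumes gen: "generator m \<phi>" and B: "B \<in> sets borel" "B \<subseteq> {-2..2}"
    and lim: "\<And>t. t \<in> B \<Longrightarrow>
      filterlim (\<lambda>n. \<bar>nsol (\<lambda>i. \<kappa> (m + i)) t (J n)\<bar> + \<bar>nsol (\<lambda>i. \<kappa> (m + i)) t (J n + 1)\<bar>) at_top sequentially"
  shows "\<Phi> (ind B) \<phi> = (\<lambda>x. 0)"
proof -
  let ?p = "\<lambda>j t. nsol (\<lambda>i. \<kappa> (m + i)) (idc t) j" and ?w = "\<lambda>j. wt (\<lambda>i. \<kappa> (m + i)) j"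
  define \<eta> where "\<eta> = \<Phi> (ind B) \<phi>"
  have \<phi>: "\<phi> \<in> l2 V" using Dn_funpow_l2[OF gen, of 0] by simp
  have i: "ind B \<in> bounded_borel" by (rule ind_bounded_borel[OF B(1)])
  have ir: "cnj (ind B t) = ind B t" for t by (simp add: ind_def)
  have \<eta>: "\<eta> \<in> l2 V" unfolding \<eta>_def by (intro Phi_l2 i \<phi>)
  have p_eq: "complex_of_real (?p j t) = complex_of_real (1 / sqrt (?w j)) * complex_of_real (sol (\<lambda>i. \<kappa> (m + i)) (idc t) j)" for j t
    by (simp add: nsol_def)
  have p_bb: "(\<lambda>t. complex_of_real (?p j t)) \<in> bounded_borel" for j
    unfolding p_eq by (intro bounded_borel_mult bounded_borel_const sol_bounded_borel)
  have p_meas: "?p j \<in> borel_measurable borel" for j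
  proof -
    have "(\<lambda>t. complex_of_real (?p j t)) \<in> borel_measurable borel"
      using p_bb[of j] unfolding bounded_borel_def by blast
    then have "(\<lambda>t. Re (complex_of_real (?p j t))) \<in> borel_measurable borel" by measurable
    then show ?thesis by simp
  qed
  define e where "e j = \<Phi> (\<lambda>t. complex_of_real (?p j t)) \<phi>" for j
  have e_l2: "e j \<in> l2 V" for j unfolding e_def by (intro Phi_l2 p_bb \<phi>)
  have e_norm: "l2_norm V (e j) = l2_norm V \<phi>" for j
  proof -
    have "e j = (\<lambda>x. complex_of_real (1 / sqrt (?w j)) * (Dn ^^ j) \<phi> x)"
      unfolding e_def p_eq Phi_scale[OF sol_bounded_borel \<phi>] Phi_sol[OF gen] ..
    then have "l2_norm V (e j) = cmod (complex_of_real (1 / sqrt (?w j))) * l2_norm V ((Dn ^^ j) \<phi>)"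
      by (simp only: l2_norm_scale)
    then have "(l2_norm V (e j))\<^sup>2 = (1 / sqrt (?w j))\<^sup>2 * (?w j * (l2_norm V \<phi>)\<^sup>2)"
      by (simp only: power_mult_distrib norm_of_real power2_abs Dn_funpow_norm[OF gen])
    also have "\<dots> = (l2_norm V \<phi>)\<^sup>2" using wt_pos[of m j] by (simp add: power_divide)
    finally have "(l2_norm V (e j))\<^sup>2 = (l2_norm V \<phi>)\<^sup>2" .
    then show ?thesis using l2_norm_nonneg by (metis power2_eq_iff_nonneg)
  qed
  \<comment> \<open>The summand 1 keeps the divisor positive; the signs in \<open>h1\<close> and
    \<open>h2\<close> turn the polynomials into their absolute values, so the three pieces add up to
    \<open>u\<close> times \<open>h0\<close>.\<close>
  define u where "u n t = 1 + \<bar>?p (J n) t\<bar> + \<bar>?p (J n + 1) t\<bar>" for n t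
  define h0 where "h0 n t = ind B t / complex_of_real (u n t)" for n t
  define h1 where "h1 n t = h0 n t * complex_of_real (sgn (?p (J n) t))" for n t
  define h2 where "h2 n t = h0 n t * complex_of_real (sgn (?p (J n + 1) t))" for n t
  have u1: "u n t \<ge> 1" for n t by (simp add: u_def)
  have h0le: "cmod (h0 n t) \<le> 1" for n t
    using u1[of n t] by (auto simp: h0_def ind_def norm_divide divide_le_eq)
  have sg: "\<bar>sgn x\<bar> \<le> 1" for x :: real by (simp add: sgn_if)
  have hle: "cmod (h1 n t) \<le> 1" "cmod (h2 n t) \<le> 1" for n t
    using h0le[of n t] sg by (auto simp: h1_def h2_def norm_mult intro!: mult_le_one)
  have [measurable]: "?p j \<in> borel_measurable borel" "ind B \<in> borel_measurable borel" for j
    using p_meas i by (auto simp: bounded_borel_def)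
  have bb: "h0 n \<in> bounded_borel" "h1 n \<in> bounded_borel" "h2 n \<in> bounded_borel" for n
    using h0le hle
    by (auto intro!: bounded_borelI[where C = 1] simp: h0_def[abs_def] h1_def[abs_def] h2_def[abs_def] u_def)
  have hlim: "(\<lambda>n. h0 n t) \<longlonglongrightarrow> 0" for t
  proof (cases "t \<in> B")
    case True
    then have "t \<in> {-2..2}" using B(2) by blast
    then have "\<bar>t\<bar> \<le> 2" by auto
    then have "filterlim (\<lambda>n. \<bar>?p (J n) t\<bar> + \<bar>?p (J n + 1) t\<bar>) at_top sequentially"
      using lim[OF True] by (simp add: idc_id)
    then have "filterlim (\<lambda>n. u n t) at_top sequentially"
      unfolding u_def add.assoc by (intro filterlim_tendsto_add_at_top[OF tendsto_const])
    then have "(\<lambda>n. inverse (u n t)) \<longlonglongrightarrow> 0" by (rule tendsto_inverse_0_at_top)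
    then have "(\<lambda>n. complex_of_real (inverse (u n t))) \<longlonglongrightarrow> complex_of_real 0" by (rule tendsto_of_real)
    then show ?thesis using True by (simp add: h0_def ind_def field_simps)
  qed (simp add: h0_def ind_def)
  have hle0: "cmod (h1 n t) \<le> cmod (h0 n t)" "cmod (h2 n t) \<le> cmod (h0 n t)" for n t
    using sg by (auto simp: h1_def h2_def norm_mult intro!: mult_left_le)
  have hlim': "(\<lambda>n. h1 n t) \<longlonglongrightarrow> 0" "(\<lambda>n. h2 n t) \<longlonglongrightarrow> 0" for t
    using hle0 by (auto intro!: Lim_null_comparison[OF _ tendsto_norm_zero[OF hlim[of t]]])
  have split: "ind B t = h0 n t + (h1 n t * complex_of_real (?p (J n) t) + h2 n t * complex_of_real (?p (J n + 1) t))" for n t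
  proof -
    have "h0 n t + (h1 n t * complex_of_real (?p (J n) t) + h2 n t * complex_of_real (?p (J n + 1) t)) =
        h0 n t * complex_of_real (1 + (sgn (?p (J n) t) * ?p (J n) t + sgn (?p (J n + 1) t) * ?p (J n + 1) t))"
      by (simp add: h1_def h2_def algebra_simps)
    also have "1 + (sgn (?p (J n) t) * ?p (J n) t + sgn (?p (J n + 1) t) * ?p (J n + 1) t) = u n t"
      by (simp only: u_def abs_sgn mult.commute add.assoc)
    finally show ?thesis using u1[of n t] by (simp add: h0_def)
  qed
  have \<eta>eq: "\<eta> = (\<lambda>x. \<Phi> (h0 n) \<phi> x + (\<Phi> (h1 n) (e (J n)) x + \<Phi> (h2 n) (e (J n + 1)) x))" for n
  proof -
    have "\<eta> = \<Phi> (\<lambda>t. h0 n t + (h1 n t * complex_of_real (?p (J n) t) + h2 n t * complex_of_real (?p (J n + 1) t))) \<phi>"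
      unfolding \<eta>_def split[of _ n, symmetric] by simp
    then show ?thesis
      by (simp add: Phi_add bb bounded_borel_add bounded_borel_mult p_bb \<phi> Phi_mult e_def)
  qed
  \<comment> \<open>Strong convergence acts on a fixed vector, whereas \<open>e (J n)\<close> moves
    with \<open>n\<close>. The coefficient functions are therefore shifted to the fixed vector
    \<open>\<eta>\<close>, leaving only the constant norm of \<open>e\<close>.\<close>
  have inner: "cmod (l2_inner V \<eta> (\<Phi> g f)) \<le> l2_norm V (\<Phi> g \<eta>) * l2_norm V f"
    if "g \<in> bounded_borel" "\<And>t. cnj (g t) = g t" "f \<in> l2 V" for g f
    using l2_Cauchy_Schwarz[OF Phi_l2[OF that(1) \<eta>] that(3)] Phi_selfadjoint[OF that(1,2) \<eta> that(3)] by simp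
  have hr: "cnj (h0 n t) = h0 n t" "cnj (h1 n t) = h1 n t" "cnj (h2 n t) = h2 n t" for n t
    by (simp_all add: h0_def h1_def h2_def ind_def)
  have bound: "(l2_norm V \<eta>)\<^sup>2 \<le>
      (l2_norm V (\<Phi> (h0 n) \<eta>) + (l2_norm V (\<Phi> (h1 n) \<eta>) + l2_norm V (\<Phi> (h2 n) \<eta>))) * l2_norm V \<phi>" for n
  proof -
    have "complex_of_real ((l2_norm V \<eta>)\<^sup>2) = l2_inner V \<eta> \<eta>" by (simp add: l2_inner_self[OF \<eta>])
    also have "\<dots> = l2_inner V \<eta> (\<lambda>x. \<Phi> (h0 n) \<phi> x + (\<Phi> (h1 n) (e (J n)) x + \<Phi> (h2 n) (e (J n + 1)) x))"
      using \<eta>eq[of n] by simp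
    also have "\<dots> = l2_inner V \<eta> (\<Phi> (h0 n) \<phi>) + (l2_inner V \<eta> (\<Phi> (h1 n) (e (J n))) + l2_inner V \<eta> (\<Phi> (h2 n) (e (J n + 1))))"
      by (simp add: l2_inner_add_right l2_add \<eta> Phi_l2 bb \<phi> e_l2)
    finally have eq: "complex_of_real ((l2_norm V \<eta>)\<^sup>2) =
      l2_inner V \<eta> (\<Phi> (h0 n) \<phi>) + (l2_inner V \<eta> (\<Phi> (h1 n) (e (J n))) + l2_inner V \<eta> (\<Phi> (h2 n) (e (J n + 1))))" .
    have "(l2_norm V \<eta>)\<^sup>2 = cmod (complex_of_real ((l2_norm V \<eta>)\<^sup>2))" by (simp add: norm_power)
    also have "\<dots> \<le> cmod (l2_inner V \<eta> (\<Phi> (h0 n) \<phi>)) + (cmod (l2_inner V \<eta> (\<Phi> (h1 n) (e (J n)))) + cmod (l2_inner V \<eta> (\<Phi> (h2 n) (e (J n + 1)))))"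
      unfolding eq by (intro order_trans[OF norm_triangle_ineq] add_mono order_refl)
    also have "\<dots> \<le> l2_norm V (\<Phi> (h0 n) \<eta>) * l2_norm V \<phi> + (l2_norm V (\<Phi> (h1 n) \<eta>) * l2_norm V \<phi> + l2_norm V (\<Phi> (h2 n) \<eta>) * l2_norm V \<phi>)"
      using inner[OF bb(1) hr(1) \<phi>] inner[OF bb(2) hr(2) e_l2] inner[OF bb(3) hr(3) e_l2]
      by (intro add_mono) (simp_all only: e_norm)
    finally show ?thesis by (simp add: algebra_simps)
  qed
  have "(\<lambda>n. (l2_norm V (\<Phi> (h0 n) \<eta>) + (l2_norm V (\<Phi> (h1 n) \<eta>) + l2_norm V (\<Phi> (h2 n) \<eta>))) * l2_norm V \<phi>) \<longlonglongrightarrow> (0 + (0 + 0)) * l2_norm V \<phi>"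
    using h0le hle hlim hlim' \<eta> bb by (intro tendsto_intros Phi_tendsto_0[where C = 1]) auto
  then have "(l2_norm V \<eta>)\<^sup>2 \<le> (0 + (0 + 0)) * l2_norm V \<phi>"
    by (rule LIMSEQ_le_const) (use bound in auto)
  then have "l2_norm V \<eta> = 0" by simp
  then show ?thesis using l2_norm_eq_0D[OF \<eta>] by (simp add: \<eta>_def)
qed

end

section \<open>Amplitudes of solutions\<close>

text \<open>One step of the recurrence in the coordinate \<open>osc\<close>, across a level with
  \<open>\<kappa>\<close> children. \<open>Im u / sin k\<close> recovers the normalised value of the
  solution there, and \<open>sqrt \<kappa>\<close> comes from the change of \<open>wt\<close>. For
  \<open>\<kappa> = 1\<close> it is the rotation by \<open>k\<close>.\<close>

definition bump :: "real \<Rightarrow> real \<Rightarrow> complex \<Rightarrow> complex" where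
  "bump \<kappa> k u = (cis k * u - of_real ((\<kappa> - 1) * Im u / sin k)) / of_real (sqrt \<kappa>)"

text \<open>The mean of the squared modulus of \<open>bump\<close> over all phases of a unit
  argument.\<close>

definition bump_mean :: "real \<Rightarrow> real \<Rightarrow> real" where
  "bump_mean \<kappa> k = 1 + ((\<kappa> - 1) / sin k)\<^sup>2 / (2 * \<kappa>)"

text \<open>As a real linear map of the plane, \<open>bump\<close> has determinant 1. The
  eigenvalues of the quadratic form, the mean plus or minus the square root of
  \<open>\<alpha>\<^sup>2 + \<beta>\<^sup>2\<close>, thus have product 1, which is the first
  identity.\<close>

lemma norm_bump_sq:
  assumes "\<kappa> > 0" "sin k \<noteq> 0"
  obtains \<alpha> \<beta> where "\<alpha>\<^sup>2 + \<beta>\<^sup>2 = (bump_mean \<kappa> k)\<^sup>2 - 1"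
    "\<And>w. (norm (bump \<kappa> k w))\<^sup>2 = bump_mean \<kappa> k * (norm w)\<^sup>2 - \<alpha> * Re (w\<^sup>2) - \<beta> * Im (w\<^sup>2)"
proof
  define c where "c = (\<kappa> - 1) / sin k"
  have c: "c * sin k = \<kappa> - 1" using assms by (simp add: c_def)
  have A: "bump_mean \<kappa> k = 1 + c\<^sup>2 / (2 * \<kappa>)" by (simp add: bump_mean_def c_def)
  let ?\<alpha> = "(\<kappa> - 1 + c\<^sup>2 / 2) / \<kappa>" and ?\<beta> = "c * cos k / \<kappa>"
  have "(c * cos k)\<^sup>2 = c\<^sup>2 - (\<kappa> - 1)\<^sup>2"
    unfolding c[symmetric] power_mult_distrib cos_squared_eq by (simp add: algebra_simps)
  then have "\<kappa>\<^sup>2 * (?\<alpha>\<^sup>2 + ?\<beta>\<^sup>2) = (\<kappa> - 1 + c\<^sup>2 / 2)\<^sup>2 + (c\<^sup>2 - (\<kappa> - 1)\<^sup>2)"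
    using assms by (simp add: power_divide add_divide_distrib[symmetric])
  also have "\<dots> = \<kappa>\<^sup>2 * ((bump_mean \<kappa> k)\<^sup>2 - 1)"
    using assms unfolding A by (simp add: power2_eq_square field_simps)
  finally show "?\<alpha>\<^sup>2 + ?\<beta>\<^sup>2 = (bump_mean \<kappa> k)\<^sup>2 - 1" using assms by simp
  fix w
  define x y where "x = Re w" and "y = Im w"
  have w: "w = Complex x y" by (simp add: x_def y_def)
  have sc: "(cos k)\<^sup>2 + (sin k)\<^sup>2 = 1" by simp
  have "\<kappa> * (norm (bump \<kappa> k w))\<^sup>2 = (norm (cis k * w - of_real (c * y)))\<^sup>2"
    using assms by (simp add: bump_def norm_divide power_divide c_def y_def)
  also have "\<dots> = (x * cos k - y * sin k - c * y)\<^sup>2 + (x * sin k + y * cos k)\<^sup>2"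
    by (simp add: cmod_power2 w cis.ctr mult_ac)
  also have "\<dots> = ((cos k)\<^sup>2 + (sin k)\<^sup>2) * (x\<^sup>2 + y\<^sup>2) - 2 * c * cos k * x * y + 2 * (c * sin k) * y\<^sup>2 + c\<^sup>2 * y\<^sup>2"
    by algebra
  also have "\<dots> = x\<^sup>2 + y\<^sup>2 - 2 * c * cos k * x * y + 2 * (\<kappa> - 1) * y\<^sup>2 + c\<^sup>2 * y\<^sup>2"
    unfolding sc c by simp
  also have "\<dots> = \<kappa> * (bump_mean \<kappa> k * (norm w)\<^sup>2 - ?\<alpha> * Re (w\<^sup>2) - ?\<beta> * Im (w\<^sup>2))"
  proof -
    have ri: "(norm w)\<^sup>2 = x\<^sup>2 + y\<^sup>2" "Re (w\<^sup>2) = x\<^sup>2 - y\<^sup>2" "Im (w\<^sup>2) = 2 * x * y"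
      by (simp_all add: w cmod_power2) (simp_all add: power2_eq_square)
    show ?thesis unfolding A ri using assms by (simp add: power2_eq_square field_simps)
  qed
  finally show "(norm (bump \<kappa> k w))\<^sup>2 = bump_mean \<kappa> k * (norm w)\<^sup>2 - ?\<alpha> * Re (w\<^sup>2) - ?\<beta> * Im (w\<^sup>2)"
    using assms by simp
qed

lemma bump_mean_ge:
  assumes "\<kappa> > 0" "sin k \<noteq> 0"
  shows "bump_mean \<kappa> k \<ge> 1 + (\<kappa> - 1)\<^sup>2 / (2 * \<kappa>)"
proof -
  have "(sin k)\<^sup>2 \<le> 1" by (simp add: abs_square_le_1)
  then have "(\<kappa> - 1)\<^sup>2 \<le> ((\<kappa> - 1) / sin k)\<^sup>2"
    using assms by (simp add: power_divide le_divide_eq mult_left_le)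
  then show ?thesis using assms by (simp add: bump_mean_def divide_right_mono)
qed

text \<open>For \<open>A = bump_mean \<kappa> k\<close> the smaller eigenvalue of the form is
  \<open>A - sqrt (A\<^sup>2 - 1)\<close>, and this is at least \<open>1 / (2 * A)\<close>.\<close>

lemma norm_bump_ge:
  assumes "\<kappa> > 0" "sin k \<noteq> 0"
  shows "(norm (bump \<kappa> k w))\<^sup>2 \<ge> (norm w)\<^sup>2 / (2 * bump_mean \<kappa> k)"
proof -
  define A where "A = bump_mean \<kappa> k"
  have A: "A \<ge> 1" using assms by (simp add: A_def bump_mean_def)
  obtain \<alpha> \<beta> where ab: "\<alpha>\<^sup>2 + \<beta>\<^sup>2 = A\<^sup>2 - 1"
    "(norm (bump \<kappa> k w))\<^sup>2 = A * (norm w)\<^sup>2 - \<alpha> * Re (w\<^sup>2) - \<beta> * Im (w\<^sup>2)"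
    using norm_bump_sq[OF assms] unfolding A_def by metis
  define X Y \<rho> where "X = Re (w\<^sup>2)" and "Y = Im (w\<^sup>2)" and "\<rho> = (norm w)\<^sup>2"
  have XY: "X\<^sup>2 + Y\<^sup>2 = \<rho>\<^sup>2"
    unfolding X_def Y_def \<rho>_def cmod_power2[symmetric] norm_power ..
  have "(\<alpha> * X + \<beta> * Y)\<^sup>2 + (\<alpha> * Y - \<beta> * X)\<^sup>2 = (\<alpha>\<^sup>2 + \<beta>\<^sup>2) * (X\<^sup>2 + Y\<^sup>2)" by algebra
  then have "(\<alpha> * X + \<beta> * Y)\<^sup>2 \<le> (A\<^sup>2 - 1) * \<rho>\<^sup>2"
    unfolding ab XY by (smt (verit) zero_le_power2)
  also have "\<dots> \<le> (A - 1 / (2 * A))\<^sup>2 * \<rho>\<^sup>2"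
    using A by (intro mult_right_mono) (auto simp: power2_diff power_divide)
  also have "\<dots> = ((A - 1 / (2 * A)) * \<rho>)\<^sup>2" by (simp add: power_mult_distrib)
  finally have "\<alpha> * X + \<beta> * Y \<le> (A - 1 / (2 * A)) * \<rho>"
  proof (rule power2_le_imp_le)
    have "1 / (2 * A) \<le> A" using A by (smt (verit) divide_le_eq_1 mult_less_cancel_left2)
    then show "0 \<le> (A - 1 / (2 * A)) * \<rho>" by (simp add: \<rho>_def)
  qed
  then show ?thesis unfolding ab(2) X_def[symmetric] Y_def[symmetric] \<rho>_def[symmetric] A_def[symmetric]
    by (simp add: algebra_simps)
qed

lemma bump_nonzero: "\<kappa> > 0 \<Longrightarrow> sin k \<noteq> 0 \<Longrightarrow> w \<noteq> 0 \<Longrightarrow> bump \<kappa> k w \<noteq> 0"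
proof
  assume *: "\<kappa> > 0" "sin k \<noteq> 0" "w \<noteq> 0" "bump \<kappa> k w = 0"
  have "bump_mean \<kappa> k > 0" using * by (simp add: bump_mean_def add_pos_nonneg)
  then have "(norm w)\<^sup>2 / (2 * bump_mean \<kappa> k) > 0" using * by simp
  then show False using norm_bump_ge[OF *(1,2), of w] * by simp
qed

lemma bump_scale: "bump \<kappa> k (of_real r * u) = of_real r * bump \<kappa> k u"
  by (simp add: bump_def algebra_simps diff_divide_distrib)

section \<open>Averages over the phase\<close>

lemma has_integral_Poisson:
  fixes P a b D :: real
  assumes D: "D > 0" "D\<^sup>2 = P\<^sup>2 - a\<^sup>2 - b\<^sup>2" and P: "P > 0"
  shows "((\<lambda>s. 1 / (P - a * cos (2 * s) - b * sin (2 * s))) has_integral pi / D) {0..pi}"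
proof -
  define e where "e s = a * cos (2 * s) + b * sin (2 * s)" for s
  define n where "n s = a * sin (2 * s) - b * cos (2 * s)" for s
  \<comment> \<open>The antiderivative with a half-angle tangent jumps inside the period. In this
    form the denominator stays positive, so \<open>F\<close> is smooth; its arctan part is periodic
    and the linear part alone gives \<open>pi / D\<close>.\<close>
  define F where "F s = (s + arctan (n s / (D + P - e s))) / D" for s
  have en: "(e s)\<^sup>2 + (n s)\<^sup>2 = P\<^sup>2 - D\<^sup>2" for s
  proof -
    have "(e s)\<^sup>2 + (n s)\<^sup>2 = (a\<^sup>2 + b\<^sup>2) * ((cos (2 * s))\<^sup>2 + (sin (2 * s))\<^sup>2)"
      unfolding e_def n_def by algebra
    then show ?thesis using D by simp
  qed
  have eP: "e s < P" for s
  proof (rule power2_less_imp_less)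
    show "(e s)\<^sup>2 < P\<^sup>2" using en[of s] D by (smt (verit) zero_le_power2 zero_less_power2)
  qed (use P in simp)
  have der: "(F has_real_derivative 1 / (P - a * cos (2 * s) - b * sin (2 * s))) (at s)" for s
  proof -
    let ?d = "D + P - e s"
    have d: "?d > 0" using eP[of s] D by simp
    have dn: "(n has_real_derivative 2 * e s) (at s)" and de: "(e has_real_derivative - 2 * n s) (at s)"
      unfolding n_def e_def by (auto intro!: derivative_eq_intros)
    have "((\<lambda>s. n s / (D + P - e s)) has_real_derivative (2 * e s * ?d - n s * (0 - - 2 * n s)) / (?d * ?d)) (at s)"
      using d by (intro DERIV_divide dn DERIV_diff DERIV_const de) simp
    then have "(F has_real_derivative (1 + inverse (1 + (n s / ?d)\<^sup>2) * ((2 * e s * ?d - n s * (0 - - 2 * n s)) / (?d * ?d))) / D) (at s)"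
      unfolding F_def by (intro DERIV_cdivide DERIV_add DERIV_ident DERIV_chain2[OF DERIV_arctan])
    moreover have "(1 + inverse (1 + (n s / ?d)\<^sup>2) * ((2 * e s * ?d - n s * (0 - - 2 * n s)) / (?d * ?d))) / D = 1 / (P - e s)"
    proof -
      have dd: "1 + (n s / ?d)\<^sup>2 = (?d\<^sup>2 + (n s)\<^sup>2) / ?d\<^sup>2" using d by (simp add: field_simps)
      have "?d\<^sup>2 + (n s)\<^sup>2 = (D + P)\<^sup>2 - 2 * (D + P) * e s + ((e s)\<^sup>2 + (n s)\<^sup>2)" by algebra
      then have den: "?d\<^sup>2 + (n s)\<^sup>2 = 2 * (D + P) * (P - e s)" unfolding en by algebra
      have "2 * e s * ?d - n s * (0 - - 2 * n s) = 2 * (D + P) * e s - 2 * ((e s)\<^sup>2 + (n s)\<^sup>2)" by algebra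
      then have num: "2 * e s * ?d - n s * (0 - - 2 * n s) = 2 * (D + P) * (e s - P + D)" unfolding en by algebra
      have "inverse (1 + (n s / ?d)\<^sup>2) * ((2 * e s * ?d - n s * (0 - - 2 * n s)) / (?d * ?d)) =
          (2 * (D + P) * (e s - P + D)) / (2 * (D + P) * (P - e s))"
        unfolding dd den num using d by (simp add: power2_eq_square)
      also have "\<dots> = (e s - P + D) / (P - e s)" using D P by simp
      finally show ?thesis using eP[of s] D by (simp add: field_simps)
    qed
    ultimately show ?thesis by (simp add: e_def algebra_simps)
  qed
  have "((\<lambda>s. 1 / (P - a * cos (2 * s) - b * sin (2 * s))) has_integral F pi - F 0) {0..pi}"
    by (rule fundamental_theorem_of_calculus)
      (auto intro!: has_field_derivative_at_within[OF der] simp flip: has_real_derivative_iff_has_vector_derivative)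
  moreover have "F pi - F 0 = pi / D" by (simp add: F_def n_def e_def add_divide_distrib)
  ultimately show ?thesis by simp
qed

text \<open>With \<open>D\<close> the inverse of the phase mean of
  \<open>1 / (1 + h\<^sup>2)\<close>, the best choice of \<open>l\<close> in the bound below makes
  the mean equal to \<open>sqrt (2 / D)\<close>. The least \<open>D\<close> over all energies is
  \<open>(\<kappa> + 1) / sqrt \<kappa>\<close>, attained where \<open>sin k\<close> is 1 or -1. The
  rate is below 1 by the arithmetic-geometric mean inequality.\<close>

definition bump_rate :: "real \<Rightarrow> real" where
  "bump_rate \<kappa> = sqrt (sqrt (4 * \<kappa> / (\<kappa> + 1)\<^sup>2))"

lemma bump_rate:
  assumes "\<kappa> > 1"
  shows "0 < bump_rate \<kappa>" "bump_rate \<kappa> < 1"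
proof -
  have "4 * \<kappa> < (\<kappa> + 1)\<^sup>2" using assms zero_less_power2[of "\<kappa> - 1"] by (simp add: power2_eq_square algebra_simps)
  then show "0 < bump_rate \<kappa>" "bump_rate \<kappa> < 1" using assms by (auto simp: bump_rate_def)
qed

lemma continuous_on_bump [continuous_intros]:
  fixes k :: "'a :: t2_space \<Rightarrow> real"
  assumes "continuous_on S k" "continuous_on S u" "\<And>x. x \<in> S \<Longrightarrow> sin (k x) \<noteq> 0" "\<kappa> > 0"
  shows "continuous_on S (\<lambda>x. bump \<kappa> (k x) (u x))"
  using assms unfolding bump_def by (auto intro!: continuous_intros continuous_on_sin)

text \<open>The mean of \<open>1 / \<bar>bump\<bar>\<^sup>2\<close> over the phase is exactly \<open>1\<close>, so by strict concavity the mean of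
  \<open>1 / \<bar>bump\<bar>\<close> is smaller. Quantitatively, with \<open>h = \<bar>bump\<bar>\<close>, apply
  \<open>1 / h \<le> (l (1 / h\<^sup>2 + 1) + 1 / (l (1 + h\<^sup>2))) / 2\<close>, whose right-hand side has an explicit mean.\<close>

lemma integral_inverse_norm_bump_le:
  assumes \<kappa>: "\<kappa> > 1" and k: "sin k \<noteq> 0" and u: "u \<noteq> 0"
  shows "integral {0..pi} (\<lambda>s. inverse (norm (bump \<kappa> k (cis s * u)))) \<le> pi * (bump_rate \<kappa> * inverse (norm u))"
proof -
  have \<kappa>0: "\<kappa> > 0" using \<kappa> by simp
  define v where "v = sgn u"
  have v: "norm v = 1" and uv: "u = of_real (norm u) * v"
    using u by (simp_all add: v_def norm_sgn, simp add: sgn_eq)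
  define A where "A = bump_mean \<kappa> k"
  have A1: "A \<ge> 1" using \<kappa> by (simp add: A_def bump_mean_def)
  obtain \<alpha> \<beta> where ab: "\<alpha>\<^sup>2 + \<beta>\<^sup>2 = A\<^sup>2 - 1"
    "\<And>w. (norm (bump \<kappa> k w))\<^sup>2 = A * (norm w)\<^sup>2 - \<alpha> * Re (w\<^sup>2) - \<beta> * Im (w\<^sup>2)"
    using norm_bump_sq[OF \<kappa>0 k] unfolding A_def by metis
  define X Y where "X = Re (v\<^sup>2)" and "Y = Im (v\<^sup>2)"
  have XY: "X\<^sup>2 + Y\<^sup>2 = 1" unfolding X_def Y_def cmod_power2[symmetric] norm_power v by simp
  define a b where "a = \<alpha> * X + \<beta> * Y" and "b = \<beta> * X - \<alpha> * Y"
  have "a\<^sup>2 + b\<^sup>2 = (\<alpha>\<^sup>2 + \<beta>\<^sup>2) * (X\<^sup>2 + Y\<^sup>2)" unfolding a_def b_def by algebra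
  then have ab2: "a\<^sup>2 + b\<^sup>2 = A\<^sup>2 - 1" using ab XY by simp
  define h where "h s = norm (bump \<kappa> k (cis s * v))" for s
  have h2: "(h s)\<^sup>2 = A - a * cos (2 * s) - b * sin (2 * s)" for s
  proof -
    have "(cis s * v)\<^sup>2 = cis (2 * s) * v\<^sup>2" by (simp add: power_mult_distrib power2_eq_square cis_mult)
    then have ri: "Re ((cis s * v)\<^sup>2) = X * cos (2 * s) - Y * sin (2 * s)" "Im ((cis s * v)\<^sup>2) = X * sin (2 * s) + Y * cos (2 * s)"
      by (simp_all add: X_def Y_def)
    show ?thesis unfolding h_def ab(2) ri norm_mult v by (simp add: a_def b_def algebra_simps)
  qed
  have hpos: "h s > 0" for s
  proof -
    have "v \<noteq> 0" using v by auto
    then show ?thesis using bump_nonzero[OF \<kappa>0 k, of "cis s * v"] by (simp add: h_def)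
  qed
  define q where "q = bump_rate \<kappa>"
  have q: "q > 0" using bump_rate[OF \<kappa>] by (simp add: q_def)
  \<comment> \<open>For \<open>1 + h\<^sup>2\<close> the discriminant in the Poisson integral is
    \<open>(1 + A)\<^sup>2 - (A\<^sup>2 - 1)\<close>; for \<open>h\<^sup>2\<close> itself it is
    1.\<close>
  define D where "D = sqrt (2 + 2 * A)"
  have Dq: "D \<ge> 2 / q\<^sup>2"
  proof -
    have "q\<^sup>2 = sqrt (4 * \<kappa> / (\<kappa> + 1)\<^sup>2)" using \<kappa> by (simp add: q_def bump_rate_def)
    then have "(2 / q\<^sup>2)\<^sup>2 = 4 / (4 * \<kappa> / (\<kappa> + 1)\<^sup>2)" using \<kappa> by (simp add: power_divide)
    also have "\<dots> = 4 + 2 * ((\<kappa> - 1)\<^sup>2 / (2 * \<kappa>))" using \<kappa> by (simp add: power2_eq_square field_simps)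
    also have "\<dots> \<le> 2 + 2 * A" using bump_mean_ge[OF \<kappa>0 k] by (simp add: A_def)
    finally have "(2 / q\<^sup>2)\<^sup>2 \<le> 2 + 2 * A" .
    then show ?thesis unfolding D_def by (rule real_le_rsqrt)
  qed
  have i1: "((\<lambda>s. 1 / (h s)\<^sup>2) has_integral pi / 1) {0..pi}"
    unfolding h2 using ab2 A1 by (intro has_integral_Poisson) auto
  have i2: "((\<lambda>s. 1 / (1 + (h s)\<^sup>2)) has_integral pi / D) {0..pi}"
  proof -
    have "((\<lambda>s. 1 / ((1 + A) - a * cos (2 * s) - b * sin (2 * s))) has_integral pi / D) {0..pi}"
    proof (rule has_integral_Poisson)
      show "D\<^sup>2 = (1 + A)\<^sup>2 - a\<^sup>2 - b\<^sup>2" using ab2 A1 by (simp add: D_def power2_sum)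
    qed (use A1 in \<open>auto simp: D_def\<close>)
    moreover have "1 + (h s)\<^sup>2 = (1 + A) - a * cos (2 * s) - b * sin (2 * s)" for s
      by (simp add: h2)
    ultimately show ?thesis by (simp only:)
  qed
  have ub: "((\<lambda>s. (1 / 2) * ((q / 2) * (1 / (h s)\<^sup>2 + 1) + (2 / q) * (1 / (1 + (h s)\<^sup>2)))) has_integral
      (1 / 2) * ((q / 2) * (pi / 1 + (pi - 0) * 1) + (2 / q) * (pi / D))) {0..pi}"
    using has_integral_const_real[of "1::real" 0 pi]
    by (intro has_integral_mult_right has_integral_add i1 i2) simp
  have pw: "inverse (h s) \<le> (1 / 2) * ((q / 2) * (1 / (h s)\<^sup>2 + 1) + (2 / q) * (1 / (1 + (h s)\<^sup>2)))" for s
  proof -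
    \<comment> \<open>Expanding the square \<open>(y / h s - 1)\<^sup>2\<close> gives the announced
      inequality with \<open>l = q / 2\<close>.\<close>
    define y where "y = q / 2 * (1 + (h s)\<^sup>2)"
    have y: "y > 0" using q by (simp add: y_def add_pos_nonneg)
    have "0 \<le> (y / h s - 1)\<^sup>2 / y" using y by simp
    also have "\<dots> = y / (h s)\<^sup>2 + 1 / y - 2 * inverse (h s)"
      using y hpos[of s] by (simp add: power2_eq_square field_simps)
    finally have "2 * inverse (h s) \<le> y / (h s)\<^sup>2 + 1 / y" by simp
    moreover have "y / (h s)\<^sup>2 = (q / 2) * (1 / (h s)\<^sup>2 + 1)"
      using hpos[of s] by (simp add: y_def field_simps)
    moreover have "1 / y = (2 / q) * (1 / (1 + (h s)\<^sup>2))" by (simp add: y_def)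
    ultimately show ?thesis by simp
  qed
  have hcont: "continuous_on {0..pi} (\<lambda>s. inverse (h s))"
  proof -
    have "continuous_on {0..pi} h"
      unfolding h_def using k \<kappa>0 by (intro continuous_intros) auto
    then show ?thesis by (rule continuous_on_inverse) (use hpos in \<open>metis less_irrefl\<close>)
  qed
  have "integral {0..pi} (\<lambda>s. inverse (h s)) \<le> (1 / 2) * ((q / 2) * (pi / 1 + (pi - 0) * 1) + (2 / q) * (pi / D))"
    using pw by (intro has_integral_le[OF integrable_integral[OF integrable_continuous_real[OF hcont]] ub])
  also have "\<dots> = pi * (q / 2 + 1 / (q * D))" using q by (simp add: field_simps)
  also have "\<dots> \<le> pi * q"
  proof -
    have "2 \<le> D * q\<^sup>2" using Dq q by (simp add: divide_le_eq)
    moreover have "q * D > 0" using q A1 by (simp add: D_def)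
    ultimately have "2 / (q * D) \<le> q" by (simp add: divide_le_eq power2_eq_square mult_ac)
    then show ?thesis by simp
  qed
  finally have "integral {0..pi} (\<lambda>s. inverse (h s)) \<le> pi * q" .
  moreover have "inverse (norm (bump \<kappa> k (cis s * u))) = inverse (norm u) * inverse (h s)" for s
  proof -
    have "cis s * u = of_real (norm u) * (cis s * v)" by (subst uv) (simp only: mult_ac)
    then show ?thesis by (simp only: bump_scale norm_mult norm_of_real abs_norm_cancel h_def inverse_mult_distrib)
  qed
  ultimately show ?thesis
    using mult_left_mono[of "integral {0..pi} (\<lambda>s. inverse (h s))" "pi * q" "inverse (norm u)"]
    by (simp add: q_def mult_ac)
qed

text \<open>A one-sided Riemann-Lebesgue lemma. On an interval of length \<open>pi / l\<close> the
  first argument of \<open>g\<close> is almost constant while the phase runs through a full interval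
  of length \<open>pi\<close>, so \<open>avg\<close> applies with the first argument frozen.\<close>

lemma oscillating_integral_le:
  fixes g :: "real \<Rightarrow> complex \<Rightarrow> real"
  assumes ab: "a < b"
    and g: "continuous_on ({a..b} \<times> sphere 0 1) (\<lambda>(k, c). g k c)"
    and w: "continuous_on {a..b} w" "\<And>k. k \<in> {a..b} \<Longrightarrow> w k \<ge> 0"
    and avg: "\<And>k c. k \<in> {a..b} \<Longrightarrow> norm c = 1 \<Longrightarrow> integral {0..pi} (\<lambda>s. g k (cis s * c)) \<le> pi * w k"
    and e: "e > 0"
  shows "\<exists>l0. \<forall>l\<ge>l0. integral {a..b} (\<lambda>k. g k (cis (k * real l))) \<le> integral {a..b} w + e"
proof -
  \<comment> \<open>Freezing \<open>k\<close> in \<open>g\<close> and in \<open>w\<close> costs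
    \<open>\<epsilon>\<close> each, in total \<open>2 * \<epsilon> * (b - a) = e / 2\<close>. The
    other half of \<open>e\<close> pays for the incomplete last interval.\<close>
  define \<epsilon> where "\<epsilon> = e / (4 * (b - a))"
  have \<epsilon>: "\<epsilon> > 0" using ab e by (simp add: \<epsilon>_def)
  have cpt: "compact ({a..b} \<times> sphere (0::complex) 1)" by (intro compact_Times) auto
  obtain \<delta>1 where \<delta>1: "\<delta>1 > 0" "\<And>k k' c. k \<in> {a..b} \<Longrightarrow> k' \<in> {a..b} \<Longrightarrow> norm c = 1 \<Longrightarrow> \<bar>k' - k\<bar> < \<delta>1 \<Longrightarrow> \<bar>g k' c - g k c\<bar> < \<epsilon>"
  proof -
    obtain d where d: "d > 0" "\<And>x x'. x \<in> {a..b} \<times> sphere (0::complex) 1 \<Longrightarrow> x' \<in> {a..b} \<times> sphere 0 1 \<Longrightarrow> dist x' x < d \<Longrightarrow> dist (case x' of (k, c) \<Rightarrow> g k c) (case x of (k, c) \<Rightarrow> g k c) < \<epsilon>"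
      using compact_uniformly_continuous[OF g cpt] \<epsilon> unfolding uniformly_continuous_on_def by meson
    show ?thesis
    proof (rule that[OF d(1)])
      fix k k' :: real and c :: complex
      assume "k \<in> {a..b}" "k' \<in> {a..b}" "norm c = 1" "\<bar>k' - k\<bar> < d"
      then show "\<bar>g k' c - g k c\<bar> < \<epsilon>"
        using d(2)[of "(k, c)" "(k', c)"] by (auto simp: dist_Pair_Pair dist_real_def)
    qed
  qed
  obtain \<delta>2 where \<delta>2: "\<delta>2 > 0" "\<And>k k'. k \<in> {a..b} \<Longrightarrow> k' \<in> {a..b} \<Longrightarrow> \<bar>k' - k\<bar> < \<delta>2 \<Longrightarrow> \<bar>w k' - w k\<bar> < \<epsilon>"
    using compact_uniformly_continuous[OF w(1)] \<epsilon> unfolding uniformly_continuous_on_def dist_real_def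
    by (metis compact_Icc)
  obtain M where M: "M > 0" "\<And>k c. k \<in> {a..b} \<Longrightarrow> norm c = 1 \<Longrightarrow> \<bar>g k c\<bar> \<le> M"
  proof -
    have "bounded ((\<lambda>(k, c). g k c) ` ({a..b} \<times> sphere 0 1))"
      by (intro compact_imp_bounded compact_continuous_image g cpt)
    then obtain M where "M > 0" "\<forall>x\<in>(\<lambda>(k, c). g k c) ` ({a..b} \<times> sphere 0 1). norm x \<le> M"
      using bounded_pos by blast
    then show ?thesis using that[of M] by force
  qed
  obtain l0 :: nat where l0: "real l0 > pi / \<delta>1 + pi / \<delta>2 + 2 * M * pi / e" using reals_Archimedean2 by blast
  have sum_pos: "pi / \<delta>1 > 0" "pi / \<delta>2 > 0" "2 * M * pi / e > 0" using \<delta>1 \<delta>2 M e by simp_all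
  have "integral {a..b} (\<lambda>k. g k (cis (k * real l))) \<le> integral {a..b} w + e" if l: "l \<ge> l0" for l
  proof -
    have lr: "real l > pi / \<delta>1" "real l > pi / \<delta>2" "real l > 2 * M * pi / e" "real l > 0"
      using l l0 sum_pos by linarith+
    define h where "h = pi / real l"
    have h: "h > 0" "h < \<delta>1" "h < \<delta>2" "M * h \<le> e / 2"
      using lr \<delta>1 \<delta>2 M e by (auto simp: h_def field_simps)
    \<comment> \<open>With the freezing error already subtracted, the integral of \<open>f\<close>
      over each full interval is at most 0.\<close>
    define f where "f k = g k (cis (k * real l)) - (w k + 2 * \<epsilon>)" for k
    have gc: "continuous_on {a..b} (\<lambda>k. g k (cis (k * real l)))"
    proof -
      have "continuous_on {a..b} ((\<lambda>(k, c). g k c) \<circ> (\<lambda>k. (k, cis (k * real l))))"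
        by (intro continuous_on_compose continuous_on_subset[OF g] continuous_intros) auto
      then show ?thesis by (simp add: o_def)
    qed
    have gc1: "continuous_on S (\<lambda>s. g k (cis (p s) * c))" if "k \<in> {a..b}" "norm c = 1" "continuous_on S p" for k c S p
    proof -
      have "continuous_on S ((\<lambda>(k, c). g k c) \<circ> (\<lambda>s. (k, cis (p s) * c)))"
        using that by (intro continuous_on_compose continuous_on_subset[OF g] continuous_intros) (auto simp: norm_mult)
      then show ?thesis by (simp add: o_def)
    qed
    have fc: "continuous_on {a..b} f" unfolding f_def by (intro continuous_intros gc w)
    have fint: "f integrable_on {x..y}" if "a \<le> x" "y \<le> b" for x y
      using that by (intro integrable_continuous_real continuous_on_subset[OF fc]) auto
    have piece: "integral {c..c + h} f \<le> 0" if c: "a \<le> c" "c + h \<le> b" for c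
    proof -
      have cin: "c \<in> {a..b}" using c h by auto
      define G where "G k = g c (cis (k * real l))" for k
      have "((\<lambda>s. g c (cis s * cis (c * real l))) has_integral integral {0..pi} (\<lambda>s. g c (cis s * cis (c * real l)))) (cbox 0 pi)"
        unfolding cbox_interval
        by (intro integrable_integral integrable_continuous_real gc1 cin continuous_intros) simp
      from has_integral_affinity[OF this, of "real l" "- (c * real l)"] lr
      have "((\<lambda>x. g c (cis (real l * x - c * real l) * cis (c * real l))) has_integral
          integral {0..pi} (\<lambda>s. g c (cis s * cis (c * real l))) / real l) ((\<lambda>x. x / real l + c) ` {0..pi})"
        by (simp add: cbox_interval divide_inverse mult_ac)
      moreover have "(\<lambda>x. x / real l + c) ` {0..pi} = {c..c + h}"
        using image_affinity_atLeastAtMost_div[of "real l" c 0 pi] lr by (simp add: h_def add.commute)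
      moreover have "g c (cis (real l * x - c * real l) * cis (c * real l)) = G x" for x
        by (simp add: cis_mult G_def mult.commute)
      ultimately have "(G has_integral integral {0..pi} (\<lambda>s. g c (cis s * cis (c * real l))) / real l) {c..c + h}"
        by simp
      then have Gi: "integral {c..c + h} G \<le> h * w c" and Gint: "G integrable_on {c..c + h}"
        using avg[OF cin, of "cis (c * real l)"] lr
        by (auto simp: integral_unique h_def field_simps intro!: has_integral_integrable)
      have "integral {c..c + h} f \<le> integral {c..c + h} (\<lambda>k. G k - w c)"
      proof (rule integral_le[OF fint])
        show "(\<lambda>k. G k - w c) integrable_on {c..c + h}" by (intro integrable_diff Gint) auto
        fix k assume k: "k \<in> {c..c + h}"
        have "\<bar>g k (cis (k * real l)) - g c (cis (k * real l))\<bar> < \<epsilon>" "\<bar>w k - w c\<bar> < \<epsilon>"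
          using k c h cin by (auto intro!: \<delta>1(2) \<delta>2(2))
        then show "f k \<le> G k - w c" by (auto simp: f_def G_def)
      qed (use c in auto)
      also have "\<dots> = integral {c..c + h} G - h * w c"
        using Gint h by (subst integral_diff) auto
      finally show ?thesis using Gi by simp
    qed
    have steps: "integral {a..a + real j * h} f \<le> 0" if "a + real j * h \<le> b" for j
      using that
    proof (induction j)
      case (Suc j)
      have le: "a + real j * h + h \<le> b" using Suc.prems by (simp add: algebra_simps)
      have "integral {a..a + real j * h} f + integral {a + real j * h..a + real j * h + h} f = integral {a..a + real j * h + h} f"
        using h le by (intro Henstock_Kurzweil_Integration.integral_combine fint) auto
      moreover have "integral {a + real j * h..a + real j * h + h} f \<le> 0" using le h by (intro piece) auto
      ultimately show ?case using Suc.IH le h by (simp add: algebra_simps)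
    qed simp
    define n where "n = nat \<lfloor>(b - a) / h\<rfloor>"
    have "(b - a) / h \<ge> 0" using ab h by simp
    then have "real n \<le> (b - a) / h" "(b - a) / h < real n + 1" unfolding n_def by linarith+
    then have n: "a + real n * h \<le> b" "b < a + real n * h + h" using h by (auto simp: field_simps)
    \<comment> \<open>The remainder is shorter than \<open>h\<close>, and the crude bound
      \<open>M\<close> suffices there.\<close>
    have "integral {a + real n * h..b} f \<le> integral {a + real n * h..b} (\<lambda>k. M)"
    proof (rule integral_le[OF fint])
      fix k assume "k \<in> {a + real n * h..b}"
      then have k: "k \<in> {a..b}" using h by (auto intro: order_trans[rotated])
      then show "f k \<le> M" using M(2)[OF k, of "cis (k * real l)"] w(2)[OF k] \<epsilon> by (auto simp: f_def)
    qed (use h in auto)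
    also have "\<dots> = (b - (a + real n * h)) * M" using n by simp
    also have "\<dots> \<le> h * M" using n M by (intro mult_right_mono) auto
    also have "\<dots> \<le> e / 2" using h by (simp add: mult.commute)
    finally have last: "integral {a + real n * h..b} f \<le> e / 2" .
    have "integral {a..a + real n * h} f + integral {a + real n * h..b} f = integral {a..b} f"
      using h n by (intro Henstock_Kurzweil_Integration.integral_combine fint) auto
    then have "integral {a..b} f \<le> e / 2" using steps[OF n(1)] last by simp
    moreover have "integral {a..b} f = integral {a..b} (\<lambda>k. g k (cis (k * real l))) - (integral {a..b} w + (b - a) * (2 * \<epsilon>))"
    proof -
      have wi: "w integrable_on {a..b}" using w by (intro integrable_continuous_real)
      have "integral {a..b} (\<lambda>k. w k + 2 * \<epsilon>) = integral {a..b} w + integral {a..b} (\<lambda>k. 2 * \<epsilon>)"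
        by (intro Henstock_Kurzweil_Integration.integral_add wi) auto
      moreover have "integral {a..b} f = integral {a..b} (\<lambda>k. g k (cis (k * real l))) - integral {a..b} (\<lambda>k. w k + 2 * \<epsilon>)"
        unfolding f_def using gc wi
        by (intro Henstock_Kurzweil_Integration.integral_diff integrable_continuous_real integrable_add) (auto intro!: continuous_intros w(1))
      ultimately show ?thesis using ab by simp
    qed
    moreover have "(b - a) * (2 * \<epsilon>) = e / 2"
    proof -
      have "\<epsilon> * (4 * (b - a)) = e" using ab by (simp add: \<epsilon>_def)
      then show ?thesis by (simp add: algebra_simps)
    qed
    ultimately show ?thesis by simp
  qed
  then show ?thesis by blast
qed


lemma bump_integral_contraction:
  assumes \<kappa>: "\<kappa> > 1" and ab: "0 < a" "a < b" "b < pi"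
    and v: "continuous_on {a..b} v" "\<And>k. k \<in> {a..b} \<Longrightarrow> v k \<noteq> 0"
    and q: "bump_rate \<kappa> < q"
  shows "\<exists>l0. \<forall>l\<ge>l0. integral {a..b} (\<lambda>k. inverse (norm (bump \<kappa> k (cis (k * real l) * v k))))
    \<le> q * integral {a..b} (\<lambda>k. inverse (norm (v k)))"
proof -
  have sin: "sin k \<noteq> 0" if "k \<in> {a..b}" for k using sin_gt_zero[of k] that ab by auto
  have vc: "continuous_on {a..b} (\<lambda>k. inverse (norm (v k)))"
    using v by (intro continuous_intros) auto
  define Iv where "Iv = integral {a..b} (\<lambda>k. inverse (norm (v k)))"
  have "Iv > 0"
  proof -
    have "Iv \<ge> 0" unfolding Iv_def by (intro integral_nonneg integrable_continuous_real vc) auto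
    moreover have "Iv \<noteq> 0"
    proof
      assume "Iv = 0"
      then have "\<forall>k\<in>{a..b}. inverse (norm (v k)) = 0"
        unfolding Iv_def by (subst (asm) integral_eq_0_iff[OF vc ab(2)]) auto
      then show False using v(2)[of a] ab by auto
    qed
    ultimately show ?thesis by simp
  qed
  \<comment> \<open>The averaging error has to fit into the room between the rate and
    \<open>q\<close>, relative to \<open>Iv\<close>; hence \<open>Iv\<close> had to be
    positive.\<close>
  then have e: "(q - bump_rate \<kappa>) * Iv > 0" using q by simp
  have "\<exists>l0. \<forall>l\<ge>l0. integral {a..b} (\<lambda>k. inverse (norm (bump \<kappa> k (cis (k * real l) * v k))))
      \<le> integral {a..b} (\<lambda>k. bump_rate \<kappa> * inverse (norm (v k))) + (q - bump_rate \<kappa>) * Iv"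
  proof (rule oscillating_integral_le[OF ab(2) _ _ _ _ e, where g = "\<lambda>k c. inverse (norm (bump \<kappa> k (c * v k)))"])
    have *: "sin (fst x) \<noteq> 0" "bump \<kappa> (fst x) (snd x * v (fst x)) \<noteq> 0"
      if "x \<in> {a..b} \<times> sphere (0::complex) 1" for x
    proof -
      have "fst x \<in> {a..b}" "snd x \<noteq> 0" using that by auto
      then show "sin (fst x) \<noteq> 0" "bump \<kappa> (fst x) (snd x * v (fst x)) \<noteq> 0"
        using bump_nonzero[of \<kappa> "fst x" "snd x * v (fst x)"] sin v(2) \<kappa> by auto
    qed
    have "continuous_on ({a..b} \<times> sphere 0 1) (\<lambda>x. bump \<kappa> (fst x) (snd x * v (fst x)))"
      using * \<kappa> by (intro continuous_intros continuous_on_compose2[OF v(1)]) auto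
    then have "continuous_on ({a..b} \<times> sphere 0 1) (\<lambda>x. inverse (norm (bump \<kappa> (fst x) (snd x * v (fst x)))))"
      using * by (intro continuous_on_inverse continuous_on_norm) auto
    then show "continuous_on ({a..b} \<times> sphere 0 1) (\<lambda>(k, c). inverse (norm (bump \<kappa> k (c * v k))))"
      by (simp add: case_prod_unfold)
    show "continuous_on {a..b} (\<lambda>k. bump_rate \<kappa> * inverse (norm (v k)))"
      by (intro continuous_intros vc)
    show "bump_rate \<kappa> * inverse (norm (v k)) \<ge> 0" for k
      using bump_rate[OF \<kappa>] by simp
    fix k and c :: complex assume k: "k \<in> {a..b}" and c: "norm c = 1"
    have "c * v k \<noteq> 0" using v(2)[OF k] c by auto
    from integral_inverse_norm_bump_le[OF \<kappa> sin[OF k] this]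
    show "integral {0..pi} (\<lambda>s. inverse (norm (bump \<kappa> k (cis s * c * v k)))) \<le> pi * (bump_rate \<kappa> * inverse (norm (v k)))"
      by (simp add: norm_mult c mult.assoc)
  qed
  then show ?thesis by (simp add: Iv_def left_diff_distrib)
qed

text \<open>The value of \<open>osc\<close> on arrival at a branching level: \<open>d\<close> is the
  distance to the first one and \<open>gs\<close> lists the gaps passed since. The phase starts with
  \<open>d + 1\<close> because \<open>osc\<close> is \<open>cis k\<close> at level 0. A gap
  \<open>g\<close> contributes \<open>g - 1\<close> rotations, its first step being the bump. Since
  only \<open>d\<close> and \<open>gs\<close> enter, thresholds can be chosen without knowing the
  tree.\<close>

definition amp :: "real \<Rightarrow> real \<Rightarrow> nat \<Rightarrow> nat list \<Rightarrow> complex" where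
  "amp \<kappa> k d gs = foldl (\<lambda>u g. cis (k * (real g - 1)) * bump \<kappa> k u) (cis (k * real (d + 1))) gs"

lemma amp_snoc: "amp \<kappa> k d (gs @ [g]) = cis (k * (real g - 1)) * bump \<kappa> k (amp \<kappa> k d gs)"
  by (simp add: amp_def)

lemma amp_nonzero:
  assumes "\<kappa> > 0" "sin k \<noteq> 0"
  shows "amp \<kappa> k d gs \<noteq> 0"
proof (induction gs rule: rev_induct)
  case (snoc g gs)
  then show ?case using bump_nonzero[OF assms] by (simp add: amp_snoc)
qed (simp add: amp_def)

lemma continuous_on_amp:
  assumes "\<kappa> > 0" "\<And>k. k \<in> S \<Longrightarrow> sin k \<noteq> 0"
  shows "continuous_on S (\<lambda>k. amp \<kappa> k d gs)"
proof (induction gs rule: rev_induct)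
  case Nil
  show ?case unfolding amp_def by (simp, intro continuous_intros)
next
  case (snoc g gs)
  then show ?case unfolding amp_snoc using assms by (intro continuous_intros) auto
qed

text \<open>Measured after one more bump, so that appending a gap inserts a fast phase between two
  bumps, the form needed in \<open>bump_integral_contraction\<close>. The window avoids the zeros of
  \<open>sin\<close>.\<close>

definition decay_integral :: "real \<Rightarrow> real \<Rightarrow> nat \<Rightarrow> nat list \<Rightarrow> real" where
  "decay_integral \<kappa> c d gs = integral {c..pi - c} (\<lambda>k. inverse (norm (bump \<kappa> k (amp \<kappa> k d gs))))"

lemma decay_integral_contraction:
  assumes \<kappa>: "\<kappa> > 1" and c: "0 < c" "c < pi / 2" and q: "bump_rate \<kappa> < q"
  shows "\<exists>l0. \<forall>l\<ge>l0. decay_integral \<kappa> c d (gs @ [l]) \<le> q * decay_integral \<kappa> c d gs"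
proof -
  have sin: "sin k \<noteq> 0" if "k \<in> {c..pi - c}" for k using sin_gt_zero[of k] that c by auto
  have "\<exists>l0. \<forall>l\<ge>l0. integral {c..pi - c} (\<lambda>k. inverse (norm (bump \<kappa> k (cis (k * real l) * bump \<kappa> k (amp \<kappa> k d gs)))))
      \<le> q * integral {c..pi - c} (\<lambda>k. inverse (norm (bump \<kappa> k (amp \<kappa> k d gs))))"
  proof (rule bump_integral_contraction[OF \<kappa> c(1) _ _ _ _ q])
    show "continuous_on {c..pi - c} (\<lambda>k. bump \<kappa> k (amp \<kappa> k d gs))"
      using \<kappa> sin by (intro continuous_intros continuous_on_amp) auto
    show "bump \<kappa> k (amp \<kappa> k d gs) \<noteq> 0" if "k \<in> {c..pi - c}" for k
      using \<kappa> sin[OF that] by (intro bump_nonzero amp_nonzero) auto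
  qed (use c in auto)
  then obtain l0 where l0: "\<And>l. l \<ge> l0 \<Longrightarrow> integral {c..pi - c} (\<lambda>k. inverse (norm (bump \<kappa> k (cis (k * real l) * bump \<kappa> k (amp \<kappa> k d gs)))))
      \<le> q * decay_integral \<kappa> c d gs"
    unfolding decay_integral_def by blast
  \<comment> \<open>The shift by 1 accounts for the \<open>l - 1\<close> free rotations in a gap
    \<open>l\<close>.\<close>
  have "decay_integral \<kappa> c d (gs @ [l]) \<le> q * decay_integral \<kappa> c d gs" if "l \<ge> l0 + 1" for l
  proof -
    have "real (l - 1) = real l - 1" "l - 1 \<ge> l0" using that by auto
    then show ?thesis using l0[of "l - 1"] by (simp add: decay_integral_def amp_snoc)
  qed
  then show ?thesis by blast
qed

text \<open>The modulus of this combination of consecutive values of a solution is unchanged by free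
  steps.\<close>

definition osc :: "(nat \<Rightarrow> nat) \<Rightarrow> real \<Rightarrow> nat \<Rightarrow> complex" where
  "osc \<kappa> k j = (of_real (sol \<kappa> (2 * cos k) (Suc j)) - cis (- k) * of_real (sol \<kappa> (2 * cos k) j)) / of_real (sqrt (wt \<kappa> j))"

lemma osc_0: "osc \<kappa> k 0 = cis k"
  by (simp add: osc_def wt_def complex_eq_iff)

lemma wt_Suc: "wt \<kappa> (Suc j) = wt \<kappa> j * \<kappa> j"
  by (simp add: wt_def)

lemma osc_Suc:
  assumes "sin k \<noteq> 0"
  shows "osc \<kappa> k (Suc j) = bump (\<kappa> j) k (osc \<kappa> k j)"
proof -
  define x y W where "x = sol \<kappa> (2 * cos k) j" and "y = sol \<kappa> (2 * cos k) (Suc j)" and "W = sqrt (wt \<kappa> j)"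
  have W: "osc \<kappa> k j = (of_real y - cis (- k) * of_real x) / of_real W" by (simp add: osc_def x_def y_def W_def)
  have Im: "Im (osc \<kappa> k j) / sin k = x / W" unfolding W using assms by (simp add: Im_divide_of_real)
  have "bump (\<kappa> j) k (osc \<kappa> k j) = (cis k * osc \<kappa> k j - of_real ((real (\<kappa> j) - 1) * (Im (osc \<kappa> k j) / sin k))) / of_real (sqrt (\<kappa> j))"
    by (simp add: bump_def)
  also have "\<dots> = (cis k * of_real y - cis k * cis (- k) * of_real x - (of_real (real (\<kappa> j)) - 1) * of_real x) / (of_real W * of_real (sqrt (\<kappa> j)))"
    unfolding Im unfolding W by (simp add: divide_simps) (simp add: algebra_simps)
  also have "cis k * of_real y - cis k * cis (- k) * of_real x - (of_real (real (\<kappa> j)) - 1) * of_real x = cis k * of_real y - of_real (real (\<kappa> j)) * of_real x"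
    by (simp add: cis_mult algebra_simps)
  also have "\<dots> = of_real (2 * cos k * y - real (\<kappa> j) * x) - cis (- k) * of_real y"
    by (simp add: complex_eq_iff)
  also have "\<dots> / (of_real W * of_real (sqrt (\<kappa> j))) = osc \<kappa> k (Suc j)"
    by (simp add: osc_def wt_Suc real_sqrt_mult x_def y_def W_def)
  finally show ?thesis ..
qed

lemma osc_free:
  assumes "sin k \<noteq> 0" "\<And>i. i < n \<Longrightarrow> \<kappa> (j + i) = 1"
  shows "osc \<kappa> k (j + n) = cis (k * real n) * osc \<kappa> k j"
  using assms(2)
proof (induction n)
  case (Suc n)
  have "osc \<kappa> k (j + Suc n) = cis k * osc \<kappa> k (j + n)"
    using osc_Suc[OF assms(1), of \<kappa> "j + n"] Suc.prems[of n] by (simp add: bump_def)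
  then show ?case using Suc by (simp add: cis_mult algebra_simps)
qed simp

text \<open>Between consecutive branching levels there is one bump followed by
  \<open>g r - 1\<close> free steps; strict monotonicity of \<open>p\<close> ensures that no other
  branching level intervenes.\<close>

lemma osc_eq_amp:
  assumes sin: "sin k \<noteq> 0" and p0: "p 0 = d" and pS: "\<And>r. p (Suc r) = p r + g r" and g: "\<And>r. g r \<ge> 1"
    and bumps: "\<And>r. \<kappa> (p r) = \<kappa>0" and free: "\<And>j. j \<notin> range p \<Longrightarrow> \<kappa> j = 1"
  shows "osc \<kappa> k (p r) = amp \<kappa>0 k d (map g [0..<r])"
proof (induction r)
  have mono: "strict_mono p" by (rule strict_monoI_Suc) (use pS g in \<open>simp add: Suc_le_lessD\<close>)
  {
    case 0
    have "\<kappa> (0 + i) = 1" if "i < d" for i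
    proof (rule free)
      show "0 + i \<notin> range p"
      proof
        assume "0 + i \<in> range p"
        then obtain r' where "i = p r'" by auto
        moreover have "p 0 \<le> p r'" using mono by (simp add: strict_mono_less_eq)
        ultimately show False using that p0 by simp
      qed
    qed
    from osc_free[where \<kappa> = \<kappa> and j = 0 and n = d, OF sin this] show ?case
      by (simp add: p0 amp_def osc_0 cis_mult algebra_simps)
  next
    case (Suc r)
    have "\<kappa> (Suc (p r) + i) = 1" if "i < g r - 1" for i
    proof (rule free)
      show "Suc (p r) + i \<notin> range p"
      proof
        assume "Suc (p r) + i \<in> range p"
        then obtain r' where r': "Suc (p r) + i = p r'" by auto
        then have "p r < p r'" "p r' < p (Suc r)" using that pS[of r] by auto
        then show False using mono by (simp add: strict_mono_less)
      qed
    qed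
    from osc_free[where \<kappa> = \<kappa> and j = "Suc (p r)" and n = "g r - 1", OF sin this] have "osc \<kappa> k (p (Suc r)) = cis (k * real (g r - 1)) * osc \<kappa> k (Suc (p r))"
      using g[of r] by (simp add: pS)
    then show ?case using Suc osc_Suc[OF sin, of \<kappa> "p r"] g[of r] bumps
      by (simp add: amp_snoc of_nat_diff)
  }
qed

text \<open>The factor \<open>sqrt (\<kappa> j)\<close> compensates for \<open>nsol\<close> at
  \<open>Suc j\<close> being normalised with \<open>wt \<kappa> (Suc j)\<close>.\<close>

lemma norm_osc_le:
  assumes "\<kappa> j \<ge> 1" "\<And>i. \<kappa> i \<ge> 1"
  shows "norm (osc \<kappa> k j) \<le> sqrt (\<kappa> j) * (\<bar>nsol \<kappa> (2 * cos k) j\<bar> + \<bar>nsol \<kappa> (2 * cos k) (Suc j)\<bar>)"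
proof -
  let ?x = "sol \<kappa> (2 * cos k)"
  have w: "wt \<kappa> j > 0" using assms(2) by (auto simp: wt_def intro!: prod_pos simp: Suc_le_eq)
  have kj: "real (\<kappa> j) \<ge> 1" using assms by simp
  have "norm (osc \<kappa> k j) \<le> (\<bar>?x (Suc j)\<bar> + \<bar>?x j\<bar>) / sqrt (wt \<kappa> j)"
    unfolding osc_def norm_divide using w
    by (auto intro!: divide_right_mono order_trans[OF norm_triangle_ineq4] simp: norm_mult)
  also have "\<dots> = sqrt (\<kappa> j) * \<bar>nsol \<kappa> (2 * cos k) (Suc j)\<bar> + \<bar>nsol \<kappa> (2 * cos k) j\<bar>"
    using w kj by (simp add: nsol_def wt_Suc real_sqrt_mult add_divide_distrib abs_mult)
  also have "\<dots> \<le> sqrt (\<kappa> j) * \<bar>nsol \<kappa> (2 * cos k) (Suc j)\<bar> + sqrt (\<kappa> j) * \<bar>nsol \<kappa> (2 * cos k) j\<bar>"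
    using kj by (intro add_mono order_refl) (simp add: mult_right_mono mult_le_cancel_right1)
  finally show ?thesis by (simp add: algebra_simps)
qed

text \<open>Geometric decay makes the sum of the integrals finite, so the series of the functions
  converges almost everywhere and its terms tend to 0.\<close>

lemma negligible_not_tendsto_0:
  fixes f :: "nat \<Rightarrow> real \<Rightarrow> real"
  assumes cont: "\<And>n. continuous_on {a..b} (f n)" and nonneg: "\<And>n k. k \<in> {a..b} \<Longrightarrow> f n k \<ge> 0"
    and q: "0 < q" "q < 1" and decay: "\<And>n. n \<ge> n0 \<Longrightarrow> integral {a..b} (f (Suc n)) \<le> q * integral {a..b} (f n)"
  shows "negligible {k \<in> {a..b}. \<not> (\<lambda>n. f n k) \<longlonglongrightarrow> 0}"
proof -
  define F where "F n k = indicator {a..b} k * f n k" for n k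
  have Fint: "integrable lborel (F n)" for n
    using borel_integrable_compact[OF _ cont[of n]] by (simp add: F_def[abs_def] mult.commute scaleR_conv_of_real)
  have Fnn: "F n k \<ge> 0" for n k using nonneg by (auto simp: F_def indicator_def)
  have FI: "(\<integral>\<^sup>+ k. ennreal (F n k) \<partial>lborel) = ennreal (integral {a..b} (f n))" for n
  proof -
    have "set_integrable lborel {a..b} (f n)"
      using Fint[of n] by (simp add: set_integrable_def F_def[abs_def])
    then have "(\<integral>k. F n k \<partial>lborel) = integral {a..b} (f n)"
      using set_borel_integral_eq_integral(2)[of "{a..b}" "f n"]
      by (simp add: F_def[abs_def] set_lebesgue_integral_def)
    then show ?thesis using nn_integral_eq_integral[OF Fint[of n]] Fnn by simp
  qed
  define J where "J n = integral {a..b} (f n)" for n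
  have J0: "J n \<ge> 0" for n
    unfolding J_def using nonneg by (intro integral_nonneg integrable_continuous_real cont) auto
  have Jle: "J (n0 + n) \<le> J n0 * q ^ n" for n
  proof (induction n)
    case (Suc n)
    have "J (n0 + Suc n) \<le> q * J (n0 + n)" using decay[of "n0 + n"] by (simp add: J_def)
    also have "\<dots> \<le> q * (J n0 * q ^ n)" using Suc q by (intro mult_left_mono) auto
    finally show ?case by (simp add: mult_ac)
  qed simp
  have sJ: "summable (\<lambda>n. J (n0 + n))"
    by (rule summable_comparison_test'[of "\<lambda>n. J n0 * q ^ n" 0])
      (use Jle J0 q in \<open>auto intro!: summable_mult summable_geometric\<close>)
  have "(\<integral>\<^sup>+ k. (\<Sum>n. ennreal (F (n0 + n) k)) \<partial>lborel) = (\<Sum>n. \<integral>\<^sup>+ k. ennreal (F (n0 + n) k) \<partial>lborel)"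
    by (rule nn_integral_suminf) (use Fint in auto)
  also have "\<dots> = (\<Sum>n. ennreal (J (n0 + n)))" by (simp only: FI J_def)
  also have "\<dots> \<noteq> \<infinity>" using ennreal_suminf_neq_top[OF sJ J0] unfolding infinity_ennreal_def .
  finally have "AE k in lborel. (\<Sum>n. ennreal (F (n0 + n) k)) \<noteq> \<infinity>"
    by (intro nn_integral_PInf_AE) (use Fint in auto)
  then have "AE k in lborel. (\<lambda>n. F n k) \<longlonglongrightarrow> 0"
  proof eventually_elim
    case (elim k)
    then have "summable (\<lambda>n. F (n0 + n) k)"
      unfolding infinity_ennreal_def by (rule summable_suminf_not_top[OF Fnn])
    then have "(\<lambda>n. F (n + n0) k) \<longlonglongrightarrow> 0"
      unfolding add.commute[of n0] by (rule summable_LIMSEQ_zero)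
    then show ?case by (rule LIMSEQ_offset)
  qed
  then have "AE k in lebesgue. (\<lambda>n. F n k) \<longlonglongrightarrow> 0" by (rule AE_completion)
  then obtain N where N: "{k. \<not> (\<lambda>n. F n k) \<longlonglongrightarrow> 0} \<subseteq> N" "N \<in> null_sets lebesgue"
    by (auto elim!: AE_E simp: null_sets_def)
  have "{k \<in> {a..b}. \<not> (\<lambda>n. f n k) \<longlonglongrightarrow> 0} \<subseteq> N"
    using N(1) by (auto simp: F_def)
  then show ?thesis using N(2) negligible_iff_null_sets negligible_subset by blast
qed

section \<open>Growth along a sparse sequence of branching levels\<close>

locale bump_levels =
  fixes k0 :: nat and L :: "nat \<Rightarrow> nat" and \<kappa> :: "nat \<Rightarrow> nat"
  assumes k0: "k0 \<ge> 2" and L: "strict_mono_on {1..} L"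
    and kappa_L: "\<And>n. n \<ge> 1 \<Longrightarrow> \<kappa> (L n) = k0" and kappa_free: "\<And>j. j \<notin> L ` {1..} \<Longrightarrow> \<kappa> j = 1"
begin

definition gap :: "nat \<Rightarrow> nat" where "gap n = L (n + 1) - L n"

text \<open>Levels at which a cyclic subspace starts: the root, and the children of the \<open>i\<close>-th
  branching level.\<close>

definition start :: "nat \<Rightarrow> nat" where "start i = (if i = 0 then 0 else L i + 1)"

definition tail :: "nat \<Rightarrow> nat \<Rightarrow> nat" where "tail i j = \<kappa> (start i + j)"

text \<open>Branching levels as seen from \<open>start i\<close>. For positive \<open>i\<close>,
  \<open>pos i 0\<close> is \<open>gap i - 1\<close>; but \<open>pos 0 0\<close> is
  \<open>L 1\<close>, which the gaps do not determine.\<close>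

definition pos :: "nat \<Rightarrow> nat \<Rightarrow> nat" where "pos i r = L (i + 1 + r) - start i"

definition gaps :: "nat \<Rightarrow> nat \<Rightarrow> nat list" where "gaps i r = map (\<lambda>s. gap (i + 1 + s)) [0..<r]"

lemma L_less: "1 \<le> a \<Longrightarrow> a < b \<Longrightarrow> L a < L b"
  using L by (auto simp: strict_mono_on_def)

lemma L_less_iff: "1 \<le> a \<Longrightarrow> 1 \<le> b \<Longrightarrow> L a < L b \<longleftrightarrow> a < b"
  using L_less[of a b] L_less[of b a] by (metis less_asym nat_neq_iff)

lemma gap_pos: "n \<ge> 1 \<Longrightarrow> gap n \<ge> 1"
  using L_less[of n "n + 1"] by (simp add: gap_def)

lemma start_le: "start i \<le> L (i + 1 + r)"
  using L_less[of i "i + 1 + r"] by (auto simp: start_def)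

lemma pos_add: "start i + pos i r = L (i + 1 + r)"
  using start_le[of i r] by (simp add: pos_def)

lemma pos_Suc: "pos i (Suc r) = pos i r + gap (i + 1 + r)"
  using start_le[of i r] L_less[of "i + 1 + r" "i + 1 + r + 1"] by (simp add: pos_def gap_def)

lemma tail_pos: "tail i (pos i r) = k0"
  unfolding tail_def pos_add by (rule kappa_L) simp

lemma tail_free:
  assumes "j \<notin> range (pos i)"
  shows "tail i j = 1"
  unfolding tail_def
proof (rule kappa_free, rule notI)
  assume "start i + j \<in> L ` {1..}"
  then obtain n where n: "n \<ge> 1" "start i + j = L n" by auto
  have "n \<ge> i + 1"
  proof (cases "i = 0")
    case False
    then have "L i < L n" using n by (simp add: start_def)
    then show ?thesis using L_less_iff[of i n] False n by simp
  qed (use n in simp)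
  then obtain r where "n = i + 1 + r" using le_Suc_ex by blast
  then have "j = pos i r" using n by (simp add: pos_def)
  with assms show False by blast
qed

lemma tail_ge: "tail i j \<ge> 1"
  using tail_pos[of i] tail_free[of j i] k0 by (cases "j \<in> range (pos i)") auto

lemma osc_tail:
  assumes "sin k \<noteq> 0"
  shows "osc (tail i) k (pos i r) = amp k0 k (pos i 0) (gaps i r)"
  unfolding gaps_def
  by (rule osc_eq_amp[where p = "pos i", OF assms]) (use pos_Suc gap_pos tail_pos tail_free in auto)

lemma norm_amp_gaps_ge:
  assumes "sin k \<noteq> 0"
  shows "(norm (amp k0 k (pos i 0) (gaps i r)))\<^sup>2 \<ge> (1 / (2 * bump_mean k0 k)) ^ r"
proof (induction r)
  case (Suc r)
  have k0': "real k0 > 0" using k0 by simp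
  have A: "bump_mean k0 k > 0" using k0' by (simp add: bump_mean_def add_pos_nonneg)
  have "(1 / (2 * bump_mean k0 k)) ^ Suc r = (1 / (2 * bump_mean k0 k)) ^ r / (2 * bump_mean k0 k)" by simp
  also have "\<dots> \<le> (norm (amp k0 k (pos i 0) (gaps i r)))\<^sup>2 / (2 * bump_mean k0 k)"
    using Suc A by (intro divide_right_mono) auto
  also have "\<dots> \<le> (norm (bump k0 k (amp k0 k (pos i 0) (gaps i r))))\<^sup>2"
    by (rule norm_bump_ge[OF k0' assms])
  finally show ?case by (simp add: gaps_def amp_snoc norm_mult)
qed (simp add: gaps_def amp_def)

text \<open>Along the free stretch the amplitude is constant and its square is at most twice the sum
  of two consecutive squares. Each index is used at most twice, which accounts for the 4.\<close>

lemma block_sum_ge: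
  assumes "sin k \<noteq> 0"
  shows "(\<Sum>j\<in>{pos i r..pos i (Suc r)}. (nsol (tail i) (2 * cos k) j)\<^sup>2) \<ge>
    (real (gap (i + 1 + r)) - 1) / 4 * (1 / (2 * bump_mean k0 k)) ^ Suc r"
proof -
  let ?n = "\<lambda>j. (nsol (tail i) (2 * cos k) j)\<^sup>2"
  define B where "B = {Suc (pos i r)..<pos i (Suc r)}"
  have smono: "strict_mono (pos i)"
    by (rule strict_monoI_Suc) (use pos_Suc gap_pos in \<open>simp add: Suc_le_lessD\<close>)
  have free: "tail i j = 1" if "j \<in> B" for j
  proof (rule tail_free, rule notI)
    assume "j \<in> range (pos i)"
    then obtain s where "j = pos i s" by auto
    then have "pos i r < pos i s" "pos i s < pos i (Suc r)" using that by (auto simp: B_def)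
    then show False using smono by (simp add: strict_mono_less)
  qed
  have osc_eq: "norm (osc (tail i) k j) = norm (amp k0 k (pos i 0) (gaps i (Suc r)))" if j: "j \<in> B" for j
  proof -
    have "tail i (j + s) = 1" if "s < pos i (Suc r) - j" for s
      using free[of "j + s"] j that by (auto simp: B_def)
    from osc_free[where \<kappa> = "tail i" and j = j and n = "pos i (Suc r) - j", OF assms this]
    show ?thesis using osc_tail[OF assms, of i "Suc r"] j by (simp add: B_def norm_mult)
  qed
  have le: "(1 / (2 * bump_mean k0 k)) ^ Suc r \<le> 2 * (?n j + ?n (Suc j))" if j: "j \<in> B" for j
  proof -
    let ?a = "\<bar>nsol (tail i) (2 * cos k) j\<bar>" and ?b = "\<bar>nsol (tail i) (2 * cos k) (Suc j)\<bar>"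
    have "norm (osc (tail i) k j) \<le> ?a + ?b"
      using norm_osc_le[of "tail i" j k] free[OF j] tail_ge by simp
    then have "(norm (osc (tail i) k j))\<^sup>2 \<le> (?a + ?b)\<^sup>2" by (intro power_mono) auto
    also have "\<dots> \<le> 2 * (?a\<^sup>2 + ?b\<^sup>2)"
      using sum_squares_bound[of ?a ?b] by (simp add: power2_sum)
    finally show ?thesis using norm_amp_gaps_ge[OF assms, of "Suc r" i] osc_eq[OF j] by simp
  qed
  have "real (card B) * (1 / (2 * bump_mean k0 k)) ^ Suc r \<le> (\<Sum>j\<in>B. 2 * (?n j + ?n (Suc j)))"
    using le by (intro sum_bounded_below) auto
  also have "\<dots> = 2 * ((\<Sum>j\<in>B. ?n j) + (\<Sum>j\<in>Suc ` B. ?n j))"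
    by (simp add: sum_distrib_left[symmetric] sum.distrib sum.reindex)
  also have "\<dots> \<le> 2 * ((\<Sum>j\<in>{pos i r..pos i (Suc r)}. ?n j) + (\<Sum>j\<in>{pos i r..pos i (Suc r)}. ?n j))"
    by (intro mult_left_mono add_mono sum_mono2) (auto simp: B_def)
  also have "real (card B) = real (gap (i + 1 + r)) - 1"
    using gap_pos[of "i + 1 + r"] by (simp add: B_def pos_Suc of_nat_diff)
  finally show ?thesis by simp
qed

text \<open>A single late block suffices. The amplitude loses at most a factor \<open>2 * A\<close>
  per bump, where \<open>A\<close> depends on \<open>k\<close>; once \<open>n\<close> is at least
  \<open>4 * A\<close>, the gap \<open>n ^ n\<close> wins by a factor 2 per bump, whatever
  \<open>k\<close> is.\<close>

lemma nsol_sum_unbounded: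
  assumes gap: "\<And>n. n \<ge> 1 \<Longrightarrow> gap n \<ge> n ^ n + 1" and sin: "sin k \<noteq> 0"
  shows "\<exists>J. finite J \<and> (\<Sum>j\<in>J. (nsol (tail i) (2 * cos k) j)\<^sup>2) > C"
proof -
  define A where "A = bump_mean k0 k"
  have A: "A > 0" using k0 by (simp add: A_def bump_mean_def add_pos_nonneg)
  obtain r1 :: nat where r1: "real r1 > 4 * A" using reals_Archimedean2 by blast
  obtain r2 :: nat where r2: "2 ^ r2 > 4 * C" using real_arch_pow[of 2 "4 * C"] by auto
  define r where "r = max r1 r2"
  define n where "n = i + 1 + r"
  have "4 * A \<le> real n" using r1 by (simp add: n_def r_def)
  then have two: "2 \<le> real n * (1 / (2 * A))" using A by (simp add: le_divide_eq)
  have "4 * C < 2 ^ r2" by (rule r2)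
  also have "\<dots> \<le> 2 ^ Suc r" by (intro power_increasing) (auto simp: r_def)
  also have "\<dots> \<le> (real n * (1 / (2 * A))) ^ Suc r" using two by (intro power_mono) auto
  also have "\<dots> = real n ^ Suc r * (1 / (2 * A)) ^ Suc r" by (rule power_mult_distrib)
  also have "\<dots> \<le> (real (gap n) - 1) * (1 / (2 * A)) ^ Suc r"
  proof (rule mult_right_mono)
    have "n ^ Suc r \<le> n ^ n" by (intro power_increasing) (auto simp: n_def)
    also have "n ^ n + 1 \<le> gap n" by (intro gap) (simp add: n_def)
    finally have "real (n ^ Suc r + 1) \<le> real (gap n)" by (simp only: of_nat_le_iff)
    then show "real n ^ Suc r \<le> real (gap n) - 1" by simp
  qed (use A in simp)
  finally have "C < (real (gap n) - 1) / 4 * (1 / (2 * A)) ^ Suc r" by simp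
  also have "\<dots> \<le> (\<Sum>j\<in>{pos i r..pos i (Suc r)}. (nsol (tail i) (2 * cos k) j)\<^sup>2)"
    using block_sum_ge[OF sin, of i r] by (simp add: A_def n_def)
  finally show ?thesis by blast
qed

lemma nsol_unbounded_if_decay:
  assumes sin: "sin k \<noteq> 0" and lim: "(\<lambda>r. inverse (norm (bump k0 k (amp k0 k (pos i 0) (gaps i r))))) \<longlonglongrightarrow> 0"
  shows "filterlim (\<lambda>r. \<bar>nsol (tail i) (2 * cos k) (pos i (Suc r))\<bar> + \<bar>nsol (tail i) (2 * cos k) (pos i (Suc r) + 1)\<bar>) at_top sequentially"
proof -
  have k0': "real k0 > 0" using k0 by simp
  have "norm (bump k0 k (amp k0 k (pos i 0) (gaps i r))) = norm (osc (tail i) k (pos i (Suc r)))" for r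
    unfolding osc_tail[OF sin] by (simp add: gaps_def amp_snoc norm_mult)
  then have lim': "(\<lambda>r. inverse (norm (osc (tail i) k (pos i (Suc r))))) \<longlonglongrightarrow> 0" using lim by simp
  have "osc (tail i) k (pos i (Suc r)) \<noteq> 0" for r
    unfolding osc_tail[OF sin] by (rule amp_nonzero[OF k0' sin])
  then have "filterlim (\<lambda>r. inverse (inverse (norm (osc (tail i) k (pos i (Suc r)))))) at_top sequentially"
    by (intro filterlim_inverse_at_top lim') auto
  then have "filterlim (\<lambda>r. (1 / sqrt k0) * norm (osc (tail i) k (pos i (Suc r)))) at_top sequentially"
    using k0' by (intro filterlim_tendsto_pos_mult_at_top[OF tendsto_const]) auto
  then show ?thesis
  proof (rule filterlim_at_top_mono, intro always_eventually allI)
    fix r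
    show "(1 / sqrt k0) * norm (osc (tail i) k (pos i (Suc r))) \<le>
      \<bar>nsol (tail i) (2 * cos k) (pos i (Suc r))\<bar> + \<bar>nsol (tail i) (2 * cos k) (pos i (Suc r) + 1)\<bar>"
      using norm_osc_le[of "tail i" "pos i (Suc r)" k] tail_ge tail_pos[of i "Suc r"] k0'
      by (simp add: divide_le_eq mult.commute)
  qed
qed

text \<open>For each start \<open>i\<close> and each window the integrals decay eventually; the
  exceptional phases form a countable union over \<open>i\<close> and \<open>m\<close>, as the
  windows exhaust the open interval.\<close>

lemma negligible_no_decay:
  assumes q: "0 < q" "q < 1"
    and decay: "\<And>i m r. r \<ge> pos i 0 \<Longrightarrow> r \<ge> m \<Longrightarrow>
      decay_integral k0 (1 / (real m + 2)) (pos i 0) (gaps i (Suc r)) \<le> q * decay_integral k0 (1 / (real m + 2)) (pos i 0) (gaps i r)"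
  shows "negligible {k \<in> {0<..<pi}. \<exists>i. \<not> (\<lambda>r. inverse (norm (bump k0 k (amp k0 k (pos i 0) (gaps i r))))) \<longlonglongrightarrow> 0}"
    (is "negligible ?Z")
proof -
  define c where "c m = 1 / (real m + 2)" for m :: nat
  let ?f = "\<lambda>i r k. inverse (norm (bump k0 k (amp k0 k (pos i 0) (gaps i r))))"
  have c: "c m > 0" for m by (simp add: c_def)
  have "negligible {k \<in> {c m..pi - c m}. \<not> (\<lambda>r. ?f i r k) \<longlonglongrightarrow> 0}" for i m
  proof (rule negligible_not_tendsto_0[OF _ _ q, where ?n0.0 = "pos i 0 + m"])
    have sin: "sin k \<noteq> 0" if "k \<in> {c m..pi - c m}" for k
      using sin_gt_zero[of k] that c[of m] by auto
    have nz: "bump k0 k (amp k0 k (pos i 0) (gaps i r)) \<noteq> 0" if "k \<in> {c m..pi - c m}" for k r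
      using k0 sin[OF that] by (intro bump_nonzero amp_nonzero) auto
    have "continuous_on {c m..pi - c m} (\<lambda>k. bump k0 k (amp k0 k (pos i 0) (gaps i r)))" for r
      using k0 sin by (intro continuous_intros continuous_on_amp) auto
    then show "continuous_on {c m..pi - c m} (?f i r)" for r
      using nz by (intro continuous_on_inverse continuous_on_norm) auto
    show "integral {c m..pi - c m} (?f i (Suc r)) \<le> q * integral {c m..pi - c m} (?f i r)" if "r \<ge> pos i 0 + m" for r
      using decay[of i r m] that by (simp add: decay_integral_def c_def)
  qed simp
  then have "negligible (\<Union>(i, m)\<in>UNIV. {k \<in> {c m..pi - c m}. \<not> (\<lambda>r. ?f i r k) \<longlonglongrightarrow> 0})"
    by (intro negligible_countable_Union countable_image) auto
  moreover have "?Z \<subseteq> (\<Union>(i, m)\<in>UNIV. {k \<in> {c m..pi - c m}. \<not> (\<lambda>r. ?f i r k) \<longlonglongrightarrow> 0})"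
  proof
    fix k assume "k \<in> ?Z"
    then obtain i where i: "0 < k" "k < pi" "\<not> (\<lambda>r. ?f i r k) \<longlonglongrightarrow> 0" by auto
    obtain m :: nat where m: "real m > 1 / k + 1 / (pi - k)" using reals_Archimedean2 by blast
    have "1 / k > 0" "1 / (pi - k) > 0" using i by simp_all
    then have "1 / k \<le> real m + 2" "1 / (pi - k) \<le> real m + 2" using m by linarith+
    then have "c m \<le> k" "c m \<le> pi - k" using i by (simp_all add: c_def field_simps)
    then show "k \<in> (\<Union>(i, m)\<in>UNIV. {k \<in> {c m..pi - c m}. \<not> (\<lambda>r. ?f i r k) \<longlonglongrightarrow> 0})"
      using i(3) by (intro UN_I[of "(i, m)"]) auto
  qed
  ultimately show ?thesis by (rule negligible_subset)
qed

end

lemma energy_phase: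
  assumes "t \<in> {-2<..<2::real}"
  obtains k where "0 < k" "k < pi" "t = 2 * cos k" "sin k \<noteq> 0"
proof (rule that)
  let ?k = "arccos (t / 2)"
  show "0 < ?k" "?k < pi" using arccos_lt_bounded[of "t / 2"] assms by auto
  then show "sin ?k \<noteq> 0" using sin_gt_zero by force
  show "t = 2 * cos ?k" using assms by (simp add: cos_arccos)
qed

section \<open>From amplitudes to spectral measures\<close>

context sh_calculus
begin

lemma purely_singular_continuous:
  assumes bl: "bump_levels k0 L \<kappa>"
    and gap: "\<And>n. n \<ge> 1 \<Longrightarrow> bump_levels.gap L n \<ge> n ^ n + 1"
    and q: "0 < q" "q < 1"
    and decay: "\<And>i m r. r \<ge> bump_levels.pos L i 0 \<Longrightarrow> r \<ge> m \<Longrightarrow>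
      decay_integral k0 (1 / (real m + 2)) (bump_levels.pos L i 0) (bump_levels.gaps L i (Suc r)) \<le>
      q * decay_integral k0 (1 / (real m + 2)) (bump_levels.pos L i 0) (bump_levels.gaps L i r)"
    and \<psi>: "\<psi> \<in> l2 V" and \<mu>: "sets \<mu> = sets borel" "finite_measure \<mu>"
      "\<And>g. g \<in> bounded_borel \<Longrightarrow> l2_inner V \<psi> (\<Phi> g \<psi>) = (\<integral>t. g t \<partial>\<mu>)"
  shows "purely_singular_continuous_on {-2<..<2} \<mu>"
proof -
  interpret bump_levels k0 L \<kappa> by (rule bl)
  interpret \<mu>: finite_measure \<mu> by (rule \<mu>(2))
  \<comment> \<open>The measure of \<open>B\<close> is the inner product of \<open>\<psi>\<close>
    with \<open>\<Phi> (ind B) \<psi>\<close>.\<close>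
  have \<mu>0: "emeasure \<mu> B = 0" if B: "B \<in> sets borel" and P: "\<Phi> (ind B) \<psi> = (\<lambda>x. 0)" for B
  proof -
    have "(\<integral>t. ind B t \<partial>\<mu>) = 0"
      using \<mu>(3)[OF ind_bounded_borel[OF B]] unfolding P by (simp add: l2_inner_def)
    moreover have "ind B = (\<lambda>t. indicator B t *\<^sub>R (1::complex))" by (auto simp: ind_def indicator_def)
    ultimately have "(\<integral>t. indicator B t *\<^sub>R (1::complex) \<partial>\<mu>) = 0" by simp
    moreover have "B \<in> sets \<mu>" using B \<mu>(1) by simp
    then have "(\<integral>t. indicator B t *\<^sub>R (1::complex) \<partial>\<mu>) = measure \<mu> B *\<^sub>R 1"
      by (subst integral_scaleR_left) (auto simp: \<mu>.emeasure_finite less_top[symmetric] sets.Int_space_eq2)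
    ultimately have "measure \<mu> B = 0" by simp
    then show ?thesis by (simp add: \<mu>.emeasure_eq_measure)
  qed
  \<comment> \<open>Two or more children occur only on levels \<open>L i\<close>, so every generator
    that totality asks for starts at some \<open>start i\<close>.\<close>
  have P0: "\<Phi> (ind B) \<psi> = (\<lambda>x. 0)" if B: "B \<in> sets borel"
    and gen: "\<And>i \<phi>. generator (start i) \<phi> \<Longrightarrow> \<Phi> (ind B) \<phi> = (\<lambda>x. 0)" for B
  proof (rule Phi_eq_0_if_generators[OF ind_bounded_borel[OF B] _ _ _ \<psi>])
    show "cnj (ind B t) = ind B t" for t by (simp add: ind_def)
    show "\<Phi> (ind B) \<phi> = (\<lambda>x. 0)" if "generator 0 \<phi>" for \<phi>
      using gen[of 0 \<phi>] that by (simp add: start_def)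
    show "\<Phi> (ind B) \<phi> = (\<lambda>x. 0)" if k: "\<kappa> m \<ge> 2" and "generator (m + 1) \<phi>" for m \<phi>
    proof -
      have "m \<in> L ` {1..}" using kappa_free[of m] k by (cases "m \<in> L ` {1..}") auto
      then obtain i where "i \<ge> 1" "m = L i" by auto
      then show ?thesis using gen[of i \<phi>] that by (simp add: start_def)
    qed
  qed
  have tail_eq: "(\<lambda>j. \<kappa> (start i + j)) = tail i" for i by (simp add: tail_def fun_eq_iff)
  have atoms: "emeasure \<mu> {E} = 0" if E: "E \<in> {-2<..<2}" for E
  proof (rule \<mu>0[OF _ P0])
    fix i \<phi> assume gen: "generator (start i) \<phi>"
    obtain k where k: "E = 2 * cos k" "sin k \<noteq> 0" using energy_phase[OF E] by metis
    show "\<Phi> (ind {E}) \<phi> = (\<lambda>x. 0)"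
      by (rule no_atom[OF gen]) (use E nsol_sum_unbounded[OF gap k(2)] in \<open>auto simp: tail_eq k(1)\<close>)
  qed auto
  define Z where "Z = {k \<in> {0<..<pi}. \<exists>i. \<not> (\<lambda>r. inverse (norm (bump k0 k (amp k0 k (pos i 0) (gaps i r))))) \<longlonglongrightarrow> 0}"
  have "negligible ((\<lambda>k. 2 * cos k) ` Z)"
  proof (rule negligible_differentiable_image_negligible)
    show "negligible Z" unfolding Z_def by (rule negligible_no_decay[OF q decay])
    show "(\<lambda>k. 2 * cos k) differentiable_on Z"
      by (intro derivative_intros differentiable_at_imp_differentiable_on) (auto simp: differentiable_def intro!: derivative_eq_intros)
  qed simp
  \<comment> \<open>\<open>negligible\<close> refers to the completed Lebesgue measure; a Borel null
    superset is taken because \<open>\<mu>\<close> lives on Borel sets.\<close>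
  then obtain N where N: "N \<in> null_sets lborel" "(\<lambda>k. 2 * cos k) ` Z \<subseteq> N"
    unfolding negligible_iff_null_sets null_sets_completion_iff2 by blast
  have "emeasure \<mu> ({-2<..<2} - N) = 0"
  proof (rule \<mu>0[OF _ P0])
    have "N \<in> sets borel" using N(1) by auto
    then show B: "{-2<..<2} - N \<in> sets borel" by auto
    then show "{-2<..<2} - N \<in> sets borel" .
    fix i \<phi> assume gen: "generator (start i) \<phi>"
    show "\<Phi> (ind ({-2<..<2} - N)) \<phi> = (\<lambda>x. 0)"
    proof (rule Phi_ind_eq_0_if_unbounded[OF gen B, where J = "\<lambda>r. pos i (Suc r)"])
      fix t assume t: "t \<in> {-2<..<2} - N"
      obtain k where k: "0 < k" "k < pi" "t = 2 * cos k" "sin k \<noteq> 0" using energy_phase[of t] t by blast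
      have "k \<notin> Z" using t N(2) k(3) by auto
      then have "(\<lambda>r. inverse (norm (bump k0 k (amp k0 k (pos i 0) (gaps i r))))) \<longlonglongrightarrow> 0"
        using k by (auto simp: Z_def)
      from nsol_unbounded_if_decay[OF k(4) this]
      show "filterlim (\<lambda>r. \<bar>nsol (\<lambda>j. \<kappa> (start i + j)) t (pos i (Suc r))\<bar> + \<bar>nsol (\<lambda>j. \<kappa> (start i + j)) t (pos i (Suc r) + 1)\<bar>) at_top sequentially"
        unfolding tail_eq k(3) .
    qed auto
  qed
  with atoms N(1) show ?thesis unfolding purely_singular_continuous_on_def by blast
qed

end

section \<open>Choice of the thresholds\<close>

theorem theorem2p2:
  fixes k0 :: nat
  assumes "k0 \<ge> 2"
  shows
    "(\<forall>(L :: nat \<Rightarrow> nat) (V :: 'v set) adj rt.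
        strict_mono_on {1..} L \<and>
        filterlim (\<lambda>n. L (n + 1) - L n) at_top sequentially \<and>
        SH_rooted_tree_of_type V adj rt L (\<lambda>n. k0) \<longrightarrow>
        complex_of_real ` {-2..2} \<subseteq> essential_spectrum V (laplacian V adj))
     \<and>
     (\<exists>F :: nat \<Rightarrow> nat list \<Rightarrow> nat.
        \<forall>(L :: nat \<Rightarrow> nat) (V :: 'v set) adj rt.
          strict_mono_on {1..} L \<and>
          filterlim (\<lambda>n. L (n + 1) - L n) at_top sequentially \<and>
          (\<forall>n\<ge>1. L (n + 1) - L n \<ge> F n (map (\<lambda>i. L (i + 1) - L i) [1..<n])) \<and>
          SH_rooted_tree_of_type V adj rt L (\<lambda>n. k0) \<longrightarrow>
          (\<forall>\<psi>\<in>l2 V. \<forall>\<mu>. spectral_measure V (laplacian V adj) \<psi> \<mu> \<longrightarrow>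
             purely_singular_continuous_on {-2<..<2} \<mu>))"
proof (intro conjI allI impI)
  have struct: "\<exists>\<kappa>. bump_levels k0 L \<kappa> \<and> sh_tree V adj rt \<kappa> k0"
    if L: "strict_mono_on {1..} L" and SH: "SH_rooted_tree_of_type V adj rt L (\<lambda>n. k0)"
    for L and V :: "'v set" and adj rt
  proof -
    obtain \<kappa> where \<kappa>: "SH_rooted_tree V adj rt \<kappa>" "\<And>n. n \<ge> 1 \<Longrightarrow> \<kappa> (L n) = k0"
      "\<And>j. j \<notin> L ` {1..} \<Longrightarrow> \<kappa> j = 1"
      using SH by (auto simp: SH_rooted_tree_of_type_def)
    have "\<kappa> j \<ge> 1 \<and> \<kappa> j \<le> k0" for j
      using \<kappa>(2,3) assms by (cases "j \<in> L ` {1..}") auto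
    then have "bump_levels k0 L \<kappa> \<and> sh_tree V adj rt \<kappa> k0"
      using \<kappa> L assms by (auto simp: bump_levels_def sh_tree_def)
    then show ?thesis by blast
  qed
  {
    fix L :: "nat \<Rightarrow> nat" and V :: "'v set" and adj rt
    assume *: "strict_mono_on {1..} L \<and>
        filterlim (\<lambda>n. L (n + 1) - L n) at_top sequentially \<and>
        SH_rooted_tree_of_type V adj rt L (\<lambda>n. k0)"
    then obtain \<kappa> where "bump_levels k0 L \<kappa>" "sh_tree V adj rt \<kappa> k0" using struct by blast
    then interpret bump_levels k0 L \<kappa> + sh_tree V adj rt \<kappa> k0 by simp_all
    show "complex_of_real ` {-2..2} \<subseteq> essential_spectrum V (laplacian V adj)"
    proof (rule essential_spectrum_if_long_free_stretches)
      fix n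
      \<comment> \<open>A gap of \<open>n + 2\<close> leaves the \<open>n + 1\<close> levels from
        \<open>L p + 1\<close> to \<open>L p + 1 + n\<close> strictly between two branching
        levels.\<close>
      have "eventually (\<lambda>p. L (p + 1) - L p \<ge> n + 2) sequentially"
        using * by (auto simp: filterlim_at_top)
      then have "eventually (\<lambda>p. p \<ge> 1 \<and> L (p + 1) - L p \<ge> n + 2) sequentially"
        by (intro eventually_conj eventually_ge_at_top)
      then obtain p where p: "p \<ge> 1" "L (p + 1) - L p \<ge> n + 2"
        using eventually_happens'[OF sequentially_bot] by blast
      have "\<kappa> j = 1" if j: "L p + 1 \<le> j" "j \<le> L p + 1 + n" for j
      proof (rule kappa_free, rule notI)
        assume "j \<in> L ` {1..}"
        then obtain s where s: "s \<ge> 1" "j = L s" by auto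
        then have "L p < L s" "L s < L (p + 1)" using j p by auto
        then show False using L_less_iff[of p s] L_less_iff[of s "p + 1"] s p by simp
      qed
      then show "\<exists>b. \<forall>j. b \<le> j \<and> j \<le> b + n \<longrightarrow> \<kappa> j = 1" by blast
    qed
  }
  \<comment> \<open>The midpoint leaves room on both sides: above the rate to absorb averaging
    errors, below 1 for geometric decay.\<close>
  define q where "q = (bump_rate k0 + 1) / 2"
  have k0': "real k0 > 1" using assms by simp
  have q: "0 < q" "q < 1" "bump_rate k0 < q" using bump_rate[OF k0'] by (auto simp: q_def)
  have ex: "\<exists>l0. \<forall>l\<ge>l0. decay_integral k0 (1 / (real m + 2)) d (gs @ [l]) \<le> q * decay_integral k0 (1 / (real m + 2)) d gs" for d gs m
  proof (rule decay_integral_contraction[OF k0' _ _ q(3)])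
    have "1 / (real m + 2) \<le> 1 / 2" by (rule divide_left_mono) auto
    then show "1 / (real m + 2) < pi / 2" using pi_gt_zero pi_ge_two by linarith
  qed simp
  define T where "T d gs m = (SOME l0. \<forall>l\<ge>l0.
      decay_integral k0 (1 / (real m + 2)) d (gs @ [l]) \<le> q * decay_integral k0 (1 / (real m + 2)) d gs)" for d gs m
  have T: "decay_integral k0 (1 / (real m + 2)) d (gs @ [l]) \<le> q * decay_integral k0 (1 / (real m + 2)) d gs"
    if "l \<ge> T d gs m" for d gs m l
    using someI_ex[OF ex, of m d gs] that unfolding T_def by blast
  \<comment> \<open>The first term excludes atoms. The sum dominates the thresholds for all windows
    \<open>m\<close>, for all distances \<open>d\<close> up to \<open>n\<close> (since
    \<open>L 1\<close> is not an argument), and for all suffixes of the gap list, because the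
    subspace starting at \<open>start i\<close> sees only the gaps after the
    \<open>i\<close>-th.\<close>
  define F where "F n ds = n ^ n + 1 + (\<Sum>d\<le>n. \<Sum>j\<le>length ds. \<Sum>m\<le>n. T d (drop j ds) m)" for n ds
  have F1: "F n ds \<ge> n ^ n + 1" for n ds by (simp add: F_def)
  have F2: "F n ds \<ge> T d (drop j ds) m" if "d \<le> n" "j \<le> length ds" "m \<le> n" for n ds d j m
  proof -
    have "T d (drop j ds) m \<le> (\<Sum>m\<le>n. T d (drop j ds) m)"
      using that by (intro member_le_sum) auto
    also have "\<dots> \<le> (\<Sum>j\<le>length ds. \<Sum>m\<le>n. T d (drop j ds) m)"
      using that by (intro member_le_sum[where f = "\<lambda>j. \<Sum>m\<le>n. T d (drop j ds) m"]) auto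
    also have "\<dots> \<le> (\<Sum>d\<le>n. \<Sum>j\<le>length ds. \<Sum>m\<le>n. T d (drop j ds) m)"
      using that by (intro member_le_sum[where f = "\<lambda>d. \<Sum>j\<le>length ds. \<Sum>m\<le>n. T d (drop j ds) m"]) auto
    finally show ?thesis by (simp add: F_def)
  qed
  show "\<exists>F :: nat \<Rightarrow> nat list \<Rightarrow> nat.
        \<forall>(L :: nat \<Rightarrow> nat) (V :: 'v set) adj rt.
          strict_mono_on {1..} L \<and>
          filterlim (\<lambda>n. L (n + 1) - L n) at_top sequentially \<and>
          (\<forall>n\<ge>1. L (n + 1) - L n \<ge> F n (map (\<lambda>i. L (i + 1) - L i) [1..<n])) \<and>
          SH_rooted_tree_of_type V adj rt L (\<lambda>n. k0) \<longrightarrow>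
          (\<forall>\<psi>\<in>l2 V. \<forall>\<mu>. spectral_measure V (laplacian V adj) \<psi> \<mu> \<longrightarrow>
             purely_singular_continuous_on {-2<..<2} \<mu>)"
  proof (intro exI[of _ F] allI impI ballI)
    fix L :: "nat \<Rightarrow> nat" and V :: "'v set" and adj rt \<psi> \<mu>
    assume *: "strict_mono_on {1..} L \<and>
          filterlim (\<lambda>n. L (n + 1) - L n) at_top sequentially \<and>
          (\<forall>n\<ge>1. L (n + 1) - L n \<ge> F n (map (\<lambda>i. L (i + 1) - L i) [1..<n])) \<and>
          SH_rooted_tree_of_type V adj rt L (\<lambda>n. k0)"
      and \<psi>: "\<psi> \<in> l2 V" and sm: "spectral_measure V (laplacian V adj) \<psi> \<mu>"
    obtain \<kappa> where bl: "bump_levels k0 L \<kappa>" and sh: "sh_tree V adj rt \<kappa> k0" using struct * by blast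
    interpret bump_levels k0 L \<kappa> by (rule bl)
    obtain \<Phi> where \<Phi>: "borel_functional_calculus V (laplacian V adj) \<Phi>"
      and \<mu>: "sets \<mu> = sets borel" "finite_measure \<mu>"
        "\<And>g. g \<in> bounded_borel \<Longrightarrow> l2_inner V \<psi> (\<Phi> g \<psi>) = (\<integral>t. g t \<partial>\<mu>)"
      using sm unfolding spectral_measure_def by blast
    interpret sh_calculus V adj rt \<kappa> k0 \<Phi>
      using sh \<Phi> by (simp add: sh_calculus_def sh_calculus_axioms_def)
    have gapF: "gap n \<ge> F n (map gap [1..<n])" if "n \<ge> 1" for n
      using * that unfolding gap_def by blast
    show "purely_singular_continuous_on {-2<..<2} \<mu>"
    proof (rule purely_singular_continuous[OF bl _ q(1,2) _ \<psi> \<mu>])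
      show "gap n \<ge> n ^ n + 1" if "n \<ge> 1" for n
        using gapF[OF that] F1 order_trans by blast
      fix i m r :: nat assume r: "r \<ge> pos i 0" "r \<ge> m"
      \<comment> \<open>The index of the gap that is appended when \<open>gaps i r\<close> grows to
        \<open>gaps i (Suc r)\<close>.\<close>
      define n where "n = i + 1 + r"
      have "drop i (map gap [1..<n]) = map gap [1 + i..<n]" by (simp add: drop_map)
      also have "\<dots> = gaps i r"
        by (rule nth_equalityI) (auto simp: gaps_def n_def simp del: upt_Suc)
      finally have ds: "drop i (map gap [1..<n]) = gaps i r" .
      have "T (pos i 0) (drop i (map gap [1..<n])) m \<le> F n (map gap [1..<n])"
        using r by (intro F2) (auto simp: n_def)
      also have "\<dots> \<le> gap n" by (intro gapF) (simp add: n_def)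
      finally have "gap n \<ge> T (pos i 0) (gaps i r) m" unfolding ds .
      from T[OF this]
      show "decay_integral k0 (1 / (real m + 2)) (pos i 0) (gaps i (Suc r)) \<le>
          q * decay_integral k0 (1 / (real m + 2)) (pos i 0) (gaps i r)"
        by (simp add: gaps_def n_def)
    qed
  qed
qed

end
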